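(* Let $B=\bigoplus_{n\geq 0}B_n$ be a finitely semi-graded ring generated in degree $1$ such that $B_0=K$ is a field and $B$ is a $K$-algebra. Let $P(B)$ be the collection of isomorphism classes $[M]$ of point modules $M$ for $B$, and let $\sim$ be the relation on $P(B)$ defined by $$[M]\sim [M']\iff Gr(M)\cong Gr(M').$$ Then: (i) There is an injective function $$(P(B)/\sim)\xrightarrow{\ \alpha\ } P(Gr(B)).$$ (ii) Let $X$ be a $K$-scheme that parametrizes $P(Gr(B))$. Then there is an injective function $\widetilde{\alpha}$ from $(P(B)/\sim)$ to the set of closed points of $X$.
   Context: All modules are left modules and $\mathbb{N}=\{0,1,2,\dots\}$. **Semi-graded rings and modules.** A ring $B$ is semi-graded (SG) if there is a collection $\{B_n\}_{n\ge 0}$ of additive subgroups of $B$ with $B=\bigoplus_{n\geq 0}B_n$, $B_mB_n\subseteq B_0\oplus\cdots\oplus B_{m+n}$ for all $m,n\ge 0$, and $1\in B_0$. It is finitely semi-graded (FSG) if moreover there are finitely many $x_1,\dots,x_k\in B$ such that the subring generated by $B_0$ and $x_1,\dots,x_k$ is $B$, and each $B_n$ is a free $B_0$-module of finite dimension. It is generated in degree $1$ if such generators $x_1,\dots,x_k$ can be chosen in $B_1$. A $B$-module $M$ is $\mathbb{N}$-semi-graded if $M=\bigoplus_{n\ge 0}M_n$ for additive subgroups $M_n$ with $B_mM_n\subseteq \bigoplus_{0\le k\leq m+n}M_k$ for all $m,n\geq 0$. It is finitely $\mathbb{N}$-semi-graded if moreover it is finitely generated and each $M_n$ is a free $B_0$-module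 of finite dimension. A homomorphism $f:M\to N$ of semi-graded $B$-modules is homogeneous if $f(M_n)\subseteq N_n$ for all $n$. **Point modules of $B$.** A point module for $B$ is a finitely $\mathbb{N}$-semi-graded $B$-module $M=\bigoplus_{n\ge0}M_n$ such that $M=Bm_0$ for some $m_0\in M_0$ and $\dim_{B_0}(M_n)=1$ for all $n\geq 0$. Two point modules are isomorphic if there is a homogeneous $B$-isomorphism between them. **Associated graded objects.** $Gr(B)$ is the associated graded ring of the filtration $F_n(B)=B_0\oplus\cdots\oplus B_n$, so $Gr(B)_n=F_n(B)/F_{n-1}(B)\cong B_n$ as $K$-vector spaces; it is an $\mathbb{N}$-graded $K$-algebra with $Gr(B)_0=K$. For an $\mathbb{N}$-semi-graded $B$-module $M$, $Gr(M)=\bigoplus_{n\ge 0}Gr(M)_n$ with $Gr(M)_n=(M_0\oplus\cdots\oplus M_n)/(M_0\oplus\cdots\oplus M_{n-1})$, which is a graded $Gr(B)$-module via $\overline{b_p}\cdot\overline{m_n}:=\overline{b_pm_n}\in Gr(M)_{p+n}$ for $b_p\in B_p$, $m_n\in M_n$. The isomorphism $Gr(M)\cong Gr(M')$ is a homogeneous (degree-preserving) isomorphism of $Gr(B)$-modules. **Point modules of $C=Gr(B)$.** For an $\mathbb{N}$-graded $K$-algebra $C$ with $C_0=K$, a point module is a graded $C$-module $N=\bigoplus_{n\ge 0}N_n$ with $N=Cn_0$ for some $n_0\in N_0$ and $\dim_K N_n=1$ for all $n\ge 0$. $P(C)$ is the collection of classes of point modules for $C$ up to degree-preserving isomorphism.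 **Parametrization.** For a commutative $K$-algebra $S$, an $S$-point module for $C$ is an $\mathbb{N}$-graded $S\otimes_K C$-module $N=\bigoplus_{n\ge 0}N_n$ which is cyclic, generated in degree $0$, with $N_0=S$ and each $N_n$ a locally free $S$-module of rank $1$. $P(C;S)$ is the set of (isomorphism classes of) $S$-point modules for $C$. The point functor $P$ for $C$ is the covariant functor from commutative $K$-algebras to sets given by $S\mapsto P(C;S)$, where a morphism $S\to T$ is sent to $P(C;S)\to P(C;T)$, $N\mapsto T\otimes_S N$. A $K$-scheme $X$ parametrizes $P(C)$ (the point modules of $C$) if the point functor $P$ for $C$ is naturally isomorphic to the functor of points $h_X: S\mapsto \mathrm{Hom}_K(\mathrm{Spec}\,S,X)$. *)

theory Defs
  imports "HOL-Algebra.Module" "HOL-Algebra.Ideal" "HOL-Algebra.Generated_Rings"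
    "HOL-Algebra.Free_Abelian_Groups" "HOL-Analysis.Abstract_Topology"
begin

section \<open>Left modules\<close>

text \<open>The locale \<^locale>\<open>module\<close> of the library is restricted to commutative rings; its record type
  is reused here for left modules over arbitrary rings. The fields \<open>mult\<close> and \<open>one\<close> of such a record
  carry no information.\<close>

definition left_module :: "'r ring \<Rightarrow> ('r, 'm) module \<Rightarrow> bool" where
  "left_module R M \<longleftrightarrow> ring R \<and> abelian_group M \<and>
     (\<forall>a\<in>carrier R. \<forall>x\<in>carrier M. a \<odot>\<^bsub>M\<^esub> x \<in> carrier M) \<and>
     (\<forall>a\<in>carrier R. \<forall>b\<in>carrier R. \<forall>x\<in>carrier M. (a \<oplus>\<^bsub>R\<^esub> b) \<odot>\<^bsub>M\<^esub> x = a \<odot>\<^bsub>M\<^esub> x \<oplus>\<^bsub>M\<^esub> b \<odot>\<^bsub>M\<^esub> x) \<and>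
     (\<forall>a\<in>carrier R. \<forall>x\<in>carrier M. \<forall>y\<in>carrier M. a \<odot>\<^bsub>M\<^esub> (x \<oplus>\<^bsub>M\<^esub> y) = a \<odot>\<^bsub>M\<^esub> x \<oplus>\<^bsub>M\<^esub> a \<odot>\<^bsub>M\<^esub> y) \<and>
     (\<forall>a\<in>carrier R. \<forall>b\<in>carrier R. \<forall>x\<in>carrier M. (a \<otimes>\<^bsub>R\<^esub> b) \<odot>\<^bsub>M\<^esub> x = a \<odot>\<^bsub>M\<^esub> (b \<odot>\<^bsub>M\<^esub> x)) \<and>
     (\<forall>x\<in>carrier M. \<one>\<^bsub>R\<^esub> \<odot>\<^bsub>M\<^esub> x = x)"

definition regular_module :: "'r ring \<Rightarrow> ('r, 'r) module" where
  "regular_module R = \<lparr>carrier = carrier R, monoid.mult = monoid.mult R, monoid.one = \<one>\<^bsub>R\<^esub>,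
     ring.zero = \<zero>\<^bsub>R\<^esub>, ring.add = ring.add R, smult = monoid.mult R\<rparr>"

definition restrict_scalars :: "('k \<Rightarrow> 'r) \<Rightarrow> ('r, 'm) module \<Rightarrow> ('k, 'm) module" where
  "restrict_scalars \<phi> M = \<lparr>carrier = carrier M, monoid.mult = monoid.mult M, monoid.one = \<one>\<^bsub>M\<^esub>,
     ring.zero = \<zero>\<^bsub>M\<^esub>, ring.add = ring.add M, smult = (\<lambda>k x. \<phi> k \<odot>\<^bsub>M\<^esub> x)\<rparr>"

definition module_iso ::
    "'r ring \<Rightarrow> ('r, 'm) module \<Rightarrow> ('r, 'n) module \<Rightarrow> ('m \<Rightarrow> 'n) \<Rightarrow> bool" where
  "module_iso R M N h \<longleftrightarrow> bij_betw h (carrier M) (carrier N) \<and>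
     (\<forall>x\<in>carrier M. \<forall>y\<in>carrier M. h (x \<oplus>\<^bsub>M\<^esub> y) = h x \<oplus>\<^bsub>N\<^esub> h y) \<and>
     (\<forall>a\<in>carrier R. \<forall>x\<in>carrier M. h (a \<odot>\<^bsub>M\<^esub> x) = a \<odot>\<^bsub>N\<^esub> h x)"

definition finitely_generated :: "'r ring \<Rightarrow> ('r, 'm) module \<Rightarrow> bool" where
  "finitely_generated R M \<longleftrightarrow> (\<exists>X. finite X \<and> X \<subseteq> carrier M \<and>
     (\<forall>x\<in>carrier M. \<exists>c\<in>X \<rightarrow> carrier R. x = (\<Oplus>\<^bsub>M\<^esub>v\<in>X. c v \<odot>\<^bsub>M\<^esub> v)))"

text \<open>A left module that is free with a basis \<open>e\<^sub>0, \<dots>, e\<^bsub>r-1\<^esub>\<close>.\<close>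

definition free_of_rank :: "'r ring \<Rightarrow> ('r, 'm) module \<Rightarrow> nat \<Rightarrow> bool" where
  "free_of_rank R V r \<longleftrightarrow> left_module R V \<and> (\<exists>e\<in>{..<r} \<rightarrow> carrier V.
     \<forall>v\<in>carrier V. \<exists>!c. c \<in> {..<r} \<rightarrow>\<^sub>E carrier R \<and> v = (\<Oplus>\<^bsub>V\<^esub>i\<in>{..<r}. c i \<odot>\<^bsub>V\<^esub> e i))"


section \<open>Semi-graded rings and modules\<close>

definition direct_sum :: "('m, 'x) ring_scheme \<Rightarrow> (nat \<Rightarrow> 'm set) \<Rightarrow> bool" where
  "direct_sum M Mn \<longleftrightarrow> (\<forall>n. subgroup (Mn n) (add_monoid M)) \<and>
     (\<forall>x\<in>carrier M. \<exists>!f. (\<forall>n. f n \<in> Mn n) \<and> finite {n. f n \<noteq> \<zero>\<^bsub>M\<^esub>} \<and>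
        x = (\<Oplus>\<^bsub>M\<^esub>n\<in>{n. f n \<noteq> \<zero>\<^bsub>M\<^esub>}. f n))"

text \<open>\<open>filt M Mn n\<close> is \<open>M\<^sub>0 + \<dots> + M\<^bsub>n-1\<^esub>\<close> (so it is zero for \<open>n = 0\<close>); the \<open>n\<close>-th step of the usual
  filtration is \<open>filt M Mn (Suc n)\<close>.\<close>

definition filt :: "('m, 'x) ring_scheme \<Rightarrow> (nat \<Rightarrow> 'm set) \<Rightarrow> nat \<Rightarrow> 'm set" where
  "filt M Mn n = {(\<Oplus>\<^bsub>M\<^esub>i\<in>{..<n}. f i) | f. \<forall>i<n. f i \<in> Mn i}"

definition semi_graded_ring :: "'b ring \<Rightarrow> (nat \<Rightarrow> 'b set) \<Rightarrow> bool" where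
  "semi_graded_ring B Bn \<longleftrightarrow> ring B \<and> direct_sum B Bn \<and>
     (\<forall>m n. \<forall>a\<in>Bn m. \<forall>b\<in>Bn n. a \<otimes>\<^bsub>B\<^esub> b \<in> filt B Bn (Suc (m + n))) \<and> \<one>\<^bsub>B\<^esub> \<in> Bn 0"

abbreviation base_ring :: "'b ring \<Rightarrow> (nat \<Rightarrow> 'b set) \<Rightarrow> 'b ring" where
  "base_ring B Bn \<equiv> B\<lparr>carrier := Bn 0\<rparr>"

definition finitely_semi_graded_ring :: "'b ring \<Rightarrow> (nat \<Rightarrow> 'b set) \<Rightarrow> bool" where
  "finitely_semi_graded_ring B Bn \<longleftrightarrow> semi_graded_ring B Bn \<and>
     (\<exists>X. finite X \<and> X \<subseteq> carrier B \<and> generate_ring B (Bn 0 \<union> X) = carrier B) \<and>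
     (\<forall>n. \<exists>r. free_of_rank (base_ring B Bn) ((regular_module B)\<lparr>carrier := Bn n\<rparr>) r)"

definition generated_in_degree_one :: "'b ring \<Rightarrow> (nat \<Rightarrow> 'b set) \<Rightarrow> bool" where
  "generated_in_degree_one B Bn \<longleftrightarrow>
     (\<exists>X. finite X \<and> X \<subseteq> Bn 1 \<and> generate_ring B (Bn 0 \<union> X) = carrier B)"

type_synonym ('r, 'm) gmod = "('r, 'm) module \<times> (nat \<Rightarrow> 'm set)"

definition semi_graded_module :: "'b ring \<Rightarrow> (nat \<Rightarrow> 'b set) \<Rightarrow> ('b, 'm) gmod \<Rightarrow> bool" where
  "semi_graded_module B Bn = (\<lambda>(M, Mn). left_module B M \<and> direct_sum M Mn \<and>
     (\<forall>m n. \<forall>b\<in>Bn m. \<forall>x\<in>Mn n. b \<odot>\<^bsub>M\<^esub> x \<in> filt M Mn (Suc (m + n))))"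

definition finitely_semi_graded_module ::
    "'b ring \<Rightarrow> (nat \<Rightarrow> 'b set) \<Rightarrow> ('b, 'm) gmod \<Rightarrow> bool" where
  "finitely_semi_graded_module B Bn = (\<lambda>(M, Mn). semi_graded_module B Bn (M, Mn) \<and>
     finitely_generated B M \<and>
     (\<forall>n. \<exists>r. free_of_rank (base_ring B Bn) (M\<lparr>carrier := Mn n\<rparr>) r))"

definition cyclic_in_degree_zero :: "'r ring \<Rightarrow> ('r, 'm) gmod \<Rightarrow> bool" where
  "cyclic_in_degree_zero R = (\<lambda>(M, Mn). \<exists>x\<in>Mn 0. carrier M = {b \<odot>\<^bsub>M\<^esub> x | b. b \<in> carrier R})"

text \<open>Point modules of a semi-graded ring.\<close>

definition sg_point_module :: "'b ring \<Rightarrow> (nat \<Rightarrow> 'b set) \<Rightarrow> ('b, 'm) gmod \<Rightarrow> bool" where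
  "sg_point_module B Bn = (\<lambda>(M, Mn). finitely_semi_graded_module B Bn (M, Mn) \<and>
     cyclic_in_degree_zero B (M, Mn) \<and>
     (\<forall>n. free_of_rank (base_ring B Bn) (M\<lparr>carrier := Mn n\<rparr>) 1))"

definition homogeneous_iso :: "'r ring \<Rightarrow> ('r, 'm) gmod \<Rightarrow> ('r, 'n) gmod \<Rightarrow> bool" where
  "homogeneous_iso R = (\<lambda>(M, Mn) (N, Nn). \<exists>h. module_iso R M N h \<and> (\<forall>n. h ` Mn n \<subseteq> Nn n))"

definition iso_classes :: "'r ring \<Rightarrow> ('r, 'm) gmod set \<Rightarrow> ('r, 'm) gmod set set" where
  "iso_classes R A = A // {(M, N). M \<in> A \<and> N \<in> A \<and> homogeneous_iso R M N}"

text \<open>\<open>P(B)\<close>. The type \<open>'m\<close> of module elements is a parameter. A cyclic module has at most as many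
  elements as its ring, so every isomorphism class is already represented for \<open>'m = 'b\<close>.\<close>

definition sg_point_classes :: "'b ring \<Rightarrow> (nat \<Rightarrow> 'b set) \<Rightarrow> ('b, 'm) gmod set set" where
  "sg_point_classes B Bn = iso_classes B {M. sg_point_module B Bn M}"


section \<open>Associated graded rings and modules\<close>

text \<open>An element of the external direct sum of the quotients \<open>F\<^sub>n(M)/F\<^bsub>n-1\<^esub>(M)\<close> is a family of cosets,
  almost all of which are zero.\<close>

definition gr_carrier :: "('m, 'x) ring_scheme \<Rightarrow> (nat \<Rightarrow> 'm set) \<Rightarrow> (nat \<Rightarrow> 'm set) set" where
  "gr_carrier M Mn = {g. (\<forall>n. g n \<in> {filt M Mn n +>\<^bsub>M\<^esub> x | x. x \<in> filt M Mn (Suc n)}) \<and>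
     finite {n. g n \<noteq> filt M Mn n}}"

definition gr_comp :: "('m, 'x) ring_scheme \<Rightarrow> (nat \<Rightarrow> 'm set) \<Rightarrow> nat \<Rightarrow> (nat \<Rightarrow> 'm set) set" where
  "gr_comp M Mn n = {g \<in> gr_carrier M Mn. \<forall>k. k \<noteq> n \<longrightarrow> g k = filt M Mn k}"

text \<open>The canonical map from \<open>B\<^sub>0\<close> to the degree zero component of \<open>Gr(B)\<close>.\<close>

definition gr_unit :: "'b ring \<Rightarrow> (nat \<Rightarrow> 'b set) \<Rightarrow> 'b \<Rightarrow> (nat \<Rightarrow> 'b set)" where
  "gr_unit B Bn k = (\<lambda>n. if n = 0 then filt B Bn 0 +>\<^bsub>B\<^esub> k else filt B Bn n)"

text \<open>The component of degree \<open>k\<close> of a product is the sum over \<open>i + j = k\<close> of the cosets of \<open>a\<^sub>i b\<^sub>j\<close>,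
  where \<open>a\<^sub>i\<close> and \<open>b\<^sub>j\<close> represent the components of the factors; the union over all choices of
  representatives is a union of equal cosets.\<close>

definition gr_ring :: "'b ring \<Rightarrow> (nat \<Rightarrow> 'b set) \<Rightarrow> (nat \<Rightarrow> 'b set) ring" where
  "gr_ring B Bn = \<lparr>carrier = gr_carrier B Bn,
     monoid.mult = (\<lambda>x y k. \<Union>a\<in>{a. \<forall>i. a i \<in> x i}. \<Union>b\<in>{b. \<forall>i. b i \<in> y i}.
               filt B Bn k +>\<^bsub>B\<^esub> (\<Oplus>\<^bsub>B\<^esub>i\<in>{..k}. a i \<otimes>\<^bsub>B\<^esub> b (k - i))),
     monoid.one = gr_unit B Bn \<one>\<^bsub>B\<^esub>,
     ring.zero = filt B Bn,
     ring.add = (\<lambda>x y k. x k <+>\<^bsub>B\<^esub> y k)\<rparr>"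

definition gr_module ::
    "('b, 'm) gmod \<Rightarrow> (nat \<Rightarrow> 'b set, nat \<Rightarrow> 'm set) gmod" where
  "gr_module = (\<lambda>(M, Mn). (\<lparr>carrier = gr_carrier M Mn, monoid.mult = undefined, monoid.one = undefined,
     ring.zero = filt M Mn,
     ring.add = (\<lambda>x y k. x k <+>\<^bsub>M\<^esub> y k),
     smult = (\<lambda>x y k. \<Union>a\<in>{a. \<forall>i. a i \<in> x i}. \<Union>b\<in>{b. \<forall>i. b i \<in> y i}.
               filt M Mn k +>\<^bsub>M\<^esub> (\<Oplus>\<^bsub>M\<^esub>i\<in>{..k}. a i \<odot>\<^bsub>M\<^esub> b (k - i)))\<rparr>, gr_comp M Mn))"

text \<open>The relation \<open>~\<close> on \<open>P(B)\<close>.\<close>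

definition gr_equiv ::
    "'b ring \<Rightarrow> (nat \<Rightarrow> 'b set) \<Rightarrow> (('b, 'm) gmod set \<times> ('b, 'm) gmod set) set" where
  "gr_equiv B Bn = {(c, c'). c \<in> sg_point_classes B Bn \<and> c' \<in> sg_point_classes B Bn \<and>
     (\<exists>M\<in>c. \<exists>M'\<in>c'. homogeneous_iso (gr_ring B Bn) (gr_module M) (gr_module M'))}"


section \<open>Point modules of graded algebras\<close>

definition graded_module :: "'c ring \<Rightarrow> (nat \<Rightarrow> 'c set) \<Rightarrow> ('c, 'n) gmod \<Rightarrow> bool" where
  "graded_module C Cn = (\<lambda>(N, Nn). left_module C N \<and> direct_sum N Nn \<and>
     (\<forall>m n. \<forall>c\<in>Cn m. \<forall>x\<in>Nn n. c \<odot>\<^bsub>N\<^esub> x \<in> Nn (m + n)))"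

text \<open>Here \<open>\<kappa>\<close> is the structure map of the \<open>K\<close>-algebra \<open>C\<close>.\<close>

definition point_module ::
    "'k ring \<Rightarrow> ('k \<Rightarrow> 'c) \<Rightarrow> 'c ring \<Rightarrow> (nat \<Rightarrow> 'c set) \<Rightarrow> ('c, 'n) gmod \<Rightarrow> bool" where
  "point_module K \<kappa> C Cn = (\<lambda>(N, Nn). graded_module C Cn (N, Nn) \<and>
     cyclic_in_degree_zero C (N, Nn) \<and>
     (\<forall>n. free_of_rank K ((restrict_scalars \<kappa> N)\<lparr>carrier := Nn n\<rparr>) 1))"

text \<open>\<open>P(C)\<close>. Every cyclic \<open>C\<close>-module is isomorphic to one with elements in the type of \<open>C\<close>, so all
  isomorphism classes are represented.\<close>

definition point_classes ::
    "'k ring \<Rightarrow> ('k \<Rightarrow> 'c) \<Rightarrow> 'c ring \<Rightarrow> (nat \<Rightarrow> 'c set) \<Rightarrow> ('c, 'c) gmod set set" where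
  "point_classes K \<kappa> C Cn = iso_classes C {N. point_module K \<kappa> C Cn N}"


section \<open>Tensor products\<close>

text \<open>The tensor product over a commutative ring as the quotient of the free abelian group on the
  pairs by the bilinearity relations. Its elements are cosets of formal sums.\<close>

type_synonym ('v, 'w) tens = "('v \<times> 'w \<Rightarrow>\<^sub>0 int) set"

abbreviation pairs_group ::
    "('r, 'v) module \<Rightarrow> ('r, 'w) module \<Rightarrow> ('v \<times> 'w \<Rightarrow>\<^sub>0 int) monoid" where
  "pairs_group V W \<equiv> free_Abelian_group (carrier V \<times> carrier W)"

definition tensor_null ::
    "'r ring \<Rightarrow> ('r, 'v) module \<Rightarrow> ('r, 'w) module \<Rightarrow> ('v, 'w) tens" where
  "tensor_null R V W = generate (pairs_group V W)
     ({frag_of (v \<oplus>\<^bsub>V\<^esub> v', w) - frag_of (v, w) - frag_of (v', w) | v v' w.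
         v \<in> carrier V \<and> v' \<in> carrier V \<and> w \<in> carrier W} \<union>
      {frag_of (v, w \<oplus>\<^bsub>W\<^esub> w') - frag_of (v, w) - frag_of (v, w') | v w w'.
         v \<in> carrier V \<and> w \<in> carrier W \<and> w' \<in> carrier W} \<union>
      {frag_of (r \<odot>\<^bsub>V\<^esub> v, w) - frag_of (v, r \<odot>\<^bsub>W\<^esub> w) | r v w.
         r \<in> carrier R \<and> v \<in> carrier V \<and> w \<in> carrier W})"

definition tensor_class ::
    "'r ring \<Rightarrow> ('r, 'v) module \<Rightarrow> ('r, 'w) module \<Rightarrow> ('v \<times> 'w \<Rightarrow>\<^sub>0 int) \<Rightarrow> ('v, 'w) tens" where
  "tensor_class R V W x = tensor_null R V W #>\<^bsub>pairs_group V W\<^esub> x"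

text \<open>The image of \<open>V \<otimes> W'\<close> in \<open>V \<otimes> W\<close> for a subset \<open>W'\<close> of \<open>W\<close>.\<close>

definition tensor_part ::
    "'r ring \<Rightarrow> ('r, 'v) module \<Rightarrow> ('r, 'w) module \<Rightarrow> 'w set \<Rightarrow> ('v, 'w) tens set" where
  "tensor_part R V W W' =
     {tensor_class R V W x | x. x \<in> carrier (free_Abelian_group (carrier V \<times> W'))}"

definition frag_bilinear ::
    "('p \<Rightarrow> 'q \<Rightarrow> 'z) \<Rightarrow> ('p \<Rightarrow>\<^sub>0 int) \<Rightarrow> ('q \<Rightarrow>\<^sub>0 int) \<Rightarrow> ('z \<Rightarrow>\<^sub>0 int)" where
  "frag_bilinear f x y = frag_extend (\<lambda>p. frag_extend (\<lambda>q. frag_of (f p q)) y) x"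

abbreviation algebra_module :: "('k \<Rightarrow> 'a) \<Rightarrow> 'a ring \<Rightarrow> ('k, 'a) module" where
  "algebra_module \<sigma> A \<equiv> restrict_scalars \<sigma> (regular_module A)"

text \<open>The algebra \<open>S \<otimes>\<^sub>K C\<close> for \<open>K\<close>-algebras with structure maps \<open>\<sigma>\<close> and \<open>\<kappa>\<close>, where
  \<open>(s \<otimes> c) (s' \<otimes> c') = s s' \<otimes> c c'\<close>, and its grading induced by the grading of \<open>C\<close>.\<close>

definition tensor_algebra ::
    "'k ring \<Rightarrow> ('k \<Rightarrow> 's) \<Rightarrow> 's ring \<Rightarrow> ('k \<Rightarrow> 'c) \<Rightarrow> 'c ring \<Rightarrow> ('s, 'c) tens ring" where
  "tensor_algebra K \<sigma> S \<kappa> C =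
     (let V = algebra_module \<sigma> S; W = algebra_module \<kappa> C; cls = tensor_class K V W in
      \<lparr>carrier = tensor_part K V W (carrier W),
       monoid.mult = (\<lambda>X Y. \<Union>x\<in>X. \<Union>y\<in>Y.
                 cls (frag_bilinear (\<lambda>(s, c) (s', c'). (s \<otimes>\<^bsub>S\<^esub> s', c \<otimes>\<^bsub>C\<^esub> c')) x y)),
       monoid.one = cls (frag_of (\<one>\<^bsub>S\<^esub>, \<one>\<^bsub>C\<^esub>)),
       ring.zero = tensor_null K V W,
       ring.add = (\<lambda>X Y. X <#>\<^bsub>pairs_group V W\<^esub> Y)\<rparr>)"

definition tensor_grading ::
    "'k ring \<Rightarrow> ('k \<Rightarrow> 's) \<Rightarrow> 's ring \<Rightarrow> ('k \<Rightarrow> 'c) \<Rightarrow> 'c ring \<Rightarrow> (nat \<Rightarrow> 'c set) \<Rightarrow>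
     nat \<Rightarrow> ('s, 'c) tens set" where
  "tensor_grading K \<sigma> S \<kappa> C Cn n =
     tensor_part K (algebra_module \<sigma> S) (algebra_module \<kappa> C) (Cn n)"

definition pure_tensor ::
    "'k ring \<Rightarrow> ('k \<Rightarrow> 's) \<Rightarrow> 's ring \<Rightarrow> ('k \<Rightarrow> 'c) \<Rightarrow> 'c ring \<Rightarrow> 's \<Rightarrow> 'c \<Rightarrow> ('s, 'c) tens" where
  "pure_tensor K \<sigma> S \<kappa> C s c =
     tensor_class K (algebra_module \<sigma> S) (algebra_module \<kappa> C) (frag_of (s, c))"

text \<open>An \<open>S \<otimes>\<^sub>K C\<close>-module regarded as an \<open>S\<close>-module via \<open>s \<mapsto> s \<otimes> 1\<close>.\<close>

definition scalars_left ::
    "'k ring \<Rightarrow> ('k \<Rightarrow> 's) \<Rightarrow> 's ring \<Rightarrow> ('k \<Rightarrow> 'c) \<Rightarrow> 'c ring \<Rightarrow> (('s, 'c) tens, 'n) module \<Rightarrow>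
     ('s, 'n) module" where
  "scalars_left K \<sigma> S \<kappa> C N = restrict_scalars (\<lambda>s. pure_tensor K \<sigma> S \<kappa> C s \<one>\<^bsub>C\<^esub>) N"

text \<open>Base change of an \<open>S \<otimes>\<^sub>K C\<close>-module \<open>N\<close> along \<open>\<phi> : S \<rightarrow> T\<close>: the \<open>T \<otimes>\<^sub>K C\<close>-module \<open>T \<otimes>\<^sub>S N\<close> with
  \<open>(t \<otimes> c) (t' \<otimes> n) = t t' \<otimes> (1 \<otimes> c) n\<close>.\<close>

definition base_change ::
    "'k ring \<Rightarrow> ('k \<Rightarrow> 's) \<Rightarrow> 's ring \<Rightarrow> 't ring \<Rightarrow> ('s \<Rightarrow> 't) \<Rightarrow> ('k \<Rightarrow> 'c) \<Rightarrow> 'c ring \<Rightarrow>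
     (('s, 'c) tens, 'n) gmod \<Rightarrow> (('t, 'c) tens, ('t, 'n) tens) gmod" where
  "base_change K \<sigma> S T \<phi> \<kappa> C = (\<lambda>(N, Nn).
     (let V = algebra_module \<phi> T; W = scalars_left K \<sigma> S \<kappa> C N; cls = tensor_class S V W in
      (\<lparr>carrier = tensor_part S V W (carrier W), monoid.mult = undefined, monoid.one = undefined,
        ring.zero = tensor_null S V W,
        ring.add = (\<lambda>X Y. X <#>\<^bsub>pairs_group V W\<^esub> Y),
        smult = (\<lambda>X Y. \<Union>x\<in>X. \<Union>y\<in>Y.
           cls (frag_bilinear
             (\<lambda>(t, c) (t', n). (t \<otimes>\<^bsub>T\<^esub> t', pure_tensor K \<sigma> S \<kappa> C \<one>\<^bsub>S\<^esub> c \<odot>\<^bsub>N\<^esub> n)) x y))\<rparr>,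
       \<lambda>n. tensor_part S V W (Nn n))))"


section \<open>Localization\<close>

text \<open>The fraction \<open>m/d\<close> as the set of all pairs representing it.\<close>

definition frac :: "('r, 'm) module \<Rightarrow> 'r set \<Rightarrow> 'm \<Rightarrow> 'r \<Rightarrow> ('m \<times> 'r) set" where
  "frac M D m d =
     {(n, e). n \<in> carrier M \<and> e \<in> D \<and> (\<exists>u\<in>D. u \<odot>\<^bsub>M\<^esub> (e \<odot>\<^bsub>M\<^esub> m) = u \<odot>\<^bsub>M\<^esub> (d \<odot>\<^bsub>M\<^esub> n))}"

definition loc_ring :: "'r ring \<Rightarrow> 'r set \<Rightarrow> ('r \<times> 'r) set ring" where
  "loc_ring R D = (let fr = frac (regular_module R) D in
     \<lparr>carrier = {fr a d | a d. a \<in> carrier R \<and> d \<in> D},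
      monoid.mult = (\<lambda>X Y. \<Union>(a, d)\<in>X. \<Union>(b, e)\<in>Y. fr (a \<otimes>\<^bsub>R\<^esub> b) (d \<otimes>\<^bsub>R\<^esub> e)),
      monoid.one = fr \<one>\<^bsub>R\<^esub> \<one>\<^bsub>R\<^esub>,
      ring.zero = fr \<zero>\<^bsub>R\<^esub> \<one>\<^bsub>R\<^esub>,
      ring.add = (\<lambda>X Y. \<Union>(a, d)\<in>X. \<Union>(b, e)\<in>Y. fr (e \<otimes>\<^bsub>R\<^esub> a \<oplus>\<^bsub>R\<^esub> d \<otimes>\<^bsub>R\<^esub> b) (d \<otimes>\<^bsub>R\<^esub> e))\<rparr>)"

definition loc_module ::
    "'r ring \<Rightarrow> 'r set \<Rightarrow> ('r, 'm) module \<Rightarrow> (('r \<times> 'r) set, ('m \<times> 'r) set) module" where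
  "loc_module R D M = (let fr = frac M D in
     \<lparr>carrier = {fr m d | m d. m \<in> carrier M \<and> d \<in> D}, monoid.mult = undefined, monoid.one = undefined,
      ring.zero = fr \<zero>\<^bsub>M\<^esub> \<one>\<^bsub>R\<^esub>,
      ring.add = (\<lambda>X Y. \<Union>(m, d)\<in>X. \<Union>(n, e)\<in>Y. fr (e \<odot>\<^bsub>M\<^esub> m \<oplus>\<^bsub>M\<^esub> d \<odot>\<^bsub>M\<^esub> n) (d \<otimes>\<^bsub>R\<^esub> e)),
      smult = (\<lambda>X Y. \<Union>(a, d)\<in>X. \<Union>(m, e)\<in>Y. fr (a \<odot>\<^bsub>M\<^esub> m) (d \<otimes>\<^bsub>R\<^esub> e))\<rparr>)"

text \<open>Locally free on the spectrum: free of the given rank on a cover by basic open sets.\<close>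

definition locally_free_of_rank :: "'r ring \<Rightarrow> ('r, 'm) module \<Rightarrow> nat \<Rightarrow> bool" where
  "locally_free_of_rank R M r \<longleftrightarrow> left_module R M \<and>
     (\<exists>F. finite F \<and> F \<subseteq> carrier R \<and> Idl\<^bsub>R\<^esub> F = carrier R \<and>
        (\<forall>f\<in>F. let D = {f [^]\<^bsub>R\<^esub> k | k::nat. True} in
                 free_of_rank (loc_ring R D) (loc_module R D M) r))"


section \<open>The point functor\<close>

definition S_point_module ::
    "'k ring \<Rightarrow> ('k \<Rightarrow> 'c) \<Rightarrow> 'c ring \<Rightarrow> (nat \<Rightarrow> 'c set) \<Rightarrow> 's ring \<Rightarrow> ('k \<Rightarrow> 's) \<Rightarrow>
     (('s, 'c) tens, 'n) gmod \<Rightarrow> bool" where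
  "S_point_module K \<kappa> C Cn S \<sigma> = (\<lambda>(N, Nn).
     graded_module (tensor_algebra K \<sigma> S \<kappa> C) (tensor_grading K \<sigma> S \<kappa> C Cn) (N, Nn) \<and>
     cyclic_in_degree_zero (tensor_algebra K \<sigma> S \<kappa> C) (N, Nn) \<and>
     (\<exists>h. module_iso S (regular_module S) ((scalars_left K \<sigma> S \<kappa> C N)\<lparr>carrier := Nn 0\<rparr>) h) \<and>
     (\<forall>n. locally_free_of_rank S ((scalars_left K \<sigma> S \<kappa> C N)\<lparr>carrier := Nn n\<rparr>) 1))"

text \<open>\<open>P(C; S)\<close>. As \<open>S\<close>-point modules are cyclic, all isomorphism classes are represented by modules
  with elements in the type of \<open>S \<otimes>\<^sub>K C\<close>.\<close>

definition S_point_classes ::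
    "'k ring \<Rightarrow> ('k \<Rightarrow> 'c) \<Rightarrow> 'c ring \<Rightarrow> (nat \<Rightarrow> 'c set) \<Rightarrow> 's ring \<times> ('k \<Rightarrow> 's) \<Rightarrow>
     (('s, 'c) tens, ('s, 'c) tens) gmod set set" where
  "S_point_classes K \<kappa> C Cn = (\<lambda>(S, \<sigma>).
     iso_classes (tensor_algebra K \<sigma> S \<kappa> C) {N. S_point_module K \<kappa> C Cn S \<sigma> N})"

definition S_point_map ::
    "'k ring \<Rightarrow> ('k \<Rightarrow> 'c) \<Rightarrow> 'c ring \<Rightarrow> (nat \<Rightarrow> 'c set) \<Rightarrow> 's ring \<times> ('k \<Rightarrow> 's) \<Rightarrow>
     't ring \<times> ('k \<Rightarrow> 't) \<Rightarrow> ('s \<Rightarrow> 't) \<Rightarrow> (('s, 'c) tens, ('s, 'c) tens) gmod set \<Rightarrow>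
     (('t, 'c) tens, ('t, 'c) tens) gmod set" where
  "S_point_map K \<kappa> C Cn = (\<lambda>(S, \<sigma>) (T, \<tau>) \<phi> A.
     {N'. S_point_module K \<kappa> C Cn T \<tau> N' \<and>
        (\<exists>N\<in>A. homogeneous_iso (tensor_algebra K \<tau> T \<kappa> C) (base_change K \<sigma> S T \<phi> \<kappa> C N) N')})"

definition comm_algebra :: "'k ring \<Rightarrow> 's ring \<times> ('k \<Rightarrow> 's) \<Rightarrow> bool" where
  "comm_algebra K = (\<lambda>(S, \<sigma>). cring S \<and> \<sigma> \<in> ring_hom K S)"

definition algebra_hom ::
    "'k ring \<Rightarrow> 's ring \<times> ('k \<Rightarrow> 's) \<Rightarrow> 't ring \<times> ('k \<Rightarrow> 't) \<Rightarrow> ('s \<Rightarrow> 't) \<Rightarrow> bool" where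
  "algebra_hom K = (\<lambda>(S, \<sigma>) (T, \<tau>) \<phi>. \<phi> \<in> ring_hom S T \<and> (\<forall>k\<in>carrier K. \<phi> (\<sigma> k) = \<tau> k))"


section \<open>Locally ringed spaces and schemes\<close>

text \<open>\<open>sec X U\<close> is the ring of sections over the open set \<open>U\<close>, and \<open>res X U V\<close> is the restriction map
  from \<open>U\<close> to \<open>V \<subseteq> U\<close>.\<close>

record ('x, 'o) ringed_space =
  topo :: "'x topology"
  sec :: "'x set \<Rightarrow> 'o ring"
  res :: "'x set \<Rightarrow> 'x set \<Rightarrow> 'o \<Rightarrow> 'o"

definition presheaf_of_rings :: "('x, 'o) ringed_space \<Rightarrow> bool" where
  "presheaf_of_rings X \<longleftrightarrow>
     (\<forall>U. openin (topo X) U \<longrightarrow> cring (sec X U)) \<and>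
     (\<forall>U V. openin (topo X) U \<and> openin (topo X) V \<and> V \<subseteq> U \<longrightarrow>
        res X U V \<in> ring_hom (sec X U) (sec X V)) \<and>
     (\<forall>U. openin (topo X) U \<longrightarrow> (\<forall>s\<in>carrier (sec X U). res X U U s = s)) \<and>
     (\<forall>U V W. openin (topo X) U \<and> openin (topo X) V \<and> openin (topo X) W \<and> W \<subseteq> V \<and> V \<subseteq> U \<longrightarrow>
        (\<forall>s\<in>carrier (sec X U). res X V W (res X U V s) = res X U W s))"

definition sheaf_of_rings :: "('x, 'o) ringed_space \<Rightarrow> bool" where
  "sheaf_of_rings X \<longleftrightarrow> presheaf_of_rings X \<and>
     (\<forall>\<U>. (\<forall>V\<in>\<U>. openin (topo X) V) \<longrightarrow>
        (\<forall>s\<in>carrier (sec X (\<Union>\<U>)). \<forall>t\<in>carrier (sec X (\<Union>\<U>)).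
           (\<forall>V\<in>\<U>. res X (\<Union>\<U>) V s = res X (\<Union>\<U>) V t) \<longrightarrow> s = t) \<and>
        (\<forall>s. (\<forall>V\<in>\<U>. s V \<in> carrier (sec X V)) \<and>
             (\<forall>V\<in>\<U>. \<forall>W\<in>\<U>. res X V (V \<inter> W) (s V) = res X W (V \<inter> W) (s W)) \<longrightarrow>
             (\<exists>t\<in>carrier (sec X (\<Union>\<U>)). \<forall>V\<in>\<U>. res X (\<Union>\<U>) V t = s V)))"

definition germ :: "('x, 'o) ringed_space \<Rightarrow> 'x \<Rightarrow> 'x set \<Rightarrow> 'o \<Rightarrow> ('x set \<times> 'o) set" where
  "germ X x U s = {(V, t). openin (topo X) V \<and> x \<in> V \<and> t \<in> carrier (sec X V) \<and>
     (\<exists>W. openin (topo X) W \<and> x \<in> W \<and> W \<subseteq> U \<inter> V \<and> res X U W s = res X V W t)}"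

definition stalk :: "('x, 'o) ringed_space \<Rightarrow> 'x \<Rightarrow> ('x set \<times> 'o) set ring" where
  "stalk X x =
     \<lparr>carrier = {germ X x U s | U s. openin (topo X) U \<and> x \<in> U \<and> s \<in> carrier (sec X U)},
      monoid.mult = (\<lambda>A B. \<Union>(U, s)\<in>A. \<Union>(V, t)\<in>B.
        germ X x (U \<inter> V) (res X U (U \<inter> V) s \<otimes>\<^bsub>sec X (U \<inter> V)\<^esub> res X V (U \<inter> V) t)),
      monoid.one = germ X x (topspace (topo X)) \<one>\<^bsub>sec X (topspace (topo X))\<^esub>,
      ring.zero = germ X x (topspace (topo X)) \<zero>\<^bsub>sec X (topspace (topo X))\<^esub>,
      ring.add = (\<lambda>A B. \<Union>(U, s)\<in>A. \<Union>(V, t)\<in>B.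
        germ X x (U \<inter> V) (res X U (U \<inter> V) s \<oplus>\<^bsub>sec X (U \<inter> V)\<^esub> res X V (U \<inter> V) t))\<rparr>"

definition local_ring :: "'r ring \<Rightarrow> bool" where
  "local_ring R \<longleftrightarrow> cring R \<and> (\<exists>!I. maximalideal I R)"

definition locally_ringed_space :: "('x, 'o) ringed_space \<Rightarrow> bool" where
  "locally_ringed_space X \<longleftrightarrow> sheaf_of_rings X \<and> (\<forall>x\<in>topspace (topo X). local_ring (stalk X x))"

text \<open>A morphism \<open>X \<rightarrow> Y\<close> is a continuous map together with maps from the sections of \<open>Y\<close> over \<open>V\<close> to the
  sections of \<open>X\<close> over the preimage of \<open>V\<close>. All maps are required to be undefined outside their domains,
  so that equality of morphisms is equality in HOL.\<close>

type_synonym ('x, 'o, 'y, 'p) rs_map = "('x \<Rightarrow> 'y) \<times> ('y set \<Rightarrow> 'p \<Rightarrow> 'o)"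

abbreviation preim :: "('x, 'o) ringed_space \<Rightarrow> ('x \<Rightarrow> 'y) \<Rightarrow> 'y set \<Rightarrow> 'x set" where
  "preim X f V \<equiv> {x \<in> topspace (topo X). f x \<in> V}"

definition stalk_map ::
    "('x, 'o) ringed_space \<Rightarrow> ('x, 'o, 'y, 'p) rs_map \<Rightarrow> 'x \<Rightarrow> ('y set \<times> 'p) set \<Rightarrow>
     ('x set \<times> 'o) set" where
  "stalk_map X = (\<lambda>(f, fs) x G. \<Union>(V, s)\<in>G. germ X x (preim X f V) (fs V s))"

definition lrs_morphism ::
    "('x, 'o) ringed_space \<Rightarrow> ('y, 'p) ringed_space \<Rightarrow> ('x, 'o, 'y, 'p) rs_map \<Rightarrow> bool" where
  "lrs_morphism X Y = (\<lambda>(f, fs).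
     continuous_map (topo X) (topo Y) f \<and> f \<in> extensional (topspace (topo X)) \<and>
     fs \<in> extensional {V. openin (topo Y) V} \<and>
     (\<forall>V. openin (topo Y) V \<longrightarrow> fs V \<in> ring_hom (sec Y V) (sec X (preim X f V)) \<and>
        fs V \<in> extensional (carrier (sec Y V))) \<and>
     (\<forall>U V. openin (topo Y) U \<and> openin (topo Y) V \<and> V \<subseteq> U \<longrightarrow>
        (\<forall>s\<in>carrier (sec Y U).
           fs V (res Y U V s) = res X (preim X f U) (preim X f V) (fs U s))) \<and>
     (\<forall>x\<in>topspace (topo X). \<forall>I J. maximalideal I (stalk Y (f x)) \<and> maximalideal J (stalk X x) \<longrightarrow>
        stalk_map X (f, fs) x ` I \<subseteq> J))"

definition lrs_id :: "('x, 'o) ringed_space \<Rightarrow> ('x, 'o, 'x, 'o) rs_map" where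
  "lrs_id X = (\<lambda>x\<in>topspace (topo X). x, \<lambda>U\<in>{U. openin (topo X) U}. \<lambda>s\<in>carrier (sec X U). s)"

text \<open>The composition of \<open>(f, fs) : X \<rightarrow> Y\<close> and \<open>(g, gs) : Y \<rightarrow> Z\<close>.\<close>

definition lrs_comp ::
    "('x, 'o) ringed_space \<Rightarrow> ('y, 'p) ringed_space \<Rightarrow> ('z, 'q) ringed_space \<Rightarrow>
     ('y, 'p, 'z, 'q) rs_map \<Rightarrow> ('x, 'o, 'y, 'p) rs_map \<Rightarrow> ('x, 'o, 'z, 'q) rs_map" where
  "lrs_comp X Y Z = (\<lambda>(g, gs) (f, fs).
     (\<lambda>x\<in>topspace (topo X). g (f x),
      \<lambda>W\<in>{W. openin (topo Z) W}. \<lambda>s\<in>carrier (sec Z W). fs (preim Y g W) (gs W s)))"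

definition lrs_isomorphic :: "('x, 'o) ringed_space \<Rightarrow> ('y, 'p) ringed_space \<Rightarrow> bool" where
  "lrs_isomorphic X Y \<longleftrightarrow> (\<exists>f g. lrs_morphism X Y f \<and> lrs_morphism Y X g \<and>
     lrs_comp X Y X g f = lrs_id X \<and> lrs_comp Y X Y f g = lrs_id Y)"

definition open_subspace :: "('x, 'o) ringed_space \<Rightarrow> 'x set \<Rightarrow> ('x, 'o) ringed_space" where
  "open_subspace X U = X\<lparr>topo := subtopology (topo X) U\<rparr>"

definition zariski :: "'r ring \<Rightarrow> 'r set topology" where
  "zariski R = topology (\<lambda>U. \<exists>E\<subseteq>carrier R. U = {p. primeideal p R \<and> \<not> E \<subseteq> p})"

lemma istopology_zariski:
  "istopology (\<lambda>U. \<exists>E\<subseteq>carrier R. U = {p. primeideal p R \<and> \<not> E \<subseteq> p})"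
  unfolding istopology_def
proof (intro conjI allI impI)
  fix S T
  assume "\<exists>E\<subseteq>carrier R. S = {p. primeideal p R \<and> \<not> E \<subseteq> p}"
    and "\<exists>E\<subseteq>carrier R. T = {p. primeideal p R \<and> \<not> E \<subseteq> p}"
  then obtain E F where E: "E \<subseteq> carrier R" "S = {p. primeideal p R \<and> \<not> E \<subseteq> p}"
    and F: "F \<subseteq> carrier R" "T = {p. primeideal p R \<and> \<not> F \<subseteq> p}" by blast
  let ?G = "{a \<otimes>\<^bsub>R\<^esub> b | a b. a \<in> E \<and> b \<in> F}"
  have *: "?G \<subseteq> p \<longleftrightarrow> E \<subseteq> p \<or> F \<subseteq> p" if "primeideal p R" for p
  proof -
    interpret primeideal p R by fact
    show ?thesis
    proof
      assume G: "?G \<subseteq> p"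
      show "E \<subseteq> p \<or> F \<subseteq> p"
      proof (rule ccontr)
        assume "\<not> (E \<subseteq> p \<or> F \<subseteq> p)"
        then obtain a b where "a \<in> E" "a \<notin> p" "b \<in> F" "b \<notin> p" by blast
        with G E F I_prime[of a b] show False by blast
      qed
    qed (use E F I_l_closed I_r_closed in blast)
  qed
  have "?G \<subseteq> carrier R \<or> S \<inter> T = {}"
  proof (rule disjCI)
    assume "S \<inter> T \<noteq> {}"
    then obtain p where "primeideal p R" using E by blast
    then interpret primeideal p R .
    show "?G \<subseteq> carrier R" using E F by auto
  qed
  then show "\<exists>E\<subseteq>carrier R. S \<inter> T = {p. primeideal p R \<and> \<not> E \<subseteq> p}"
  proof
    assume "?G \<subseteq> carrier R"
    moreover have "S \<inter> T = {p. primeideal p R \<and> \<not> ?G \<subseteq> p}"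
    proof (rule Set.set_eqI)
      fix p
      show "p \<in> S \<inter> T \<longleftrightarrow> p \<in> {p. primeideal p R \<and> \<not> ?G \<subseteq> p}"
        using *[of p] unfolding E(2) F(2) Int_iff mem_Collect_eq by argo
    qed
    ultimately show ?thesis by (intro exI[of _ ?G] conjI)
  next
    assume "S \<inter> T = {}"
    then show ?thesis by (intro exI[of _ "{}"]) auto
  qed
next
  fix \<K>
  assume "\<forall>U\<in>\<K>. \<exists>E\<subseteq>carrier R. U = {p. primeideal p R \<and> \<not> E \<subseteq> p}"
  then have "\<forall>U\<in>\<K>. \<exists>E. E \<subseteq> carrier R \<and> U = {p. primeideal p R \<and> \<not> E \<subseteq> p}" .
  from bchoice[OF this] obtain E where E: "\<And>U. U \<in> \<K> \<Longrightarrow> E U \<subseteq> carrier R"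
      "\<And>U. U \<in> \<K> \<Longrightarrow> U = {p. primeideal p R \<and> \<not> E U \<subseteq> p}" by blast
  show "\<exists>E\<subseteq>carrier R. \<Union>\<K> = {p. primeideal p R \<and> \<not> E \<subseteq> p}"
  proof (intro exI[of _ "\<Union>U\<in>\<K>. E U"] conjI)
    show "(\<Union>U\<in>\<K>. E U) \<subseteq> carrier R" using E(1) by blast
    have U: "p \<in> U \<longleftrightarrow> primeideal p R \<and> \<not> E U \<subseteq> p" if "U \<in> \<K>" for p U
      by (subst E(2)[OF that]) simp
    have "p \<in> \<Union>\<K> \<longleftrightarrow> primeideal p R \<and> \<not> (\<Union>U\<in>\<K>. E U) \<subseteq> p" for p
      unfolding UN_subset_iff Union_iff using U by metis
    then show "\<Union>\<K> = {p. primeideal p R \<and> \<not> (\<Union>U\<in>\<K>. E U) \<subseteq> p}"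
      by (intro Set.set_eqI) (simp only: mem_Collect_eq)
  qed
qed

abbreviation loc_at :: "'r ring \<Rightarrow> 'r set \<Rightarrow> ('r \<times> 'r) set ring" where
  "loc_at R p \<equiv> loc_ring R (carrier R - p)"

abbreviation frac_at :: "'r ring \<Rightarrow> 'r set \<Rightarrow> 'r \<Rightarrow> 'r \<Rightarrow> ('r \<times> 'r) set" where
  "frac_at R p \<equiv> frac (regular_module R) (carrier R - p)"

text \<open>Sections of the structure sheaf of \<open>Spec R\<close> are functions that assign to a prime \<open>p\<close> an element
  of the localization at \<open>p\<close> and are locally given by a fraction.\<close>

definition spec_sections :: "'r ring \<Rightarrow> 'r set set \<Rightarrow> ('r set \<Rightarrow> ('r \<times> 'r) set) set" where
  "spec_sections R U = {s \<in> (\<Pi>\<^sub>E p\<in>U. carrier (loc_at R p)).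
     \<forall>p\<in>U. \<exists>V. openin (zariski R) V \<and> p \<in> V \<and> V \<subseteq> U \<and>
       (\<exists>a\<in>carrier R. \<exists>f\<in>carrier R. \<forall>q\<in>V. f \<notin> q \<and> s q = frac_at R q a f)}"

definition Spec :: "'r ring \<Rightarrow> ('r set, 'r set \<Rightarrow> ('r \<times> 'r) set) ringed_space" where
  "Spec R =
     \<lparr>topo = zariski R,
      sec = (\<lambda>U. \<lparr>carrier = spec_sections R U,
                   monoid.mult = (\<lambda>s t. \<lambda>p\<in>U. s p \<otimes>\<^bsub>loc_at R p\<^esub> t p),
                   monoid.one = (\<lambda>p\<in>U. \<one>\<^bsub>loc_at R p\<^esub>),
                   ring.zero = (\<lambda>p\<in>U. \<zero>\<^bsub>loc_at R p\<^esub>),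
                   ring.add = (\<lambda>s t. \<lambda>p\<in>U. s p \<oplus>\<^bsub>loc_at R p\<^esub> t p)\<rparr>),
      res = (\<lambda>U V s. restrict s V)\<rparr>"

text \<open>The morphism \<open>Spec T \<rightarrow> Spec S\<close> induced by \<open>\<phi> : S \<rightarrow> T\<close>.\<close>

definition Spec_map ::
    "'s ring \<Rightarrow> 't ring \<Rightarrow> ('s \<Rightarrow> 't) \<Rightarrow>
     ('t set, 't set \<Rightarrow> ('t \<times> 't) set, 's set, 's set \<Rightarrow> ('s \<times> 's) set) rs_map" where
  "Spec_map S T \<phi> =
     (let f = (\<lambda>q\<in>{q. primeideal q T}. {a \<in> carrier S. \<phi> a \<in> q}) in
      (f, \<lambda>V\<in>{V. openin (zariski S) V}. \<lambda>s\<in>spec_sections S V.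
            \<lambda>q\<in>preim (Spec T) f V. \<Union>(a, b)\<in>s (f q). frac_at T q (\<phi> a) (\<phi> b)))"

text \<open>If an open subspace is isomorphic to \<open>Spec A\<close>, then \<open>A\<close> is isomorphic to its ring of sections; so
  it is no restriction to take \<open>A\<close> in the type of sections of \<open>X\<close>.\<close>

definition scheme :: "('x, 'o) ringed_space \<Rightarrow> bool" where
  "scheme X \<longleftrightarrow> locally_ringed_space X \<and>
     (\<forall>x\<in>topspace (topo X). \<exists>U. openin (topo X) U \<and> x \<in> U \<and>
        (\<exists>A :: 'o ring. cring A \<and> lrs_isomorphic (open_subspace X U) (Spec A)))"

definition K_scheme ::
    "'k ring \<Rightarrow> ('x, 'o) ringed_space \<Rightarrow>
     ('x, 'o, 'k set, 'k set \<Rightarrow> ('k \<times> 'k) set) rs_map \<Rightarrow> bool" where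
  "K_scheme K X \<pi> \<longleftrightarrow> scheme X \<and> lrs_morphism X (Spec K) \<pi>"

definition closed_points :: "('x, 'o) ringed_space \<Rightarrow> 'x set" where
  "closed_points X = {x \<in> topspace (topo X). closedin (topo X) {x}}"

text \<open>The functor of points \<open>h\<^sub>X(S) = Hom\<^sub>K(Spec S, X)\<close>.\<close>

definition functor_of_points ::
    "'k ring \<Rightarrow> ('x, 'o) ringed_space \<Rightarrow>
     ('x, 'o, 'k set, 'k set \<Rightarrow> ('k \<times> 'k) set) rs_map \<Rightarrow> 's ring \<times> ('k \<Rightarrow> 's) \<Rightarrow>
     ('s set, 's set \<Rightarrow> ('s \<times> 's) set, 'x, 'o) rs_map set" where
  "functor_of_points K X \<pi> = (\<lambda>(S, \<sigma>).
     {g. lrs_morphism (Spec S) X g \<and> lrs_comp (Spec S) X (Spec K) \<pi> g = Spec_map K S \<sigma>})"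

text \<open>\<open>X\<close> parametrizes \<open>P(C)\<close>: the point functor of \<open>C\<close> is naturally isomorphic to the functor of points
  of \<open>X\<close>. The test algebras range over all commutative \<open>K\<close>-algebras with carrier in the type \<open>'k\<close>. Since
  the carrier of \<open>K\<close> may be an arbitrary subset of an arbitrary type, \<open>'k\<close> serves as the universe in
  which both \<open>K\<close> and the test algebras live.\<close>

definition parametrizes ::
    "'k ring \<Rightarrow> ('x, 'o) ringed_space \<Rightarrow>
     ('x, 'o, 'k set, 'k set \<Rightarrow> ('k \<times> 'k) set) rs_map \<Rightarrow>
     ('k \<Rightarrow> 'c) \<Rightarrow> 'c ring \<Rightarrow> (nat \<Rightarrow> 'c set) \<Rightarrow> bool" where
  "parametrizes K X \<pi> \<kappa> C Cn \<longleftrightarrow>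
     (\<exists>\<eta> :: 'k ring \<times> ('k \<Rightarrow> 'k) \<Rightarrow> (('k, 'c) tens, ('k, 'c) tens) gmod set \<Rightarrow>
             ('k set, 'k set \<Rightarrow> ('k \<times> 'k) set, 'x, 'o) rs_map.
        (\<forall>S. comm_algebra K S \<longrightarrow>
           bij_betw (\<eta> S) (S_point_classes K \<kappa> C Cn S) (functor_of_points K X \<pi> S)) \<and>
        (\<forall>S T \<phi>. comm_algebra K S \<and> comm_algebra K T \<and> algebra_hom K S T \<phi> \<longrightarrow>
           (\<forall>A\<in>S_point_classes K \<kappa> C Cn S.
              \<eta> T (S_point_map K \<kappa> C Cn S T \<phi> A) =
              lrs_comp (Spec (fst T)) (Spec (fst S)) X (\<eta> S A) (Spec_map (fst S) (fst T) \<phi>))))"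

end

theory Submission
  imports Defs "HOL-Algebra.Ring_Divisibility"
begin

text \<open>Write \<open>C = Gr(B)\<close> and \<open>F\<^sub>n\<close> for the \<open>n\<close>-th step of a filtration. The key fact is that \<open>Gr(M)\<close> is a point
  module of \<open>C\<close> for every point module \<open>M = B m\<^sub>0\<close> of \<open>B\<close> (\<open>gr_point_module\<close>). Its components are copies of
  the \<open>M\<^sub>n\<close>, so they are one-dimensional, and the problem is to show that \<open>Gr(M)\<close> is generated by the
  class of \<open>m\<^sub>0\<close>, that is, \<open>F\<^sub>n(M) = F\<^sub>n(B) m\<^sub>0\<close> for all \<open>n\<close> (\<open>FM_eq_FB_smult\<close>). A priori \<open>F\<^sub>n(B) m\<^sub>0\<close> could be
  too small. But if \<open>B\<^sub>1 F\<^sub>n(M) \<subseteq> F\<^sub>n(M)\<close>, then \<open>F\<^sub>n(M)\<close> is stable under \<open>B\<^sub>0\<close> and \<open>B\<^sub>1\<close>, hence under \<open>B\<close>, because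
  \<open>B\<close> is generated in degree one; then \<open>M = B m\<^sub>0 \<subseteq> F\<^sub>n(M)\<close>, although \<open>M\<^bsub>n+1\<^esub> \<noteq> 0\<close>. So some product \<open>b y\<close>
  with \<open>b \<in> B\<^sub>1\<close> and \<open>y \<in> F\<^sub>n(M)\<close> has a nonzero component in \<open>M\<^bsub>n+1\<^esub>\<close>, which is one-dimensional, and the
  claim follows by induction on \<open>n\<close>.

  The relation \<open>~\<close> says that the classes of \<open>Gr(M)\<close> and \<open>Gr(M')\<close> agree. Since isomorphic modules have
  isomorphic associated graded modules (\<open>gr_homogeneous_iso\<close>), \<open>[M] \<mapsto> [Gr(M)]\<close> is defined on the quotient
  by \<open>~\<close> and is injective there. The elements of \<open>Gr(M)\<close> may live in a different type than those of \<open>C\<close>;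
  as \<open>Gr(M)\<close> is cyclic, it can be moved (\<open>point_module_in_type\<close>). This is the first part.

  For the second part the isomorphism of functors is evaluated at \<open>S = K\<close>. Because of \<open>K \<otimes> C = C\<close>, point modules of \<open>C\<close>
  are \<open>K\<close>-point modules (\<open>S_point_module_of_point_module\<close>), and the given bijection turns their classes
  into \<open>K\<close>-morphisms from \<open>Spec K\<close> to \<open>X\<close>. Such a morphism is sent to its image point. This is injective
  (\<open>rational_point_determined\<close>): a section of \<open>X\<close> near the point is the sum of a constant, whose pullback
  is known because the morphism is over \<open>K\<close>, and of a section that vanishes at the point, whose pullback
  is zero because the morphism is local. The image point \<open>x\<close> is closed (\<open>rational_point_closed\<close>),
  because its residue field is \<open>K\<close>: if \<open>y \<noteq> x\<close> lies in an affine neighbourhood of \<open>x\<close>, some section \<open>s\<close> vanishes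
  at exactly one of the two points; after subtracting its value at \<open>x\<close> if necessary, it vanishes at \<open>x\<close> but
  not at \<open>y\<close>, and where it does not vanish there is a neighbourhood of \<open>y\<close> that avoids \<open>x\<close>. Vanishing at a
  point is expressed through sections that are invertible near the point.\<close>

section \<open>Direct sums and their filtrations\<close>

context abelian_group
begin

lemma filt_0 [simp]: "filt G Mn 0 = {\<zero>}"
  by (simp add: filt_def)

lemma filt_Suc_eq:
  assumes sub: "\<And>n. Mn n \<subseteq> carrier G"
  shows "filt G Mn (Suc n) = {u \<oplus> v | u v. u \<in> filt G Mn n \<and> v \<in> Mn n}" (is "?L = ?R")
proof
  have split: "(\<Oplus>i\<in>{..<Suc n}. f i) = (\<Oplus>i\<in>{..<n}. f i) \<oplus> f n" if "\<And>i. i \<le> n \<Longrightarrow> f i \<in> Mn i" for f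
  proof -
    have fc: "f i \<in> carrier G" if "i \<le> n" for i using \<open>\<And>i. i \<le> n \<Longrightarrow> f i \<in> Mn i\<close>[OF that] sub by blast
    have "(\<Oplus>i\<in>insert n {..<n}. f i) = f n \<oplus> (\<Oplus>i\<in>{..<n}. f i)"
      using fc by (intro finsum_insert) auto
    moreover have "(\<Oplus>i\<in>{..<n}. f i) \<in> carrier G"
      using fc by (intro finsum_closed) auto
    moreover have "f n \<in> carrier G" using that[of n] sub by auto
    ultimately show ?thesis by (simp add: lessThan_Suc a_comm)
  qed
  show "?L \<subseteq> ?R"
  proof
    fix x assume "x \<in> ?L"
    then obtain f where f: "x = (\<Oplus>i\<in>{..<Suc n}. f i)" "\<forall>i<Suc n. f i \<in> Mn i"
      unfolding filt_def by blast
    then have "x = (\<Oplus>i\<in>{..<n}. f i) \<oplus> f n" using split by auto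
    moreover have "(\<Oplus>i\<in>{..<n}. f i) \<in> filt G Mn n" using f(2) by (force simp: filt_def)
    ultimately show "x \<in> ?R" using f(2) by blast
  qed
  show "?R \<subseteq> ?L"
  proof
    fix x assume "x \<in> ?R"
    then obtain u v where uv: "x = u \<oplus> v" "u \<in> filt G Mn n" "v \<in> Mn n" by blast
    then obtain f where f: "u = (\<Oplus>i\<in>{..<n}. f i)" "\<forall>i<n. f i \<in> Mn i"
      unfolding filt_def by blast
    define g where "g i = (if i = n then v else f i)" for i
    have g: "g i \<in> Mn i" if "i \<le> n" for i using that uv f by (auto simp: g_def)
    have "(\<Oplus>i\<in>{..<n}. g i) = u" unfolding f(1)
      using f(2) subsetD[OF sub] by (intro finsum_cong') (auto simp: g_def)
    with split[of g] g have "x = (\<Oplus>i\<in>{..<Suc n}. g i)" by (simp add: uv g_def)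
    with g show "x \<in> ?L" unfolding filt_def by (auto simp: less_Suc_eq_le)
  qed
qed

context
  fixes Mn :: "nat \<Rightarrow> 'a set"
  assumes sub: "\<And>n. subgroup (Mn n) (add_monoid G)"
begin

lemma comp_carrier: "x \<in> Mn n \<Longrightarrow> x \<in> carrier G"
  using subgroup.subset[OF sub[of n]] by auto

lemma comp_add: "x \<in> Mn n \<Longrightarrow> y \<in> Mn n \<Longrightarrow> x \<oplus> y \<in> Mn n"
  using subgroup.m_closed[OF sub[of n]] by auto

lemma comp_minus: "x \<in> Mn n \<Longrightarrow> \<ominus> x \<in> Mn n"
  using subgroup.m_inv_closed[OF sub[of n]] by (auto simp: a_inv_def)

lemma comp_zero: "\<zero> \<in> Mn n"
  using subgroup.one_closed[OF sub[of n]] by auto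

lemma filt_Suc: "x \<in> filt G Mn (Suc n) \<longleftrightarrow> (\<exists>u\<in>filt G Mn n. \<exists>v\<in>Mn n. x = u \<oplus> v)"
  using filt_Suc_eq[of Mn] comp_carrier by blast

lemma filt_subgroup: "subgroup (filt G Mn n) (add_monoid G)"
proof (induction n)
  case 0
  show ?case using add.triv_subgroup by simp
next
  case (Suc n)
  have S: "x \<in> filt G Mn n \<Longrightarrow> x \<in> carrier G"
    "x \<in> filt G Mn n \<Longrightarrow> y \<in> filt G Mn n \<Longrightarrow> x \<oplus> y \<in> filt G Mn n"
    "x \<in> filt G Mn n \<Longrightarrow> \<ominus> x \<in> filt G Mn n" "\<zero> \<in> filt G Mn n" for x y
    using subgroup.subset[OF Suc] subgroup.m_closed[OF Suc] subgroup.m_inv_closed[OF Suc]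
      subgroup.one_closed[OF Suc] by (auto simp: a_inv_def)
  show ?case
  proof (rule add.subgroupI)
    show "filt G Mn (Suc n) \<subseteq> carrier G" using S(1) comp_carrier by (auto simp: filt_Suc)
    have "\<zero> \<oplus> \<zero> \<in> filt G Mn (Suc n)" unfolding filt_Suc using S(4) comp_zero[of n] by blast
    then show "filt G Mn (Suc n) \<noteq> {}" by auto
  next
    fix x assume "x \<in> filt G Mn (Suc n)"
    then obtain u v where "u \<in> filt G Mn n" "v \<in> Mn n" "x = u \<oplus> v" unfolding filt_Suc by blast
    moreover from this have "\<ominus> x = \<ominus> u \<oplus> \<ominus> v" using S(1) comp_carrier by (auto intro!: minus_add)
    ultimately show "\<ominus> x \<in> filt G Mn (Suc n)"
      unfolding filt_Suc using S(3) comp_minus by blast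
  next
    fix x y assume "x \<in> filt G Mn (Suc n)" "y \<in> filt G Mn (Suc n)"
    then obtain u v u' v' where *: "u \<in> filt G Mn n" "v \<in> Mn n" "x = u \<oplus> v"
      "u' \<in> filt G Mn n" "v' \<in> Mn n" "y = u' \<oplus> v'" unfolding filt_Suc by blast
    then have c: "u \<in> carrier G" "v \<in> carrier G" "u' \<in> carrier G" "v' \<in> carrier G"
      using S(1) comp_carrier by auto
    then have "x \<oplus> y = (u \<oplus> u') \<oplus> (v \<oplus> v')" using * by (simp add: a_ac)
    then show "x \<oplus> y \<in> filt G Mn (Suc n)"
      unfolding filt_Suc using S(2) comp_add * by blast
  qed
qed

lemma filt_carrier: "x \<in> filt G Mn n \<Longrightarrow> x \<in> carrier G"
  using subgroup.subset[OF filt_subgroup[of n]] by auto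

lemma filt_add: "x \<in> filt G Mn n \<Longrightarrow> y \<in> filt G Mn n \<Longrightarrow> x \<oplus> y \<in> filt G Mn n"
  using subgroup.m_closed[OF filt_subgroup[of n]] by auto

lemma filt_minus: "x \<in> filt G Mn n \<Longrightarrow> \<ominus> x \<in> filt G Mn n"
  using subgroup.m_inv_closed[OF filt_subgroup[of n]] by (auto simp: a_inv_def)

lemma filt_diff: "x \<in> filt G Mn n \<Longrightarrow> y \<in> filt G Mn n \<Longrightarrow> x \<ominus> y \<in> filt G Mn n"
  using filt_add filt_minus by (auto simp: a_minus_def)

lemma filt_zero: "\<zero> \<in> filt G Mn n"
  using subgroup.one_closed[OF filt_subgroup[of n]] by auto

lemma comp_filt: "x \<in> Mn n \<Longrightarrow> x \<in> filt G Mn (Suc n)"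
  unfolding filt_Suc using filt_zero comp_carrier by force

lemma filt_mono: "m \<le> n \<Longrightarrow> x \<in> filt G Mn m \<Longrightarrow> x \<in> filt G Mn n"
proof (induction rule: dec_induct)
  case (step k)
  then show ?case unfolding filt_Suc using comp_zero filt_carrier by force
qed

lemma finsum_filt: "(\<And>i. i \<in> I \<Longrightarrow> f i \<in> filt G Mn n) \<Longrightarrow> (\<Oplus>i\<in>I. f i) \<in> filt G Mn n"
proof (induction I rule: infinite_finite_induct)
  case (insert i I)
  then have "(\<Oplus>i\<in>insert i I. f i) = f i \<oplus> (\<Oplus>i\<in>I. f i)"
    by (intro finsum_insert) (auto intro: filt_carrier)
  with insert show ?case by (auto intro: filt_add)
qed (use filt_zero in auto)

end

text \<open>For a sum over all of \<open>\<nat>\<close> independence only has to be tested against the preceding summands.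
  In this form the condition can be checked by induction along the filtration, without
  handling infinite families.\<close>

lemma direct_sum_iff:
  "direct_sum G Mn \<longleftrightarrow> (\<forall>n. subgroup (Mn n) (add_monoid G)) \<and>
     (\<forall>x\<in>carrier G. \<exists>n. x \<in> filt G Mn n) \<and> (\<forall>n. filt G Mn n \<inter> Mn n \<subseteq> {\<zero>})"
proof (cases "\<forall>n. subgroup (Mn n) (add_monoid G)")
  case True
  then have s: "\<And>n. subgroup (Mn n) (add_monoid G)" by auto
  have trunc: "(\<Oplus>i\<in>{n. f n \<noteq> \<zero>}. f i) = (\<Oplus>i\<in>{..<N}. f i)"
    if "\<And>n. f n \<in> Mn n" "{n. f n \<noteq> \<zero>} \<subseteq> {..<N}" for f and N :: nat
  proof -
    have "f i \<in> carrier G" for i using comp_carrier[of Mn, OF s that(1)] .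
    with that(2) show ?thesis by (intro add.finprod_mono_neutral_cong_left) auto
  qed
  have supp: "\<exists>N. {n. f n \<noteq> \<zero>} \<subseteq> {..<N::nat}" if "finite {n. f n \<noteq> \<zero>}" for f
    using that finite_nat_iff_bounded by blast
  have indep: "\<forall>i<N. d i = \<zero>" if ind: "\<And>n. filt G Mn n \<inter> Mn n \<subseteq> {\<zero>}"
     and d: "\<And>n. d n \<in> Mn n" and 0: "(\<Oplus>i\<in>{..<N}. d i) = \<zero>" for d and N :: nat
    using 0
  proof (induction N)
    case (Suc N)
    have dc: "d i \<in> carrier G" for i using comp_carrier[of Mn, OF s d] .
    have "(\<Oplus>i\<in>insert N {..<N}. d i) = d N \<oplus> (\<Oplus>i\<in>{..<N}. d i)"
      using dc by (intro finsum_insert) auto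
    then have e: "d N \<oplus> (\<Oplus>i\<in>{..<N}. d i) = \<zero>" using Suc.prems by (simp add: lessThan_Suc)
    have S: "(\<Oplus>i\<in>{..<N}. d i) \<in> filt G Mn N" using d by (force simp: filt_def)
    have "d N = \<ominus> (\<Oplus>i\<in>{..<N}. d i)"
      using e dc filt_carrier[of Mn, OF s S] minus_equality by presburger
    then have "d N \<in> filt G Mn N" using filt_minus[of Mn, OF s S] by simp
    with ind d have "d N = \<zero>" by blast
    with e Suc.IH filt_carrier[of Mn, OF s S] show ?case by (auto simp: less_Suc_eq)
  qed simp
  show ?thesis
  proof
    assume D: "direct_sum G Mn"
    have ex: "\<exists>n. x \<in> filt G Mn n" if x: "x \<in> carrier G" for x
    proof -
      obtain f where f: "\<And>n. f n \<in> Mn n" "finite {n. f n \<noteq> \<zero>}"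
        "x = (\<Oplus>n\<in>{n. f n \<noteq> \<zero>}. f n)"
        using D x unfolding direct_sum_def by metis
      obtain N where "{n. f n \<noteq> \<zero>} \<subseteq> {..<N::nat}" using supp f(2) by blast
      with f trunc[OF f(1)] have "x = (\<Oplus>i\<in>{..<N}. f i)" by simp
      with f(1) show ?thesis unfolding filt_def by blast
    qed
    have "x = \<zero>" if x: "x \<in> filt G Mn n" "x \<in> Mn n" for x n
    proof -
      obtain f where f: "x = (\<Oplus>i\<in>{..<n}. f i)" "\<forall>i<n. f i \<in> Mn i"
        using x(1) unfolding filt_def by blast
      define g where "g i = (if i < n then f i else \<zero>)" for i
      define h where "h i = (if i = n then x else \<zero>)" for i
      have g: "g i \<in> Mn i" and h: "h i \<in> Mn i" for i
        using f x comp_zero[of Mn, OF s] by (auto simp: g_def h_def)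
      have sg: "{i. g i \<noteq> \<zero>} \<subseteq> {..<n}" and sh: "{i. h i \<noteq> \<zero>} \<subseteq> {..<Suc n}"
        by (auto simp: g_def h_def split: if_splits)
      have "(\<Oplus>i\<in>{..<n}. g i) = x" unfolding f(1)
        using f(2) comp_carrier[of Mn, OF s] by (intro finsum_cong') (auto simp: g_def)
      then have "x = (\<Oplus>i\<in>{i. g i \<noteq> \<zero>}. g i)" using trunc[OF g sg] by simp
      moreover have "(\<Oplus>i\<in>{..<Suc n}. h i) = x"
        unfolding h_def using comp_carrier[of Mn, OF s x(2)] add.finprod_singleton[of n "{..<Suc n}" "\<lambda>_. x"]
        by (simp add: eq_commute)
      then have "x = (\<Oplus>i\<in>{i. h i \<noteq> \<zero>}. h i)" using trunc[OF h sh] by simp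
      moreover have "finite {i. g i \<noteq> \<zero>}" "finite {i. h i \<noteq> \<zero>}"
        using sg sh finite_subset by blast+
      moreover have "\<exists>!f. (\<forall>n. f n \<in> Mn n) \<and> finite {n. f n \<noteq> \<zero>} \<and>
        x = (\<Oplus>n\<in>{n. f n \<noteq> \<zero>}. f n)"
        using D comp_carrier[of Mn, OF s x(2)] unfolding direct_sum_def by blast
      ultimately have "g = h" using g h by blast
      then have "g n = h n" by simp
      then show ?thesis by (simp add: g_def h_def)
    qed
    with ex s show "(\<forall>n. subgroup (Mn n) (add_monoid G)) \<and>
     (\<forall>x\<in>carrier G. \<exists>n. x \<in> filt G Mn n) \<and> (\<forall>n. filt G Mn n \<inter> Mn n \<subseteq> {\<zero>})" by blast
  next
    assume R: "(\<forall>n. subgroup (Mn n) (add_monoid G)) \<and>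
     (\<forall>x\<in>carrier G. \<exists>n. x \<in> filt G Mn n) \<and> (\<forall>n. filt G Mn n \<inter> Mn n \<subseteq> {\<zero>})"
    show "direct_sum G Mn"
      unfolding direct_sum_def
    proof (intro conjI ballI)
      show "\<forall>n. subgroup (Mn n) (add_monoid G)" using s by blast
      fix x assume x: "x \<in> carrier G"
      then obtain n f where f: "x = (\<Oplus>i\<in>{..<n}. f i)" "\<forall>i<n. f i \<in> Mn i"
        using R unfolding filt_def by blast
      define g where "g i = (if i < n then f i else \<zero>)" for i
      have g: "g i \<in> Mn i" for i using f comp_zero[of Mn, OF s] by (auto simp: g_def)
      have sg: "{i. g i \<noteq> \<zero>} \<subseteq> {..<n}" by (auto simp: g_def split: if_splits)
      have "(\<Oplus>i\<in>{..<n}. g i) = x" unfolding f(1)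
        using f(2) comp_carrier[of Mn, OF s] by (intro finsum_cong') (auto simp: g_def)
      then have gx: "x = (\<Oplus>i\<in>{i. g i \<noteq> \<zero>}. g i)" using trunc[OF g sg] by simp
      have gfin: "finite {i. g i \<noteq> \<zero>}" using sg finite_subset by blast
      show "\<exists>!f. (\<forall>n. f n \<in> Mn n) \<and> finite {n. f n \<noteq> \<zero>} \<and> x = (\<Oplus>n\<in>{n. f n \<noteq> \<zero>}. f n)"
      proof (rule ex1I[of _ g])
        show "(\<forall>n. g n \<in> Mn n) \<and> finite {n. g n \<noteq> \<zero>} \<and> x = (\<Oplus>n\<in>{n. g n \<noteq> \<zero>}. g n)"
          using g gfin gx by blast
        fix h assume "(\<forall>n. h n \<in> Mn n) \<and> finite {n. h n \<noteq> \<zero>} \<and> x = (\<Oplus>n\<in>{n. h n \<noteq> \<zero>}. h n)"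
        then have h: "\<And>n. h n \<in> Mn n" "finite {n. h n \<noteq> \<zero>}" "x = (\<Oplus>n\<in>{n. h n \<noteq> \<zero>}. h n)"
          by auto
        obtain N where N: "{i. h i \<noteq> \<zero>} \<union> {i. g i \<noteq> \<zero>} \<subseteq> {..<N::nat}"
          using gfin h(2) finite_nat_iff_bounded by (metis finite_UnI)
        then have "(\<Oplus>i\<in>{..<N}. h i) = (\<Oplus>i\<in>{..<N}. g i)"
          using trunc[OF g, of N] trunc[OF h(1), of N] gx h(3) by (metis Un_subset_iff)
        have gc: "g i \<in> carrier G" and hc: "h i \<in> carrier G" for i
          using g h comp_carrier[of Mn, OF s] by blast+
        define d where "d i = h i \<ominus> g i" for i
        have d: "d i \<in> Mn i" for i using g h unfolding d_def a_minus_def by (intro comp_add[of Mn, OF s] comp_minus[of Mn, OF s])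
        have dc: "d i \<in> carrier G" for i using gc hc by (simp add: d_def)
        have "h i = d i \<oplus> g i" for i using gc hc by (simp add: d_def a_minus_def a_assoc l_neg)
        then have "h = (\<lambda>i. d i \<oplus> g i)" by blast
        moreover have "(\<Oplus>i\<in>{..<N}. d i \<oplus> g i) = (\<Oplus>i\<in>{..<N}. d i) \<oplus> (\<Oplus>i\<in>{..<N}. g i)"
          by (intro finsum_addf) (simp_all add: dc gc)
        ultimately have "(\<Oplus>i\<in>{..<N}. h i) = (\<Oplus>i\<in>{..<N}. d i) \<oplus> (\<Oplus>i\<in>{..<N}. g i)"
          by argo
        then have "(\<Oplus>i\<in>{..<N}. d i) \<oplus> (\<Oplus>i\<in>{..<N}. g i) = \<zero> \<oplus> (\<Oplus>i\<in>{..<N}. g i)"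
          using \<open>(\<Oplus>i\<in>{..<N}. h i) = (\<Oplus>i\<in>{..<N}. g i)\<close> finsum_closed[of g "{..<N}"] gc
          by (metis Pi_I l_zero)
        then have "(\<Oplus>i\<in>{..<N}. d i) = \<zero>"
          by (rule add.right_cancel[THEN iffD1, rotated 3]) (use dc gc in \<open>auto intro!: finsum_closed\<close>)
        from indep[OF _ d this] R have "\<forall>i<N. d i = \<zero>" by blast
        then have "h i = g i" if "i < N" for i using that \<open>h = (\<lambda>i. d i \<oplus> g i)\<close> gc by simp
        moreover have "h i = g i" if "\<not> i < N" for i
          using that subsetD[OF N, of i] by fastforce
        ultimately show "h = g" by blast
      qed
    qed
  qed
qed (auto simp: direct_sum_def)

end

section \<open>Left modules and their isomorphisms\<close>

lemma left_moduleD: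
  assumes "left_module R M"
  shows left_module_ring: "ring R" and left_module_group: "abelian_group M"
    and smult_closed: "a \<in> carrier R \<Longrightarrow> x \<in> carrier M \<Longrightarrow> a \<odot>\<^bsub>M\<^esub> x \<in> carrier M"
    and smult_l_distr: "a \<in> carrier R \<Longrightarrow> b \<in> carrier R \<Longrightarrow> x \<in> carrier M \<Longrightarrow>
      (a \<oplus>\<^bsub>R\<^esub> b) \<odot>\<^bsub>M\<^esub> x = a \<odot>\<^bsub>M\<^esub> x \<oplus>\<^bsub>M\<^esub> b \<odot>\<^bsub>M\<^esub> x"
    and smult_r_distr: "a \<in> carrier R \<Longrightarrow> x \<in> carrier M \<Longrightarrow> y \<in> carrier M \<Longrightarrow>
      a \<odot>\<^bsub>M\<^esub> (x \<oplus>\<^bsub>M\<^esub> y) = a \<odot>\<^bsub>M\<^esub> x \<oplus>\<^bsub>M\<^esub> a \<odot>\<^bsub>M\<^esub> y"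
    and smult_assoc: "a \<in> carrier R \<Longrightarrow> b \<in> carrier R \<Longrightarrow> x \<in> carrier M \<Longrightarrow>
      (a \<otimes>\<^bsub>R\<^esub> b) \<odot>\<^bsub>M\<^esub> x = a \<odot>\<^bsub>M\<^esub> (b \<odot>\<^bsub>M\<^esub> x)"
    and smult_one: "x \<in> carrier M \<Longrightarrow> \<one>\<^bsub>R\<^esub> \<odot>\<^bsub>M\<^esub> x = x"
  using assms by (simp_all add: left_module_def)

lemma left_moduleI:
  assumes "ring R" "abelian_group M"
    and "\<And>a x. a \<in> carrier R \<Longrightarrow> x \<in> carrier M \<Longrightarrow> a \<odot>\<^bsub>M\<^esub> x \<in> carrier M"
    and "\<And>a b x. a \<in> carrier R \<Longrightarrow> b \<in> carrier R \<Longrightarrow> x \<in> carrier M \<Longrightarrow>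
      (a \<oplus>\<^bsub>R\<^esub> b) \<odot>\<^bsub>M\<^esub> x = a \<odot>\<^bsub>M\<^esub> x \<oplus>\<^bsub>M\<^esub> b \<odot>\<^bsub>M\<^esub> x"
    and "\<And>a x y. a \<in> carrier R \<Longrightarrow> x \<in> carrier M \<Longrightarrow> y \<in> carrier M \<Longrightarrow>
      a \<odot>\<^bsub>M\<^esub> (x \<oplus>\<^bsub>M\<^esub> y) = a \<odot>\<^bsub>M\<^esub> x \<oplus>\<^bsub>M\<^esub> a \<odot>\<^bsub>M\<^esub> y"
    and "\<And>a b x. a \<in> carrier R \<Longrightarrow> b \<in> carrier R \<Longrightarrow> x \<in> carrier M \<Longrightarrow>
      (a \<otimes>\<^bsub>R\<^esub> b) \<odot>\<^bsub>M\<^esub> x = a \<odot>\<^bsub>M\<^esub> (b \<odot>\<^bsub>M\<^esub> x)"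
    and "\<And>x. x \<in> carrier M \<Longrightarrow> \<one>\<^bsub>R\<^esub> \<odot>\<^bsub>M\<^esub> x = x"
  shows "left_module R M"
  unfolding left_module_def by (intro conjI ballI) (fact assms)+

lemma smult_l_null:
  assumes "left_module R M" "x \<in> carrier M"
  shows "\<zero>\<^bsub>R\<^esub> \<odot>\<^bsub>M\<^esub> x = \<zero>\<^bsub>M\<^esub>"
proof -
  interpret R: ring R using left_module_ring[OF assms(1)] .
  interpret M: abelian_group M using left_module_group[OF assms(1)] .
  have c: "\<zero>\<^bsub>R\<^esub> \<odot>\<^bsub>M\<^esub> x \<in> carrier M" using smult_closed[OF assms(1) R.zero_closed assms(2)] .
  have "\<zero>\<^bsub>R\<^esub> \<odot>\<^bsub>M\<^esub> x \<oplus>\<^bsub>M\<^esub> \<zero>\<^bsub>R\<^esub> \<odot>\<^bsub>M\<^esub> x = \<zero>\<^bsub>R\<^esub> \<odot>\<^bsub>M\<^esub> x"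
    using smult_l_distr[OF assms(1) _ _ assms(2), of "\<zero>\<^bsub>R\<^esub>" "\<zero>\<^bsub>R\<^esub>"] by simp
  then show ?thesis using c M.add.r_cancel_one by blast
qed

lemma smult_r_null:
  assumes "left_module R M" "a \<in> carrier R"
  shows "a \<odot>\<^bsub>M\<^esub> \<zero>\<^bsub>M\<^esub> = \<zero>\<^bsub>M\<^esub>"
proof -
  interpret M: abelian_group M using left_module_group[OF assms(1)] .
  have c: "a \<odot>\<^bsub>M\<^esub> \<zero>\<^bsub>M\<^esub> \<in> carrier M" using smult_closed[OF assms M.zero_closed] .
  have "a \<odot>\<^bsub>M\<^esub> \<zero>\<^bsub>M\<^esub> \<oplus>\<^bsub>M\<^esub> a \<odot>\<^bsub>M\<^esub> \<zero>\<^bsub>M\<^esub> = a \<odot>\<^bsub>M\<^esub> \<zero>\<^bsub>M\<^esub>"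
    using smult_r_distr[OF assms, of "\<zero>\<^bsub>M\<^esub>" "\<zero>\<^bsub>M\<^esub>"] by simp
  then show ?thesis using c M.add.r_cancel_one by blast
qed

lemma smult_l_minus:
  assumes "left_module R M" "a \<in> carrier R" "x \<in> carrier M"
  shows "(\<ominus>\<^bsub>R\<^esub> a) \<odot>\<^bsub>M\<^esub> x = \<ominus>\<^bsub>M\<^esub> (a \<odot>\<^bsub>M\<^esub> x)"
proof -
  interpret R: ring R using left_module_ring[OF assms(1)] .
  interpret M: abelian_group M using left_module_group[OF assms(1)] .
  have "(\<ominus>\<^bsub>R\<^esub> a) \<odot>\<^bsub>M\<^esub> x \<oplus>\<^bsub>M\<^esub> a \<odot>\<^bsub>M\<^esub> x = \<zero>\<^bsub>M\<^esub>"
    using smult_l_distr[OF assms(1) _ assms(2,3), of "\<ominus>\<^bsub>R\<^esub> a"] assms smult_l_null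
    by (metis R.add.inv_closed R.l_neg)
  then show ?thesis using assms smult_closed[OF assms(1) _ assms(3)] M.minus_equality
    by (metis R.add.inv_closed)
qed

lemma smult_finsum_distr:
  assumes "left_module R M" "a \<in> carrier R" "\<And>i. i \<in> I \<Longrightarrow> f i \<in> carrier M"
  shows "a \<odot>\<^bsub>M\<^esub> (\<Oplus>\<^bsub>M\<^esub>i\<in>I. f i) = (\<Oplus>\<^bsub>M\<^esub>i\<in>I. a \<odot>\<^bsub>M\<^esub> f i)"
proof -
  interpret M: abelian_group M using left_module_group[OF assms(1)] .
  show ?thesis using assms(3)
  proof (induction I rule: infinite_finite_induct)
    case (insert i I)
    then show ?case
      using smult_r_distr[OF assms(1,2)] smult_closed[OF assms(1,2)] M.finsum_closed[of f I]
      by (simp add: Pi_def)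
  qed (simp_all add: smult_r_null[OF assms(1,2)])
qed

lemma finsum_smult_distr:
  assumes "left_module R M" "x \<in> carrier M" "\<And>i. i \<in> I \<Longrightarrow> f i \<in> carrier R"
  shows "(\<Oplus>\<^bsub>R\<^esub>i\<in>I. f i) \<odot>\<^bsub>M\<^esub> x = (\<Oplus>\<^bsub>M\<^esub>i\<in>I. f i \<odot>\<^bsub>M\<^esub> x)"
proof -
  interpret R: ring R using left_module_ring[OF assms(1)] .
  interpret M: abelian_group M using left_module_group[OF assms(1)] .
  show ?thesis using assms(3)
  proof (induction I rule: infinite_finite_induct)
    case (insert i I)
    then show ?case
      using smult_l_distr[OF assms(1) _ _ assms(2)] smult_closed[OF assms(1) _ assms(2)]
        R.finsum_closed[of f I]
      by (simp add: Pi_def)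
  qed (simp_all add: smult_l_null[OF assms(1,2)])
qed

lemma regular_left_module:
  assumes "ring R" shows "left_module R (regular_module R)"
proof -
  interpret ring R by fact
  have "abelian_group (regular_module R)"
    by (rule abelian_groupI) (auto simp: regular_module_def a_ac intro: l_neg a_inv_closed)
  then show ?thesis
    by (intro left_moduleI) (auto simp: regular_module_def assms l_distr r_distr m_assoc)
qed

text \<open>With a single basis element no sums remain in the definition of a free module.\<close>

lemma free_of_rank_one_iff:
  "free_of_rank R V 1 \<longleftrightarrow> left_module R V \<and>
     (\<exists>e\<in>carrier V. \<forall>v\<in>carrier V. \<exists>!a. a \<in> carrier R \<and> v = a \<odot>\<^bsub>V\<^esub> e)"
proof (cases "left_module R V")
  case True
  interpret V: abelian_group V using left_module_group[OF True] .
  have sum: "(\<Oplus>\<^bsub>V\<^esub>i\<in>{..<1}. c i \<odot>\<^bsub>V\<^esub> e i) = c 0 \<odot>\<^bsub>V\<^esub> e 0"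
    if "c \<in> {..<1} \<rightarrow>\<^sub>E carrier R" "e \<in> {..<1} \<rightarrow> carrier V" for c and e :: "nat \<Rightarrow> _"
  proof -
    have "c 0 \<odot>\<^bsub>V\<^esub> e 0 \<in> carrier V" using that smult_closed[OF True] by (auto simp: PiE_def Pi_def)
    then have "(\<Oplus>\<^bsub>V\<^esub>i\<in>{0}. c i \<odot>\<^bsub>V\<^esub> e i) = c 0 \<odot>\<^bsub>V\<^esub> e 0" by simp
    then show ?thesis by (simp add: lessThan_Suc)
  qed
  have ex1: "(\<exists>!c. c \<in> {..<1} \<rightarrow>\<^sub>E carrier R \<and> v = (\<Oplus>\<^bsub>V\<^esub>i\<in>{..<1}. c i \<odot>\<^bsub>V\<^esub> e i)) \<longleftrightarrow>
      (\<exists>!a. a \<in> carrier R \<and> v = a \<odot>\<^bsub>V\<^esub> e 0)" (is "?L \<longleftrightarrow> ?R")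
    if e: "e \<in> {..<1} \<rightarrow> carrier V" for v and e :: "nat \<Rightarrow> _"
  proof
    assume ?L
    then obtain c where "c \<in> {..<1} \<rightarrow>\<^sub>E carrier R \<and> v = (\<Oplus>\<^bsub>V\<^esub>i\<in>{..<1}. c i \<odot>\<^bsub>V\<^esub> e i)"
      and u: "\<And>d. d \<in> {..<1} \<rightarrow>\<^sub>E carrier R \<and> v = (\<Oplus>\<^bsub>V\<^esub>i\<in>{..<1}. d i \<odot>\<^bsub>V\<^esub> e i) \<Longrightarrow> d = c"
      by (rule ex1E) iprover
    then have c: "c \<in> {..<1} \<rightarrow>\<^sub>E carrier R" "v = (\<Oplus>\<^bsub>V\<^esub>i\<in>{..<1}. c i \<odot>\<^bsub>V\<^esub> e i)" by simp_all
    show ?R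
    proof (rule ex1I[of _ "c 0"])
      show "c 0 \<in> carrier R \<and> v = c 0 \<odot>\<^bsub>V\<^esub> e 0" using c(1) sum[OF c(1) e] c(2) by auto
      fix a assume a: "a \<in> carrier R \<and> v = a \<odot>\<^bsub>V\<^esub> e 0"
      let ?d = "\<lambda>i\<in>{..<1::nat}. a"
      have "?d \<in> {..<1::nat} \<rightarrow>\<^sub>E carrier R" using a by auto
      with sum[OF this e] a have "?d = c" by (intro u) simp
      then have "?d 0 = c 0" by simp
      then show "a = c 0" by simp
    qed
  next
    assume ?R
    then obtain a where a: "a \<in> carrier R" "v = a \<odot>\<^bsub>V\<^esub> e 0"
      and u: "\<And>b. b \<in> carrier R \<Longrightarrow> v = b \<odot>\<^bsub>V\<^esub> e 0 \<Longrightarrow> b = a" by blast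
    let ?d = "\<lambda>i\<in>{..<1::nat}. a"
    have d: "?d \<in> {..<1::nat} \<rightarrow>\<^sub>E carrier R" using a by auto
    show ?L
    proof (rule ex1I[of _ ?d])
      show "?d \<in> {..<1} \<rightarrow>\<^sub>E carrier R \<and> v = (\<Oplus>\<^bsub>V\<^esub>i\<in>{..<1}. ?d i \<odot>\<^bsub>V\<^esub> e i)"
        using d sum[OF d e] a by simp
      fix c assume c: "c \<in> {..<1} \<rightarrow>\<^sub>E carrier R \<and> v = (\<Oplus>\<^bsub>V\<^esub>i\<in>{..<1}. c i \<odot>\<^bsub>V\<^esub> e i)"
      then have "v = c 0 \<odot>\<^bsub>V\<^esub> e 0" using sum[of c e] e by simp
      moreover have "c 0 \<in> carrier R" using c by auto
      ultimately have "c 0 = a" using u by blast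
      then show "c = ?d" using c by (intro extensionalityI[of c "{..<1}"]) (auto simp: PiE_def)
    qed
  qed
  show ?thesis
  proof
    assume "free_of_rank R V 1"
    then obtain e where e: "e \<in> {..<1::nat} \<rightarrow> carrier V"
      and f: "\<forall>v\<in>carrier V. \<exists>!c. c \<in> {..<1} \<rightarrow>\<^sub>E carrier R \<and> v = (\<Oplus>\<^bsub>V\<^esub>i\<in>{..<1}. c i \<odot>\<^bsub>V\<^esub> e i)"
      unfolding free_of_rank_def by blast
    from f have "\<forall>v\<in>carrier V. \<exists>!a. a \<in> carrier R \<and> v = a \<odot>\<^bsub>V\<^esub> e 0" unfolding ex1[OF e] .
    moreover have "e 0 \<in> carrier V" using e by auto
    ultimately show "left_module R V \<and>
     (\<exists>e\<in>carrier V. \<forall>v\<in>carrier V. \<exists>!a. a \<in> carrier R \<and> v = a \<odot>\<^bsub>V\<^esub> e)" using True by blast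
  next
    assume "left_module R V \<and>
     (\<exists>e\<in>carrier V. \<forall>v\<in>carrier V. \<exists>!a. a \<in> carrier R \<and> v = a \<odot>\<^bsub>V\<^esub> e)"
    then obtain e where e: "e \<in> carrier V" "\<forall>v\<in>carrier V. \<exists>!a. a \<in> carrier R \<and> v = a \<odot>\<^bsub>V\<^esub> e" by blast
    have c: "(\<lambda>i::nat. e) \<in> {..<1} \<rightarrow> carrier V" using e(1) by auto
    from e(2) have "\<forall>v\<in>carrier V. \<exists>!d. d \<in> {..<1::nat} \<rightarrow>\<^sub>E carrier R \<and> v = (\<Oplus>\<^bsub>V\<^esub>i\<in>{..<1}. d i \<odot>\<^bsub>V\<^esub> e)"
      unfolding ex1[OF c] .
    then show "free_of_rank R V 1"
      unfolding free_of_rank_def by (intro conjI True bexI[of _ "\<lambda>i. e"] c)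
  qed
qed (simp add: free_of_rank_def)

lemma module_isoD:
  assumes "module_iso R M N h"
  shows "inj_on h (carrier M)" "h ` carrier M = carrier N"
    and "x \<in> carrier M \<Longrightarrow> y \<in> carrier M \<Longrightarrow> h (x \<oplus>\<^bsub>M\<^esub> y) = h x \<oplus>\<^bsub>N\<^esub> h y"
    and "a \<in> carrier R \<Longrightarrow> x \<in> carrier M \<Longrightarrow> h (a \<odot>\<^bsub>M\<^esub> x) = a \<odot>\<^bsub>N\<^esub> h x"
    and "x \<in> carrier M \<Longrightarrow> h x \<in> carrier N"
  using assms unfolding module_iso_def bij_betw_def by auto

lemma module_iso_zero:
  assumes "module_iso R M N h" "abelian_group M" "abelian_group N"
  shows "h \<zero>\<^bsub>M\<^esub> = \<zero>\<^bsub>N\<^esub>"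
proof -
  interpret M: abelian_group M by fact
  interpret N: abelian_group N by fact
  have "h \<zero>\<^bsub>M\<^esub> \<oplus>\<^bsub>N\<^esub> h \<zero>\<^bsub>M\<^esub> = h \<zero>\<^bsub>M\<^esub>"
    using module_isoD(3)[OF assms(1), of "\<zero>\<^bsub>M\<^esub>" "\<zero>\<^bsub>M\<^esub>"] by simp
  then show ?thesis using module_isoD(5)[OF assms(1), of "\<zero>\<^bsub>M\<^esub>"] N.add.r_cancel_one by auto
qed

lemma module_iso_refl: "module_iso R M M id"
  by (simp add: module_iso_def)

lemma module_iso_trans:
  assumes "module_iso R M N g" "module_iso R N P h"
  shows "module_iso R M P (h \<circ> g)"
  using assms bij_betw_trans[of g "carrier M" "carrier N" h "carrier P"]
    module_isoD(5)[OF assms(1)]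
  by (auto simp: module_iso_def)

lemma module_iso_sym:
  assumes h: "module_iso R M N h" and M: "left_module R M"
  shows "module_iso R N M (inv_into (carrier M) h)"
  unfolding module_iso_def
proof (intro conjI ballI)
  interpret M: abelian_group M using left_module_group[OF M] .
  let ?g = "inv_into (carrier M) h"
  show "bij_betw ?g (carrier N) (carrier M)"
    using h bij_betw_inv_into unfolding module_iso_def by blast
  have g: "?g x \<in> carrier M" "h (?g x) = x" if "x \<in> carrier N" for x
    using that module_isoD(2)[OF h] by (auto simp: inv_into_into f_inv_into_f)
  have gh: "?g (h x) = x" if "x \<in> carrier M" for x
    using that module_isoD(1)[OF h] by simp
  show "?g (x \<oplus>\<^bsub>N\<^esub> y) = ?g x \<oplus>\<^bsub>M\<^esub> ?g y" if "x \<in> carrier N" "y \<in> carrier N" for x y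
    using that g gh module_isoD(3)[OF h, of "?g x" "?g y"] by (metis M.a_closed)
  show "?g (a \<odot>\<^bsub>N\<^esub> x) = a \<odot>\<^bsub>M\<^esub> ?g x" if "a \<in> carrier R" "x \<in> carrier N" for a x
    using that g gh module_isoD(4)[OF h, of a "?g x"] smult_closed[OF M] by metis
qed

lemma homogeneous_iso_refl: "homogeneous_iso R M M"
  unfolding homogeneous_iso_def by (auto intro!: exI[of _ id] module_iso_refl)

lemma homogeneous_iso_trans:
  assumes "homogeneous_iso R M N" "homogeneous_iso R N P"
  shows "homogeneous_iso R M P"
proof -
  obtain M1 M2 N1 N2 P1 P2 where [simp]: "M = (M1,M2)" "N = (N1,N2)" "P = (P1,P2)"
    by (metis surj_pair)
  obtain g h where gh: "module_iso R M1 N1 g" "\<forall>n. g ` M2 n \<subseteq> N2 n"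
    "module_iso R N1 P1 h" "\<forall>n. h ` N2 n \<subseteq> P2 n"
    using assms by (auto simp: homogeneous_iso_def)
  have "module_iso R M1 P1 (h \<circ> g)" using module_iso_trans[OF gh(1,3)] .
  moreover have "\<forall>n. (h \<circ> g) ` M2 n \<subseteq> P2 n" using gh(2,4) by (auto simp: image_subset_iff)
  ultimately have "\<exists>f. module_iso R M1 P1 f \<and> (\<forall>n. f ` M2 n \<subseteq> P2 n)" by blast
  then show ?thesis by (simp add: homogeneous_iso_def)
qed

lemma module_iso_filt:
  assumes h: "module_iso R M N h" and M: "abelian_group M" and N: "abelian_group N"
    and Mn: "\<And>n. subgroup (Mn n) (add_monoid M)"
    and Nn: "\<And>n. subgroup (Nn n) (add_monoid N)"
    and deg: "\<And>n. h ` Mn n \<subseteq> Nn n" and x: "x \<in> filt M Mn n"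
  shows "h x \<in> filt N Nn n"
  using x
proof (induction n arbitrary: x)
  case 0
  then show ?case using module_iso_zero[OF h M N] abelian_group.filt_0[OF M] abelian_group.filt_0[OF N]
    by auto
next
  case (Suc n)
  interpret M: abelian_group M by fact
  interpret N: abelian_group N by fact
  obtain u v where uv: "u \<in> filt M Mn n" "v \<in> Mn n" "x = u \<oplus>\<^bsub>M\<^esub> v"
    using Suc.prems unfolding M.filt_Suc[of Mn, OF Mn] by blast
  have "h x = h u \<oplus>\<^bsub>N\<^esub> h v" unfolding uv(3)
    by (rule module_isoD(3)[OF h M.filt_carrier[of Mn, OF Mn uv(1)] M.comp_carrier[of Mn, OF Mn uv(2)]])
  moreover have "h v \<in> Nn n" using deg uv(2) by blast
  ultimately show ?case unfolding N.filt_Suc[of Nn, OF Nn] using Suc.IH[OF uv(1)] by blast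
qed

text \<open>A bijection that preserves degrees reflects them: if \<open>h x\<close> has degree \<open>n\<close>, then the leading
  term of \<open>x\<close> is mapped into \<open>N\<^sub>m \<inter> (N\<^sub>0 + \<dots> + N\<^bsub>m-1\<^esub>) = 0\<close>, unless its degree \<open>m\<close> equals \<open>n\<close>.\<close>

lemma homogeneous_iso_onto:
  assumes h: "module_iso R M N h" and M: "abelian_group M" and N: "abelian_group N"
    and dM: "direct_sum M Mn" and dN: "direct_sum N Nn"
    and deg: "\<And>n. h ` Mn n \<subseteq> Nn n"
  shows "h ` Mn n = Nn n"
proof
  interpret M: abelian_group M by fact
  interpret N: abelian_group N by fact
  have Mn: "\<And>n. subgroup (Mn n) (add_monoid M)" and ex: "\<And>x. x \<in> carrier M \<Longrightarrow> \<exists>n. x \<in> filt M Mn n"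
    using dM unfolding M.direct_sum_iff by blast+
  have Nn: "\<And>n. subgroup (Nn n) (add_monoid N)" and ind: "\<And>n. filt N Nn n \<inter> Nn n \<subseteq> {\<zero>\<^bsub>N\<^esub>}"
    using dN unfolding N.direct_sum_iff by blast+
  note hf = module_iso_filt[of R M N h Mn Nn, OF h M N Mn Nn deg]
  have inj0: "x = \<zero>\<^bsub>M\<^esub>" if "x \<in> carrier M" "h x = \<zero>\<^bsub>N\<^esub>" for x
    using that module_isoD(1)[OF h] module_iso_zero[OF h M N] M.zero_closed by (metis inj_onD)
  have "x \<in> Mn n" if "x \<in> filt M Mn m" "h x \<in> Nn n" for x m
    using that
  proof (induction m arbitrary: x)
    case 0
    then show ?case using M.comp_zero[of Mn, OF Mn] by simp
  next
    case (Suc m)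
    obtain u v where uv: "u \<in> filt M Mn m" "v \<in> Mn m" "x = u \<oplus>\<^bsub>M\<^esub> v"
      using Suc.prems unfolding M.filt_Suc[of Mn, OF Mn] by blast
    have uc: "u \<in> carrier M" "v \<in> carrier M"
      using M.filt_carrier[of Mn, OF Mn uv(1)] M.comp_carrier[of Mn, OF Mn uv(2)] .
    have hx: "h x = h u \<oplus>\<^bsub>N\<^esub> h v" unfolding uv(3) by (rule module_isoD(3)[OF h uc])
    have hc: "h u \<in> carrier N" "h v \<in> carrier N" using uc module_isoD(5)[OF h] by auto
    consider "m = n" | "m < n" | "n < m" by linarith
    then show ?case
    proof cases
      case 1
      have "h u = h x \<oplus>\<^bsub>N\<^esub> \<ominus>\<^bsub>N\<^esub> h v" using hx hc by (simp add: N.a_assoc N.r_neg)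
      moreover have "h v \<in> Nn n" using uv 1 deg by blast
      ultimately have "h u \<in> Nn n"
        using Suc.prems N.comp_add[of Nn, OF Nn] N.comp_minus[of Nn, OF Nn] by metis
      then have "h u = \<zero>\<^bsub>N\<^esub>" using ind hf[OF uv(1)] 1 by blast
      then have "u = \<zero>\<^bsub>M\<^esub>" using inj0 uc by blast
      then show ?thesis using uv uc 1 by simp
    next
      case 2
      then have "x \<in> filt M Mn n" using M.filt_mono[of Mn, OF Mn, of "Suc m" n] Suc.prems by auto
      then have "h x = \<zero>\<^bsub>N\<^esub>" using ind hf Suc.prems by blast
      then have "x = \<zero>\<^bsub>M\<^esub>" using inj0 uv uc by auto
      then show ?thesis using M.comp_zero[of Mn, OF Mn] by simp
    next
      case 3
      have "h v = h x \<oplus>\<^bsub>N\<^esub> \<ominus>\<^bsub>N\<^esub> h u" using hx hc by (simp add: N.a_assoc N.a_comm N.r_neg1)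
      moreover have "h x \<in> filt N Nn m"
        using Suc.prems 3 N.comp_filt[of Nn, OF Nn] N.filt_mono[of Nn, OF Nn, of "Suc n" m] by auto
      ultimately have "h v \<in> filt N Nn m"
        using hf[OF uv(1)] N.filt_add[of Nn, OF Nn] N.filt_minus[of Nn, OF Nn] by metis
      then have "h v = \<zero>\<^bsub>N\<^esub>" using ind uv(2) deg by blast
      then have "v = \<zero>\<^bsub>M\<^esub>" using inj0 uc by blast
      then have "x = u" using uv uc by simp
      then show ?thesis using Suc uv by blast
    qed
  qed
  moreover have "\<exists>x\<in>carrier M. y = h x" if "y \<in> Nn n" for y
    using that N.comp_carrier[of Nn, OF Nn] module_isoD(2)[OF h] by blast
  ultimately show "Nn n \<subseteq> h ` Mn n" using ex by blast
qed (use deg in blast)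

lemma homogeneous_iso_sym:
  assumes "homogeneous_iso R (M, Mn) (N, Nn)" and M: "left_module R M" and N: "abelian_group N"
    and dM: "direct_sum M Mn" and dN: "direct_sum N Nn"
  shows "homogeneous_iso R (N, Nn) (M, Mn)"
proof -
  obtain h where h: "module_iso R M N h" "\<And>n. h ` Mn n \<subseteq> Nn n"
    using assms by (auto simp: homogeneous_iso_def)
  note on = homogeneous_iso_onto[of R M N h Mn Nn, OF h(1) left_module_group[OF M] N dM dN h(2)]
  interpret M: abelian_group M using left_module_group[OF M] .
  have "Mn n \<subseteq> carrier M" for n
    using dM M.comp_carrier[of Mn] unfolding M.direct_sum_iff by blast
  then have "inv_into (carrier M) h ` Nn n \<subseteq> Mn n" for n
    unfolding on[symmetric] using module_isoD(1)[OF h(1)] by auto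
  with module_iso_sym[OF h(1) M] have "\<exists>g. module_iso R N M g \<and> (\<forall>n. g ` Nn n \<subseteq> Mn n)" by blast
  then show ?thesis by (simp add: homogeneous_iso_def)
qed

section \<open>Restriction of scalars and transport of modules\<close>

lemma left_module_restrict_scalars:
  assumes M: "left_module R M" and K: "ring K" and \<phi>: "\<phi> \<in> ring_hom K R"
  shows "left_module K (restrict_scalars \<phi> M)"
proof -
  interpret M: abelian_group M using left_module_group[OF M] .
  have c: "\<phi> a \<in> carrier R" if "a \<in> carrier K" for a using ring_hom_closed[OF \<phi>] that .
  show ?thesis
  proof (rule left_moduleI)
    show "abelian_group (restrict_scalars \<phi> M)"
      by (rule abelian_groupI) (auto simp: restrict_scalars_def M.a_ac intro: M.l_neg M.a_inv_closed)
  qed (use c ring_hom_add[OF \<phi>] ring_hom_mult[OF \<phi>] ring_hom_one[OF \<phi>] K left_moduleD[OF M] in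
      \<open>simp_all add: restrict_scalars_def\<close>)
qed

lemma left_submodule:
  assumes V: "left_module R V" and W: "subgroup W (add_monoid V)"
    and cl: "\<And>a x. a \<in> carrier R \<Longrightarrow> x \<in> W \<Longrightarrow> a \<odot>\<^bsub>V\<^esub> x \<in> W"
  shows "left_module R (V\<lparr>carrier := W\<rparr>)"
proof -
  interpret V: abelian_group V using left_module_group[OF V] .
  have sub: "x \<in> W \<Longrightarrow> x \<in> carrier V" for x using subgroup.subset[OF W] by auto
  have W: "\<And>x y. x \<in> W \<Longrightarrow> y \<in> W \<Longrightarrow> x \<oplus>\<^bsub>V\<^esub> y \<in> W" "\<And>x. x \<in> W \<Longrightarrow> \<ominus>\<^bsub>V\<^esub> x \<in> W" "\<zero>\<^bsub>V\<^esub> \<in> W"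
    using subgroup.m_closed[OF W] subgroup.m_inv_closed[OF W] subgroup.one_closed[OF W]
    by (auto simp: a_inv_def)
  show ?thesis
  proof (rule left_moduleI)
    show "abelian_group (V\<lparr>carrier := W\<rparr>)"
    proof (rule abelian_groupI)
      show "\<exists>y\<in>carrier (V\<lparr>carrier := W\<rparr>). y \<oplus>\<^bsub>V\<lparr>carrier := W\<rparr>\<^esub> x = \<zero>\<^bsub>V\<lparr>carrier := W\<rparr>\<^esub>"
        if "x \<in> carrier (V\<lparr>carrier := W\<rparr>)" for x
        using that W(2) V.l_neg[of x] sub by (intro bexI[of _ "\<ominus>\<^bsub>V\<^esub> x"]) auto
    qed (use W sub in \<open>auto simp: V.a_assoc intro: V.a_comm\<close>)
  qed (use left_module_ring[OF V] cl sub left_moduleD(4-)[OF V] in \<open>simp_all\<close>)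
qed

lemma left_module_iso:
  assumes M: "left_module R M" and h: "module_iso R M N h" and z: "h \<zero>\<^bsub>M\<^esub> = \<zero>\<^bsub>N\<^esub>"
  shows "left_module R N"
proof -
  interpret M: abelian_group M using left_module_group[OF M] .
  have c: "carrier N = h ` carrier M" using module_isoD(2)[OF h] by simp
  note add = module_isoD(3)[OF h, symmetric] and sm = module_isoD(4)[OF h, symmetric]
  have cl: "a \<odot>\<^bsub>M\<^esub> x \<in> carrier M" if "a \<in> carrier R" "x \<in> carrier M" for a x
    using smult_closed[OF M that] .
  show ?thesis
  proof (rule left_moduleI)
    show "abelian_group N"
    proof (rule abelian_groupI)
      show "\<exists>y\<in>carrier N. y \<oplus>\<^bsub>N\<^esub> x = \<zero>\<^bsub>N\<^esub>" if x: "x \<in> carrier N" for x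
      proof -
        obtain u where u: "u \<in> carrier M" "x = h u" using x unfolding c by blast
        then show ?thesis
          using M.l_neg[of u] by (intro bexI[of _ "h (\<ominus>\<^bsub>M\<^esub> u)"]) (auto simp: c z[symmetric] add)
      qed
    qed (auto simp: c z[symmetric] add M.a_ac)
    show "\<one>\<^bsub>R\<^esub> \<odot>\<^bsub>N\<^esub> x = x" if "x \<in> carrier N" for x
      using that monoid.one_closed[OF ring.is_monoid[OF left_module_ring[OF M]]] smult_one[OF M]
      by (auto simp: c sm)
    show "(a \<oplus>\<^bsub>R\<^esub> b) \<odot>\<^bsub>N\<^esub> x = a \<odot>\<^bsub>N\<^esub> x \<oplus>\<^bsub>N\<^esub> b \<odot>\<^bsub>N\<^esub> x"
      if "a \<in> carrier R" "b \<in> carrier R" "x \<in> carrier N" for a b x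
      using that ring.ring_simprules(1)[OF left_module_ring[OF M]] smult_l_distr[OF M] cl
      by (auto simp: c sm add)
    show "(a \<otimes>\<^bsub>R\<^esub> b) \<odot>\<^bsub>N\<^esub> x = a \<odot>\<^bsub>N\<^esub> (b \<odot>\<^bsub>N\<^esub> x)"
      if "a \<in> carrier R" "b \<in> carrier R" "x \<in> carrier N" for a b x
      using that ring.ring_simprules(5)[OF left_module_ring[OF M]] smult_assoc[OF M] cl
      by (auto simp: c sm add)
  qed (use left_module_ring[OF M] smult_r_distr[OF M] cl in \<open>auto simp: c sm add\<close>)
qed

definition transport_module :: "('m \<Rightarrow> 't) \<Rightarrow> ('r, 'm) module \<Rightarrow> ('r, 't) module" where
  "transport_module J M = (let g = inv_into (carrier M) J in
     \<lparr>carrier = J ` carrier M, monoid.mult = undefined, monoid.one = undefined, ring.zero = J \<zero>\<^bsub>M\<^esub>,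
      ring.add = (\<lambda>u v. J (g u \<oplus>\<^bsub>M\<^esub> g v)), smult = (\<lambda>a u. J (a \<odot>\<^bsub>M\<^esub> g u))\<rparr>)"

lemma transport_module_iso:
  assumes "inj_on J (carrier M)"
  shows "module_iso R M (transport_module J M) J"
  using assms by (simp add: module_iso_def transport_module_def bij_betw_def Let_def)

lemma left_module_transport:
  assumes M: "left_module R M" and J: "inj_on J (carrier M)"
  shows "left_module R (transport_module J M)"
  by (rule left_module_iso[OF M transport_module_iso[OF J]]) (simp add: transport_module_def Let_def)

lemma subgroup_image:
  assumes M: "abelian_group M" and N: "abelian_group N" and h: "module_iso R M N h"
    and W: "subgroup W (add_monoid M)"
  shows "subgroup (h ` W) (add_monoid N)"
proof -
  interpret M: abelian_group M by fact
  interpret N: abelian_group N by fact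
  have "h \<in> hom (add_monoid M) (add_monoid N)"
    using module_isoD(3,5)[OF h] by (auto simp: hom_def)
  then interpret group_hom "add_monoid M" "add_monoid N" h
    by (simp add: group_hom_def group_hom_axioms_def M.a_group N.a_group)
  show ?thesis using subgroup_img_is_subgroup[OF W] .
qed

lemma graded_module_iso:
  assumes M: "graded_module C Cn (M, Mn)" and h: "module_iso C M N h" and N: "left_module C N"
    and Cn: "\<And>n. Cn n \<subseteq> carrier C"
  shows "graded_module C Cn (N, \<lambda>n. h ` Mn n)"
proof -
  have LM: "left_module C M" and dM: "direct_sum M Mn"
    and deg: "\<And>m n c x. c \<in> Cn m \<Longrightarrow> x \<in> Mn n \<Longrightarrow> c \<odot>\<^bsub>M\<^esub> x \<in> Mn (m + n)"
    using M by (auto simp: graded_module_def)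
  interpret M: abelian_group M using left_module_group[OF LM] .
  interpret N: abelian_group N using left_module_group[OF N] .
  let ?g = "inv_into (carrier M) h" and ?Nn = "\<lambda>n. h ` Mn n"
  have Mn: "subgroup (Mn n) (add_monoid M)" and ex: "x \<in> carrier M \<Longrightarrow> \<exists>n. x \<in> filt M Mn n"
    and ind: "filt M Mn n \<inter> Mn n \<subseteq> {\<zero>\<^bsub>M\<^esub>}" for x n
    using dM unfolding M.direct_sum_iff by blast+
  have Nn: "subgroup (?Nn n) (add_monoid N)" for n
    using subgroup_image[OF M.abelian_group_axioms N.abelian_group_axioms h Mn] .
  have hf: "x \<in> filt M Mn n \<Longrightarrow> h x \<in> filt N ?Nn n" for x n
    by (rule module_iso_filt[OF h M.abelian_group_axioms N.abelian_group_axioms Mn Nn]) auto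
  have g: "module_iso C N M ?g" using module_iso_sym[OF h LM] .
  have gh: "?g (h x) = x" if "x \<in> Mn n" for x n
    using that M.comp_carrier[of Mn, OF Mn] module_isoD(1)[OF h] by auto
  have gf: "y \<in> filt N ?Nn n \<Longrightarrow> ?g y \<in> filt M Mn n" for y n
    by (rule module_iso_filt[OF g N.abelian_group_axioms M.abelian_group_axioms Nn Mn]) (auto simp: gh)
  have "direct_sum N ?Nn" unfolding N.direct_sum_iff
  proof (intro conjI allI ballI)
    fix y assume "y \<in> carrier N"
    then obtain x where "x \<in> carrier M" "y = h x" using module_isoD(2)[OF h] by blast
    then show "\<exists>n. y \<in> filt N ?Nn n" using ex hf by blast
  next
    fix n
    show "filt N ?Nn n \<inter> ?Nn n \<subseteq> {\<zero>\<^bsub>N\<^esub>}"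
    proof
      fix y assume y: "y \<in> filt N ?Nn n \<inter> ?Nn n"
      then obtain x where x: "x \<in> Mn n" "y = h x" by blast
      then have "x \<in> filt M Mn n" using gf[of y n] gh[of x n] y by auto
      then have "x = \<zero>\<^bsub>M\<^esub>" using ind x by blast
      then show "y \<in> {\<zero>\<^bsub>N\<^esub>}"
        using x module_iso_zero[OF h M.abelian_group_axioms N.abelian_group_axioms] by simp
    qed
  qed (use Nn in blast)
  moreover have "c \<odot>\<^bsub>N\<^esub> y \<in> ?Nn (m + n)" if cy: "c \<in> Cn m" "y \<in> ?Nn n" for c y m n
  proof -
    obtain x where x: "x \<in> Mn n" "y = h x" using cy by blast
    then have "c \<odot>\<^bsub>N\<^esub> y = h (c \<odot>\<^bsub>M\<^esub> x)"
      using module_isoD(4)[OF h subsetD[OF Cn cy(1)] M.comp_carrier[of Mn, OF Mn x(1)]] by simp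
    then show ?thesis using deg[OF cy(1) x(1)] by auto
  qed
  ultimately show ?thesis using N by (auto simp: graded_module_def)
qed

lemma free_of_rank_one_iso:
  assumes V: "free_of_rank R V 1" and h: "module_iso R V W h" and W: "left_module R W"
  shows "free_of_rank R W 1"
proof -
  obtain e where e: "e \<in> carrier V" "\<And>v. v \<in> carrier V \<Longrightarrow> \<exists>!a. a \<in> carrier R \<and> v = a \<odot>\<^bsub>V\<^esub> e"
    and LV: "left_module R V"
    using V unfolding free_of_rank_one_iff by metis
  have "\<exists>!a. a \<in> carrier R \<and> w = a \<odot>\<^bsub>W\<^esub> h e" if w: "w \<in> carrier W" for w
  proof -
    obtain v where v: "v \<in> carrier V" "w = h v" using module_isoD(2)[OF h] w by blast
    have eq: "w = a \<odot>\<^bsub>W\<^esub> h e \<longleftrightarrow> v = a \<odot>\<^bsub>V\<^esub> e" if "a \<in> carrier R" for a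
      unfolding v(2) module_isoD(4)[OF h that e(1), symmetric]
      using inj_on_eq_iff[OF module_isoD(1)[OF h] v(1) smult_closed[OF LV that e(1)]] .
    have "(a \<in> carrier R \<and> w = a \<odot>\<^bsub>W\<^esub> h e) \<longleftrightarrow> (a \<in> carrier R \<and> v = a \<odot>\<^bsub>V\<^esub> e)" for a
      using eq by blast
    then show ?thesis using e(2)[OF v(1)] by presburger
  qed
  then show ?thesis
    unfolding free_of_rank_one_iff by (intro conjI W bexI[of _ "h e"] ballI module_isoD(5)[OF h e(1)])
qed

lemma component_left_module:
  assumes N: "graded_module C Cn (N, Nn)" and K: "ring K" and \<kappa>: "\<kappa> \<in> ring_hom K C"
    and \<kappa>0: "\<kappa> ` carrier K \<subseteq> Cn 0"
  shows "left_module K ((restrict_scalars \<kappa> N)\<lparr>carrier := Nn n\<rparr>)"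
proof (rule left_submodule)
  have LN: "left_module C N" and dN: "direct_sum N Nn"
    and deg: "\<And>m n c x. c \<in> Cn m \<Longrightarrow> x \<in> Nn n \<Longrightarrow> c \<odot>\<^bsub>N\<^esub> x \<in> Nn (m + n)"
    using N by (auto simp: graded_module_def)
  show "left_module K (restrict_scalars \<kappa> N)" using left_module_restrict_scalars[OF LN K \<kappa>] .
  show "subgroup (Nn n) (add_monoid (restrict_scalars \<kappa> N))"
    using dN by (simp add: direct_sum_def restrict_scalars_def subgroup_def m_inv_def)
  show "a \<odot>\<^bsub>restrict_scalars \<kappa> N\<^esub> x \<in> Nn n" if "a \<in> carrier K" "x \<in> Nn n" for a x
    using deg[of "\<kappa> a" 0 x n] that \<kappa>0 by (auto simp: restrict_scalars_def)
qed

text \<open>A cyclic module has no more elements than its ring. Sending an element \<open>c x\<close> to a chosen such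
  \<open>c\<close> therefore moves a point module into any type that has room for the ring.\<close>

lemma point_module_in_type:
  fixes \<iota> :: "'c \<Rightarrow> 't" and M :: "('c, 'm) module"
  assumes M: "point_module K \<kappa> C Cn (M, Mn)" and \<iota>: "inj_on \<iota> (carrier C)"
    and K: "ring K" and \<kappa>: "\<kappa> \<in> ring_hom K C" and \<kappa>0: "\<kappa> ` carrier K \<subseteq> Cn 0"
    and Cn: "\<And>n. Cn n \<subseteq> carrier C"
  shows "\<exists>N :: ('c, 't) gmod. point_module K \<kappa> C Cn N \<and> homogeneous_iso C (M, Mn) N"
proof -
  have gM: "graded_module C Cn (M, Mn)" and cM: "cyclic_in_degree_zero C (M, Mn)"
    and fM: "\<And>n. free_of_rank K ((restrict_scalars \<kappa> M)\<lparr>carrier := Mn n\<rparr>) 1"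
    using M by (auto simp: point_module_def)
  have LM: "left_module C M" and dM: "direct_sum M Mn" using gM by (auto simp: graded_module_def)
  interpret M: abelian_group M using left_module_group[OF LM] .
  have Mn: "Mn n \<subseteq> carrier M" for n using dM M.comp_carrier[of Mn] unfolding M.direct_sum_iff by blast
  obtain x where x: "x \<in> Mn 0" "carrier M = {c \<odot>\<^bsub>M\<^esub> x | c. c \<in> carrier C}"
    using cM by (auto simp: cyclic_in_degree_zero_def)
  define s where "s y = (SOME c. c \<in> carrier C \<and> y = c \<odot>\<^bsub>M\<^esub> x)" for y
  have s: "s y \<in> carrier C \<and> y = s y \<odot>\<^bsub>M\<^esub> x" if "y \<in> carrier M" for y
  proof -
    have "\<exists>c. c \<in> carrier C \<and> y = c \<odot>\<^bsub>M\<^esub> x" using that unfolding x(2) by blast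
    from someI_ex[OF this] show ?thesis unfolding s_def .
  qed
  define J where "J = \<iota> \<circ> s"
  have J: "inj_on J (carrier M)"
  proof (rule inj_onI)
    fix y z assume yz: "y \<in> carrier M" "z \<in> carrier M" "J y = J z"
    then have "s y = s z" using inj_onD[OF \<iota>, of "s y" "s z"] s[of y] s[of z] by (simp add: J_def)
    then show "y = z" using s[OF yz(1)] s[OF yz(2)] by simp
  qed
  define N where "N = transport_module J M"
  have h: "module_iso C M N J" unfolding N_def using transport_module_iso[OF J] .
  have LN: "left_module C N" unfolding N_def using left_module_transport[OF LM J] .
  have gN: "graded_module C Cn (N, \<lambda>n. J ` Mn n)" using graded_module_iso[OF gM h LN Cn] .
  moreover have "cyclic_in_degree_zero C (N, \<lambda>n. J ` Mn n)"
  proof -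
    have "carrier N = J ` {c \<odot>\<^bsub>M\<^esub> x | c. c \<in> carrier C}" using module_isoD(2)[OF h] x(2) by simp
    also have "\<dots> = {J (c \<odot>\<^bsub>M\<^esub> x) | c. c \<in> carrier C}" by blast
    also have "\<dots> = {c \<odot>\<^bsub>N\<^esub> J x | c. c \<in> carrier C}"
      using module_isoD(4)[OF h _ subsetD[OF Mn x(1)]] by force
    finally show ?thesis unfolding cyclic_in_degree_zero_def split_conv
      by (intro bexI[of _ "J x"] imageI x(1))
  qed
  moreover have "free_of_rank K ((restrict_scalars \<kappa> N)\<lparr>carrier := J ` Mn n\<rparr>) 1" for n
  proof (rule free_of_rank_one_iso[OF fM])
    show "module_iso K ((restrict_scalars \<kappa> M)\<lparr>carrier := Mn n\<rparr>)
      ((restrict_scalars \<kappa> N)\<lparr>carrier := J ` Mn n\<rparr>) J"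
      unfolding module_iso_def
    proof (intro conjI ballI)
      show "bij_betw J (carrier ((restrict_scalars \<kappa> M)\<lparr>carrier := Mn n\<rparr>))
         (carrier ((restrict_scalars \<kappa> N)\<lparr>carrier := J ` Mn n\<rparr>))"
        using inj_on_subset[OF J Mn] by (simp add: bij_betw_def)
    qed (use module_isoD(3,4)[OF h] subsetD[OF Mn] ring_hom_closed[OF \<kappa>] in
        \<open>auto simp: restrict_scalars_def\<close>)
    show "left_module K ((restrict_scalars \<kappa> N)\<lparr>carrier := J ` Mn n\<rparr>)"
      using component_left_module[OF gN K \<kappa> \<kappa>0] .
  qed
  ultimately have "point_module K \<kappa> C Cn (N, \<lambda>n. J ` Mn n)" by (auto simp: point_module_def)
  moreover have "\<exists>f. module_iso C M N f \<and> (\<forall>n. f ` Mn n \<subseteq> J ` Mn n)" using h by blast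
  then have "homogeneous_iso C (M, Mn) (N, \<lambda>n. J ` Mn n)" by (simp add: homogeneous_iso_def)
  ultimately show ?thesis by blast
qed

section \<open>Families of representatives\<close>

text \<open>A family of representatives of an element of the associated graded object. All operations are
  computed on such families; \<open>gr_of\<close> passes to the cosets.\<close>

definition gr_seqs :: "('m, 'x) ring_scheme \<Rightarrow> (nat \<Rightarrow> 'm set) \<Rightarrow> (nat \<Rightarrow> 'm) set" where
  "gr_seqs M Mn = {a. (\<forall>i. a i \<in> filt M Mn (Suc i)) \<and> finite {i. a i \<notin> filt M Mn i}}"

definition gr_of :: "('m, 'x) ring_scheme \<Rightarrow> (nat \<Rightarrow> 'm set) \<Rightarrow> (nat \<Rightarrow> 'm) \<Rightarrow> nat \<Rightarrow> 'm set" where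
  "gr_of M Mn a = (\<lambda>i. filt M Mn i +>\<^bsub>M\<^esub> a i)"

definition single_seq :: "('m, 'x) ring_scheme \<Rightarrow> nat \<Rightarrow> 'm \<Rightarrow> nat \<Rightarrow> 'm" where
  "single_seq M n x = (\<lambda>i. if i = n then x else \<zero>\<^bsub>M\<^esub>)"

definition convolution :: "('b, 'm) module \<Rightarrow> (nat \<Rightarrow> 'b) \<Rightarrow> (nat \<Rightarrow> 'm) \<Rightarrow> nat \<Rightarrow> 'm" where
  "convolution M a m k = (\<Oplus>\<^bsub>M\<^esub>i\<in>{..k}. a i \<odot>\<^bsub>M\<^esub> m (k - i))"

lemma (in abelian_group) finsum_Sigma:
  assumes "finite I" "\<And>i. i \<in> I \<Longrightarrow> finite (A i)" "\<And>i j. i \<in> I \<Longrightarrow> j \<in> A i \<Longrightarrow> f i j \<in> carrier G"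
  shows "(\<Oplus>i\<in>I. \<Oplus>j\<in>A i. f i j) = (\<Oplus>p\<in>Sigma I A. f (fst p) (snd p))"
proof -
  have S: "Sigma I A = (\<Union>i\<in>I. Pair i ` A i)" by auto
  have "(\<Oplus>p\<in>Sigma I A. f (fst p) (snd p)) = (\<Oplus>i\<in>I. \<Oplus>p\<in>Pair i ` A i. f (fst p) (snd p))"
    unfolding S
  proof (rule add.finprod_UN_disjoint)
    show "pairwise (\<lambda>i j. disjnt (Pair i ` A i) (Pair j ` A j)) I"
      by (auto simp: pairwise_def disjnt_def)
  qed (use assms in auto)
  also have "\<dots> = (\<Oplus>i\<in>I. \<Oplus>j\<in>A i. f i j)"
  proof (rule finsum_cong')
    show "(\<Oplus>p\<in>Pair i ` A i. f (fst p) (snd p)) = (\<Oplus>j\<in>A i. f i j)" if "i \<in> I" for i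
    proof -
      have "(\<lambda>p. f (fst p) (snd p)) \<in> Pair i ` A i \<rightarrow> carrier G" using assms(3)[OF that] by auto
      moreover have "inj_on (Pair i) (A i)" by (auto simp: inj_on_def)
      ultimately show ?thesis using finsum_reindex[of "\<lambda>p. f (fst p) (snd p)" "Pair i" "A i"] by simp
    qed
    show "(\<lambda>i. \<Oplus>j\<in>A i. f i j) \<in> I \<rightarrow> carrier G" using assms(3) by (auto intro!: finsum_closed)
  qed simp
  finally show ?thesis by simp
qed

text \<open>Both sides sum \<open>F a b c\<close> over all \<open>a + b + c = k\<close>. This makes convolution associative.\<close>

lemma (in abelian_group) finsum_triangle:
  fixes k :: nat
  assumes F: "\<And>i j l. F i j l \<in> carrier G"
  shows "(\<Oplus>i\<in>{..k}. \<Oplus>j\<in>{..i}. F j (i - j) (k - i)) = (\<Oplus>i\<in>{..k}. \<Oplus>j\<in>{..k - i}. F i j (k - i - j))"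
proof -
  let ?S = "Sigma {..k} (\<lambda>i. {..i})" and ?T = "Sigma {..k} (\<lambda>i. {..k - i})"
  let ?h = "\<lambda>p::nat\<times>nat. (snd p, fst p - snd p)"
  let ?f = "\<lambda>p. F (fst p) (snd p) (k - fst p - snd p)"
  have im: "?h ` ?S = ?T"
  proof
    show "?T \<subseteq> ?h ` ?S"
    proof
      fix p assume "p \<in> ?T"
      then have "p = ?h (fst p + snd p, fst p)" "(fst p + snd p, fst p) \<in> ?S" by auto
      then show "p \<in> ?h ` ?S" by blast
    qed
  qed auto
  have inj: "inj_on ?h ?S" by (rule inj_onI) auto
  have "(\<Oplus>p\<in>?T. ?f p) = (\<Oplus>p\<in>?S. ?f (?h p))"
    using finsum_reindex[of ?f ?h ?S] inj F unfolding im by simp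
  also have "\<dots> = (\<Oplus>p\<in>?S. F (snd p) (fst p - snd p) (k - fst p))"
    by (rule finsum_cong') (use F in auto)
  finally show ?thesis
    using finsum_Sigma[of "{..k}" "\<lambda>i. {..i}" "\<lambda>i j. F j (i - j) (k - i)"]
      finsum_Sigma[of "{..k}" "\<lambda>i. {..k - i}" "\<lambda>i j. F i j (k - i - j)"] F by simp
qed

context abelian_group
begin

context
  fixes Mn :: "nat \<Rightarrow> 'a set"
  assumes sub: "\<And>n. subgroup (Mn n) (add_monoid G)"
begin

lemma filt_abelian_subgroup: "abelian_subgroup (filt G Mn n) G"
  using abelian_subgroupI3[OF additive_subgroupI[OF filt_subgroup[of Mn, OF sub]] abelian_group_axioms] .

lemma coset_eq_iff:
  assumes "x \<in> carrier G" "y \<in> carrier G"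
  shows "filt G Mn n +> x = filt G Mn n +> y \<longleftrightarrow> x \<ominus> y \<in> filt G Mn n"
proof -
  interpret H: abelian_subgroup "filt G Mn n" G by (rule filt_abelian_subgroup)
  show ?thesis
  proof
    assume e: "filt G Mn n +> x = filt G Mn n +> y"
    then have "x \<in> filt G Mn n +> y" using H.a_rcos_self[OF assms(1)] by simp
    then obtain h where h: "h \<in> filt G Mn n" "x = h \<oplus> y" by (auto simp: a_r_coset_def')
    then have "x \<ominus> y = h" using assms H.a_Hcarr[OF h(1)] by (simp add: a_minus_def a_assoc r_neg)
    then show "x \<ominus> y \<in> filt G Mn n" using h by simp
  next
    assume d: "x \<ominus> y \<in> filt G Mn n"
    have "x = (x \<ominus> y) \<oplus> y" using assms by (simp add: a_minus_def a_assoc l_neg)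
    then have "filt G Mn n +> x = (filt G Mn n +> (x \<ominus> y)) +> y"
      using assms a_coset_add_assoc[OF H.a_subset, of "x \<ominus> y" y] by simp
    then show "filt G Mn n +> x = filt G Mn n +> y"
      using a_coset_join2[OF _ H.a_subgroup d] assms by simp
  qed
qed

lemma coset_zero_iff:
  assumes "x \<in> carrier G"
  shows "filt G Mn n +> x = filt G Mn n \<longleftrightarrow> x \<in> filt G Mn n"
proof -
  interpret H: abelian_subgroup "filt G Mn n" G by (rule filt_abelian_subgroup)
  have "\<ominus> \<zero> = \<zero>" by (rule minus_equality) auto
  then have "x \<ominus> \<zero> = x" unfolding a_minus_def using assms by (metis r_zero)
  then show ?thesis using coset_eq_iff[OF assms zero_closed, of n] assms H.a_subset by simp
qed

lemma gr_seqs_filt: "a \<in> gr_seqs G Mn \<Longrightarrow> a i \<in> filt G Mn (Suc i)"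
  by (simp add: gr_seqs_def)

lemma gr_seqs_carrier: "a \<in> gr_seqs G Mn \<Longrightarrow> a i \<in> carrier G"
  using gr_seqs_filt filt_carrier[of Mn, OF sub] by blast

lemma gr_seqs_bound: 
  assumes "a \<in> gr_seqs G Mn" obtains N where "\<And>i. i \<ge> N \<Longrightarrow> a i \<in> filt G Mn i"
proof -
  have "finite {i. a i \<notin> filt G Mn i}" using assms by (simp add: gr_seqs_def)
  then obtain N where "{i. a i \<notin> filt G Mn i} \<subseteq> {..<N}" using finite_nat_iff_bounded by blast
  then have "a i \<in> filt G Mn i" if "i \<ge> N" for i using that by fastforce
  then show ?thesis using that by blast
qed

lemma gr_seqsI:
  fixes N :: nat
  assumes "\<And>i. a i \<in> filt G Mn (Suc i)" "\<And>i. i \<ge> N \<Longrightarrow> a i \<in> filt G Mn i"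
  shows "a \<in> gr_seqs G Mn"
proof -
  have "{i. a i \<notin> filt G Mn i} \<subseteq> {..<N}" using assms(2) not_less by blast
  then show ?thesis using assms(1) finite_subset by (auto simp: gr_seqs_def)
qed

lemma gr_of_eq_iff:
  assumes "a \<in> gr_seqs G Mn" "b \<in> gr_seqs G Mn"
  shows "gr_of G Mn a = gr_of G Mn b \<longleftrightarrow> (\<forall>i. a i \<ominus> b i \<in> filt G Mn i)"
  using coset_eq_iff[OF gr_seqs_carrier[OF assms(1)] gr_seqs_carrier[OF assms(2)]]
  by (simp add: gr_of_def fun_eq_iff)

lemma gr_of_carrier:
  assumes "a \<in> gr_seqs G Mn" shows "gr_of G Mn a \<in> gr_carrier G Mn"
proof -
  have "{n. gr_of G Mn a n \<noteq> filt G Mn n} = {n. a n \<notin> filt G Mn n}"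
    using coset_zero_iff[OF gr_seqs_carrier[OF assms]] by (simp add: gr_of_def)
  then show ?thesis using assms by (auto simp: gr_carrier_def gr_of_def gr_seqs_def)
qed

text \<open>Representatives can be chosen to be zero in all degrees in which the coset is zero.\<close>

lemma gr_carrierE:
  assumes "g \<in> gr_carrier G Mn"
  obtains a where "a \<in> gr_seqs G Mn" "g = gr_of G Mn a" "\<And>i. g i = filt G Mn i \<Longrightarrow> a i = \<zero>"
proof -
  have "\<forall>n. \<exists>x. x \<in> filt G Mn (Suc n) \<and> g n = filt G Mn n +> x"
    using assms unfolding gr_carrier_def by blast
  then obtain x where x: "\<And>n. x n \<in> filt G Mn (Suc n)" "\<And>n. g n = filt G Mn n +> x n" by metis
  define a where "a n = (if g n = filt G Mn n then \<zero> else x n)" for n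
  have z: "\<zero> \<in> filt G Mn n" for n using filt_zero[of Mn, OF sub] .
  have "g n = filt G Mn n +> a n" for n
    using x(2)[of n] coset_zero_iff[of \<zero> n] z[of n] by (auto simp: a_def)
  then have 2: "g = gr_of G Mn a" by (auto simp: gr_of_def)
  have "{i. a i \<notin> filt G Mn i} \<subseteq> {n. g n \<noteq> filt G Mn n}" using z by (auto simp: a_def)
  moreover have "finite {n. g n \<noteq> filt G Mn n}" using assms by (simp add: gr_carrier_def)
  ultimately have "a \<in> gr_seqs G Mn"
    using x(1) z finite_subset by (auto simp: gr_seqs_def a_def)
  then show ?thesis using that 2 by (simp add: a_def)
qed

lemma gr_of_mem:
  assumes a: "a \<in> gr_seqs G Mn" and b: "\<And>i. b i \<in> gr_of G Mn a i"
  shows "b i \<in> filt G Mn (Suc i) \<and> b i \<ominus> a i \<in> filt G Mn i"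
proof -
  obtain h where h: "h \<in> filt G Mn i" "b i = h \<oplus> a i"
    using b[of i] by (auto simp: gr_of_def a_r_coset_def')
  have "h \<in> filt G Mn (Suc i)" using filt_mono[of Mn, OF sub, of i "Suc i"] h by simp
  then have "b i \<in> filt G Mn (Suc i)" unfolding h using filt_add[of Mn, OF sub] gr_seqs_filt[OF a] by blast
  moreover have "b i \<ominus> a i = h" unfolding h
    using filt_carrier[of Mn, OF sub h(1)] gr_seqs_carrier[OF a] by (simp add: a_minus_def a_assoc r_neg)
  ultimately show ?thesis using h by simp
qed

lemma gr_of_self: "a \<in> gr_seqs G Mn \<Longrightarrow> a i \<in> gr_of G Mn a i"
  using abelian_subgroup.a_rcos_self[OF filt_abelian_subgroup] gr_seqs_carrier by (simp add: gr_of_def)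

lemma gr_of_add:
  assumes "a \<in> gr_seqs G Mn" "b \<in> gr_seqs G Mn"
  shows "gr_of G Mn a k <+> gr_of G Mn b k = gr_of G Mn (\<lambda>i. a i \<oplus> b i) k"
  unfolding gr_of_def
  by (rule abelian_subgroup.a_rcos_sum[OF filt_abelian_subgroup gr_seqs_carrier[OF assms(1)]
        gr_seqs_carrier[OF assms(2)]])

lemma gr_seqs_add:
  assumes "a \<in> gr_seqs G Mn" "b \<in> gr_seqs G Mn"
  shows "(\<lambda>i. a i \<oplus> b i) \<in> gr_seqs G Mn"
proof -
  obtain N N' where "\<And>i. i \<ge> N \<Longrightarrow> a i \<in> filt G Mn i" "\<And>i. i \<ge> N' \<Longrightarrow> b i \<in> filt G Mn i"
    using gr_seqs_bound assms by metis
  then show ?thesis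
    using gr_seqs_filt assms by (intro gr_seqsI[where N = "max N N'"] filt_add[of Mn, OF sub]) auto
qed

lemma gr_seqs_minus:
  assumes "a \<in> gr_seqs G Mn" shows "(\<lambda>i. \<ominus> a i) \<in> gr_seqs G Mn"
proof -
  obtain N where "\<And>i. i \<ge> N \<Longrightarrow> a i \<in> filt G Mn i" using gr_seqs_bound assms by metis
  then show ?thesis
    using gr_seqs_filt assms by (intro gr_seqsI[where N = N] filt_minus[of Mn, OF sub]) auto
qed

lemma gr_seqs_zero: "(\<lambda>i. \<zero>) \<in> gr_seqs G Mn"
  using filt_zero[of Mn, OF sub] by (intro gr_seqsI[where N = 0]) auto

lemma gr_of_zero: "gr_of G Mn (\<lambda>i. \<zero>) = filt G Mn"
  using coset_zero_iff[OF zero_closed] filt_zero[of Mn, OF sub] by (auto simp: gr_of_def)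

lemma gr_seqs_single: "x \<in> filt G Mn (Suc n) \<Longrightarrow> single_seq G n x \<in> gr_seqs G Mn"
  using filt_zero[of Mn, OF sub] by (intro gr_seqsI[where N = "Suc n"]) (auto simp: single_seq_def)

lemma gr_comp_iff: "g \<in> gr_comp G Mn n \<longleftrightarrow> (\<exists>x\<in>filt G Mn (Suc n). g = gr_of G Mn (single_seq G n x))"
proof
  assume g: "g \<in> gr_comp G Mn n"
  then have "g \<in> gr_carrier G Mn" by (simp add: gr_comp_def)
  then obtain a where a: "a \<in> gr_seqs G Mn" "g = gr_of G Mn a" "\<And>i. g i = filt G Mn i \<Longrightarrow> a i = \<zero>"
    using gr_carrierE by metis
  then have "a = single_seq G n (a n)" using g by (auto simp: gr_comp_def single_seq_def)
  then show "\<exists>x\<in>filt G Mn (Suc n). g = gr_of G Mn (single_seq G n x)"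
    using a gr_seqs_filt by metis
next
  assume "\<exists>x\<in>filt G Mn (Suc n). g = gr_of G Mn (single_seq G n x)"
  then obtain x where x: "x \<in> filt G Mn (Suc n)" "g = gr_of G Mn (single_seq G n x)" by blast
  have "gr_of G Mn (single_seq G n x) k = filt G Mn k" if "k \<noteq> n" for k
    using that coset_zero_iff[OF zero_closed] filt_zero[of Mn, OF sub] by (simp add: gr_of_def single_seq_def)
  then show "g \<in> gr_comp G Mn n"
    using gr_of_carrier[OF gr_seqs_single[OF x(1)]] x by (simp add: gr_comp_def)
qed

end
end

section \<open>The associated graded ring and its modules\<close>

locale semi_graded_pair =
  fixes B :: "'b ring" and Bn :: "nat \<Rightarrow> 'b set" and M :: "('b, 'm) module" and Mn :: "nat \<Rightarrow> 'm set"
  assumes sg_ring: "semi_graded_ring B Bn" and sg_module: "semi_graded_module B Bn (M, Mn)"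
begin

lemma left_module: "left_module B M"
  using sg_module by (simp add: semi_graded_module_def)

sublocale B: ring B using sg_ring by (simp add: semi_graded_ring_def)
sublocale M: abelian_group M using left_module_group[OF left_module] .

abbreviation FB where "FB \<equiv> filt B Bn"
abbreviation FM where "FM \<equiv> filt M Mn"
abbreviation GB where "GB \<equiv> gr_ring B Bn"
abbreviation GM where "GM \<equiv> fst (gr_module (M, Mn))"

lemma Bn_subgroup: "subgroup (Bn n) (add_monoid B)"
  using sg_ring unfolding semi_graded_ring_def B.direct_sum_iff by blast

lemma Mn_subgroup: "subgroup (Mn n) (add_monoid M)"
  and M_indep: "FM n \<inter> Mn n \<subseteq> {\<zero>\<^bsub>M\<^esub>}"
  using sg_module unfolding semi_graded_module_def split_conv M.direct_sum_iff by blast+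

lemma smult_comp: "b \<in> Bn m \<Longrightarrow> x \<in> Mn n \<Longrightarrow> b \<odot>\<^bsub>M\<^esub> x \<in> FM (Suc (m + n))"
  using sg_module by (auto simp: semi_graded_module_def)

lemma one_comp: "\<one>\<^bsub>B\<^esub> \<in> Bn 0"
  using sg_ring by (simp add: semi_graded_ring_def)

lemmas FB_carrier = B.filt_carrier[of Bn, OF Bn_subgroup]
lemmas FB_zero = B.filt_zero[of Bn, OF Bn_subgroup]
lemmas FB_add = B.filt_add[of Bn, OF Bn_subgroup]
lemmas FB_mono = B.filt_mono[of Bn, OF Bn_subgroup]
lemmas FB_Suc = B.filt_Suc[of Bn, OF Bn_subgroup]
lemmas Bn_FB = B.comp_filt[of Bn, OF Bn_subgroup]
lemmas Bn_carrier = B.comp_carrier[of Bn, OF Bn_subgroup]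
lemmas FM_carrier = M.filt_carrier[of Mn, OF Mn_subgroup]
lemmas FM_zero = M.filt_zero[of Mn, OF Mn_subgroup]
lemmas FM_add = M.filt_add[of Mn, OF Mn_subgroup]
lemmas FM_minus = M.filt_minus[of Mn, OF Mn_subgroup]
lemmas FM_diff = M.filt_diff[of Mn, OF Mn_subgroup]
lemmas FM_mono = M.filt_mono[of Mn, OF Mn_subgroup]
lemmas FM_Suc = M.filt_Suc[of Mn, OF Mn_subgroup]
lemmas FM_finsum = M.finsum_filt[of Mn, OF Mn_subgroup]
lemmas Mn_FM = M.comp_filt[of Mn, OF Mn_subgroup]
lemmas Mn_carrier = M.comp_carrier[of Mn, OF Mn_subgroup]
lemmas sm_closed = smult_closed[OF left_module]

lemma FM_smult_comp: "b \<in> Bn m \<Longrightarrow> x \<in> FM n \<Longrightarrow> b \<odot>\<^bsub>M\<^esub> x \<in> FM (m + n)"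
proof (induction n arbitrary: x)
  case 0
  then show ?case using smult_r_null[OF left_module Bn_carrier] FM_zero by simp
next
  case (Suc n)
  obtain u v where uv: "u \<in> FM n" "v \<in> Mn n" "x = u \<oplus>\<^bsub>M\<^esub> v" using Suc.prems unfolding FM_Suc by blast
  have "b \<odot>\<^bsub>M\<^esub> u \<in> FM (m + Suc n)" using Suc.IH[OF Suc.prems(1) uv(1)] FM_mono[of "m + n" "m + Suc n"] by simp
  moreover have "b \<odot>\<^bsub>M\<^esub> v \<in> FM (m + Suc n)" using smult_comp[OF Suc.prems(1) uv(2)] by simp
  ultimately show ?case unfolding uv(3)
      smult_r_distr[OF left_module Bn_carrier[OF Suc.prems(1)] FM_carrier[OF uv(1)] Mn_carrier[OF uv(2)]]
    by (rule FM_add)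
qed

lemma FM_smult: "b \<in> FB (Suc m) \<Longrightarrow> x \<in> FM n \<Longrightarrow> b \<odot>\<^bsub>M\<^esub> x \<in> FM (m + n)"
proof (induction m arbitrary: b)
  case 0
  then obtain u v where "u \<in> FB 0" "v \<in> Bn 0" "b = u \<oplus>\<^bsub>B\<^esub> v" unfolding FB_Suc by blast
  then have "b \<in> Bn 0" using Bn_carrier by simp
  then show ?case using FM_smult_comp[of b 0 x n] 0 by simp
next
  case (Suc m)
  obtain u v where uv: "u \<in> FB (Suc m)" "v \<in> Bn (Suc m)" "b = u \<oplus>\<^bsub>B\<^esub> v"
    using Suc.prems unfolding FB_Suc[of _ "Suc m"] by blast
  have "u \<odot>\<^bsub>M\<^esub> x \<in> FM (Suc m + n)" using Suc.IH[OF uv(1) Suc.prems(2)] FM_mono[of "m + n" "Suc m + n"] by simp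
  moreover have "v \<odot>\<^bsub>M\<^esub> x \<in> FM (Suc m + n)" using FM_smult_comp[OF uv(2) Suc.prems(2)] .
  ultimately show ?case unfolding uv(3)
      smult_l_distr[OF left_module FB_carrier[OF uv(1)] Bn_carrier[OF uv(2)] FM_carrier[OF Suc.prems(2)]]
    by (rule FM_add)
qed

lemma FM_smult_lower: "b \<in> FB m \<Longrightarrow> x \<in> FM (Suc n) \<Longrightarrow> b \<odot>\<^bsub>M\<^esub> x \<in> FM (m + n)"
proof (cases m)
  case 0
  then show "b \<in> FB m \<Longrightarrow> x \<in> FM (Suc n) \<Longrightarrow> b \<odot>\<^bsub>M\<^esub> x \<in> FM (m + n)"
    using smult_l_null[OF left_module FM_carrier] FM_zero by simp
next
  case (Suc k)
  then show "b \<in> FB m \<Longrightarrow> x \<in> FM (Suc n) \<Longrightarrow> b \<odot>\<^bsub>M\<^esub> x \<in> FM (m + n)"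
    using FM_smult[of b k x "Suc n"] by simp
qed

abbreviation "seqB \<equiv> gr_seqs B Bn"
abbreviation "seqM \<equiv> gr_seqs M Mn"
abbreviation "grB \<equiv> gr_of B Bn"
abbreviation "grM \<equiv> gr_of M Mn"

lemmas seqB_FB = B.gr_seqs_filt[of Bn, OF Bn_subgroup]
lemmas seqB_carrier = B.gr_seqs_carrier[of Bn, OF Bn_subgroup]
lemmas seqM_FM = M.gr_seqs_filt[of Mn, OF Mn_subgroup]
lemmas seqM_carrier = M.gr_seqs_carrier[of Mn, OF Mn_subgroup]
lemmas grM_eq_iff = M.gr_of_eq_iff[of Mn, OF Mn_subgroup]

lemma conv_seq:
  assumes a: "a \<in> seqB" and m: "m \<in> seqM"
  shows "convolution M a m \<in> seqM"
proof -
  obtain p where p: "\<And>i. i \<ge> p \<Longrightarrow> a i \<in> FB i" using B.gr_seqs_bound[of Bn, OF Bn_subgroup a] by metis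
  obtain q where q: "\<And>i. i \<ge> q \<Longrightarrow> m i \<in> FM i" using M.gr_seqs_bound[of Mn, OF Mn_subgroup m] by metis
  show ?thesis
  proof (rule M.gr_seqsI[of Mn, OF Mn_subgroup, where N = "p + q"])
    show "convolution M a m k \<in> FM (Suc k)" for k
      unfolding convolution_def
    proof (rule FM_finsum)
      fix i assume "i \<in> {..k}"
      then show "a i \<odot>\<^bsub>M\<^esub> m (k - i) \<in> FM (Suc k)"
        using FM_smult[OF seqB_FB[OF a, of i] seqM_FM[OF m, of "k - i"]] by simp
    qed
    show "convolution M a m k \<in> FM k" if k: "k \<ge> p + q" for k
      unfolding convolution_def
    proof (rule FM_finsum)
      fix i assume i: "i \<in> {..k}"
      show "a i \<odot>\<^bsub>M\<^esub> m (k - i) \<in> FM k"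
      proof (cases "i \<ge> p")
        case True
        then show ?thesis using FM_smult_lower[OF p seqM_FM[OF m, of "k - i"], of i] i by simp
      next
        case False
        then have "k - i \<ge> q" using k by simp
        then show ?thesis using FM_smult[OF seqB_FB[OF a, of i] q, of "k - i"] i by simp
      qed
    qed
  qed
qed

text \<open>A change of representatives in degree \<open>i\<close> by an element of lower degree changes a product of
  degree \<open>k\<close> by an element of degree below \<open>k\<close>, because \<open>F\<^sub>i(B) F\<^sub>j(M) \<subseteq> F\<^bsub>i+j\<^esub>(M)\<close>.\<close>

lemma conv_congruent:
  assumes a: "a \<in> seqB" and m: "m \<in> seqM"
    and a': "\<And>i. a' i \<in> FB (Suc i) \<and> a' i \<ominus>\<^bsub>B\<^esub> a i \<in> FB i"
    and m': "\<And>i. m' i \<in> FM (Suc i) \<and> m' i \<ominus>\<^bsub>M\<^esub> m i \<in> FM i"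
  shows "FM k +>\<^bsub>M\<^esub> convolution M a' m' k = FM k +>\<^bsub>M\<^esub> convolution M a m k"
proof -
  have c: "a i \<in> carrier B" "a' i \<in> carrier B" "m i \<in> carrier M" "m' i \<in> carrier M" for i
    using seqB_carrier[OF a] seqM_carrier[OF m] a' m' FB_carrier FM_carrier by blast+
  define d where "d i = (a' i \<ominus>\<^bsub>B\<^esub> a i) \<odot>\<^bsub>M\<^esub> m' (k - i) \<oplus>\<^bsub>M\<^esub> a i \<odot>\<^bsub>M\<^esub> (m' (k - i) \<ominus>\<^bsub>M\<^esub> m (k - i))" for i
  have d: "d i \<in> FM k" if "i \<le> k" for i
    using FM_smult_lower[of "a' i \<ominus>\<^bsub>B\<^esub> a i" i "m' (k - i)" "k - i"]
      FM_smult[of "a i" i "m' (k - i) \<ominus>\<^bsub>M\<^esub> m (k - i)" "k - i"] a'[of i] m'[of "k - i"] seqB_FB[OF a, of i] that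
    unfolding d_def by (intro FM_add) auto
  have split: "a' i \<odot>\<^bsub>M\<^esub> m' (k - i) = d i \<oplus>\<^bsub>M\<^esub> a i \<odot>\<^bsub>M\<^esub> m (k - i)" for i
  proof -
    have "a' i \<odot>\<^bsub>M\<^esub> m' (k - i) = ((a' i \<ominus>\<^bsub>B\<^esub> a i) \<oplus>\<^bsub>B\<^esub> a i) \<odot>\<^bsub>M\<^esub> m' (k - i)"
      using c by (simp add: a_minus_def B.a_assoc B.l_neg)
    also have "\<dots> = (a' i \<ominus>\<^bsub>B\<^esub> a i) \<odot>\<^bsub>M\<^esub> m' (k - i) \<oplus>\<^bsub>M\<^esub> a i \<odot>\<^bsub>M\<^esub> m' (k - i)"
      using c by (intro smult_l_distr[OF left_module]) auto
    also have "a i \<odot>\<^bsub>M\<^esub> m' (k - i) = a i \<odot>\<^bsub>M\<^esub> ((m' (k - i) \<ominus>\<^bsub>M\<^esub> m (k - i)) \<oplus>\<^bsub>M\<^esub> m (k - i))"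
      using c by (simp add: a_minus_def M.a_assoc M.l_neg)
    also have "\<dots> = a i \<odot>\<^bsub>M\<^esub> (m' (k - i) \<ominus>\<^bsub>M\<^esub> m (k - i)) \<oplus>\<^bsub>M\<^esub> a i \<odot>\<^bsub>M\<^esub> m (k - i)"
      using c by (intro smult_r_distr[OF left_module]) auto
    finally show ?thesis unfolding d_def using c sm_closed by (simp add: M.a_assoc)
  qed
  have dc: "d i \<in> carrier M" for i unfolding d_def using c sm_closed by simp
  have "convolution M a' m' k = (\<Oplus>\<^bsub>M\<^esub>i\<in>{..k}. d i) \<oplus>\<^bsub>M\<^esub> convolution M a m k"
    unfolding convolution_def split using dc c sm_closed by (intro M.finsum_addf) auto
  moreover have D: "(\<Oplus>\<^bsub>M\<^esub>i\<in>{..k}. d i) \<in> FM k" using d by (intro FM_finsum) auto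
  moreover have cc: "convolution M a m k \<in> carrier M" using seqM_carrier[OF conv_seq[OF a m]] .
  ultimately have "convolution M a' m' k \<ominus>\<^bsub>M\<^esub> convolution M a m k = (\<Oplus>\<^bsub>M\<^esub>i\<in>{..k}. d i)"
    using FM_carrier[OF D] by (simp add: a_minus_def M.a_assoc M.r_neg)
  then have "convolution M a' m' k \<ominus>\<^bsub>M\<^esub> convolution M a m k \<in> FM k" using D by simp
  moreover have "convolution M a' m' k \<in> carrier M"
    unfolding convolution_def using c sm_closed by (intro M.finsum_closed) auto
  ultimately show ?thesis using M.coset_eq_iff[of Mn, OF Mn_subgroup _ cc] by blast
qed

text \<open>The union in the definition of the product is a union of equal cosets.\<close>

lemma gr_smult:
  assumes a: "a \<in> seqB" and m: "m \<in> seqM"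
  shows "grB a \<odot>\<^bsub>GM\<^esub> grM m = grM (convolution M a m)"
proof
  fix k
  have "(\<Union>a'\<in>{a'. \<forall>i. a' i \<in> grB a i}. \<Union>m'\<in>{m'. \<forall>i. m' i \<in> grM m i}.
      FM k +>\<^bsub>M\<^esub> convolution M a' m' k) = FM k +>\<^bsub>M\<^esub> convolution M a m k" (is "(\<Union>a'\<in>?A. \<Union>m'\<in>?C. ?F a' m') = ?R")
  proof -
    have "?F a' m' = ?R" if a'm': "a' \<in> ?A" "m' \<in> ?C" for a' m'
    proof (rule conv_congruent[OF a m])
      show "a' i \<in> FB (Suc i) \<and> a' i \<ominus>\<^bsub>B\<^esub> a i \<in> FB i" for i
        using a'm' B.gr_of_mem[of Bn, OF Bn_subgroup a, of a'] by blast
      show "m' i \<in> FM (Suc i) \<and> m' i \<ominus>\<^bsub>M\<^esub> m i \<in> FM i" for i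
        using a'm' M.gr_of_mem[of Mn, OF Mn_subgroup m, of m'] by blast
    qed
    moreover have "a \<in> ?A" "m \<in> ?C"
      using B.gr_of_self[of Bn, OF Bn_subgroup a] M.gr_of_self[of Mn, OF Mn_subgroup m] by blast+
    ultimately show ?thesis by blast
  qed
  then show "(grB a \<odot>\<^bsub>GM\<^esub> grM m) k = grM (convolution M a m) k"
    by (simp add: gr_module_def convolution_def gr_of_def)
qed

lemma GM_carrier: "carrier GM = gr_carrier M Mn" and GM_zero: "\<zero>\<^bsub>GM\<^esub> = filt M Mn"
  by (simp_all add: gr_module_def)

lemma GM_add:
  assumes "a \<in> seqM" "b \<in> seqM" shows "grM a \<oplus>\<^bsub>GM\<^esub> grM b = grM (\<lambda>i. a i \<oplus>\<^bsub>M\<^esub> b i)"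
  using M.gr_of_add[of Mn, OF Mn_subgroup assms] by (simp add: gr_module_def)

lemma GM_E: 
  assumes "g \<in> carrier GM" obtains a where "a \<in> seqM" "g = grM a"
  using M.gr_carrierE[of Mn, OF Mn_subgroup] assms unfolding GM_carrier by metis

lemma GM_I: "a \<in> seqM \<Longrightarrow> grM a \<in> carrier GM"
  using M.gr_of_carrier[of Mn, OF Mn_subgroup] by (simp add: GM_carrier)

lemma GM_abelian_group: "abelian_group GM"
proof (rule abelian_groupI)
  note add = M.gr_seqs_add[of Mn, OF Mn_subgroup]
  have z: "\<zero>\<^bsub>GM\<^esub> = grM (\<lambda>i. \<zero>\<^bsub>M\<^esub>)" "(\<lambda>i. \<zero>\<^bsub>M\<^esub>) \<in> seqM"
    using M.gr_of_zero[of Mn, OF Mn_subgroup] M.gr_seqs_zero[of Mn, OF Mn_subgroup] by (simp_all add: GM_zero)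
  show "\<zero>\<^bsub>GM\<^esub> \<in> carrier GM" unfolding z(1) by (rule GM_I[OF z(2)])
  fix x assume "x \<in> carrier GM"
  then obtain a where a: "a \<in> seqM" "x = grM a" by (rule GM_E)
  have "(\<lambda>i. \<zero>\<^bsub>M\<^esub> \<oplus>\<^bsub>M\<^esub> a i) = a" using seqM_carrier[OF a(1)] by simp
  then show "\<zero>\<^bsub>GM\<^esub> \<oplus>\<^bsub>GM\<^esub> x = x" unfolding a(2) z(1) GM_add[OF z(2) a(1)] by simp
  have "(\<lambda>i. \<ominus>\<^bsub>M\<^esub> a i \<oplus>\<^bsub>M\<^esub> a i) = (\<lambda>i. \<zero>\<^bsub>M\<^esub>)" using seqM_carrier[OF a(1)] by (simp add: M.l_neg)
  then have "grM (\<lambda>i. \<ominus>\<^bsub>M\<^esub> a i) \<oplus>\<^bsub>GM\<^esub> x = \<zero>\<^bsub>GM\<^esub>"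
    unfolding a(2) z(1) GM_add[OF M.gr_seqs_minus[of Mn, OF Mn_subgroup a(1)] a(1)] by simp
  then show "\<exists>y\<in>carrier GM. y \<oplus>\<^bsub>GM\<^esub> x = \<zero>\<^bsub>GM\<^esub>"
    using GM_I[OF M.gr_seqs_minus[of Mn, OF Mn_subgroup a(1)]] by blast
  fix y assume "y \<in> carrier GM"
  then obtain b where b: "b \<in> seqM" "y = grM b" by (rule GM_E)
  show "x \<oplus>\<^bsub>GM\<^esub> y \<in> carrier GM" unfolding a(2) b(2) GM_add[OF a(1) b(1)] by (rule GM_I[OF add[OF a(1) b(1)]])
  show "x \<oplus>\<^bsub>GM\<^esub> y = y \<oplus>\<^bsub>GM\<^esub> x" unfolding a(2) b(2) GM_add[OF a(1) b(1)] GM_add[OF b(1) a(1)]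
    using seqM_carrier[OF a(1)] seqM_carrier[OF b(1)] by (simp add: M.a_comm)
  fix z assume "z \<in> carrier GM"
  then obtain c where c: "c \<in> seqM" "z = grM c" by (rule GM_E)
  show "x \<oplus>\<^bsub>GM\<^esub> y \<oplus>\<^bsub>GM\<^esub> z = x \<oplus>\<^bsub>GM\<^esub> (y \<oplus>\<^bsub>GM\<^esub> z)"
    unfolding a(2) b(2) c(2) GM_add[OF a(1) b(1)] GM_add[OF b(1) c(1)]
      GM_add[OF add[OF a(1) b(1)] c(1)] GM_add[OF a(1) add[OF b(1) c(1)]]
    using seqM_carrier[OF a(1)] seqM_carrier[OF b(1)] seqM_carrier[OF c(1)] by (simp add: M.a_assoc)
qed

lemma conv_l_distr:
  assumes "a \<in> seqB" "b \<in> seqB" "m \<in> seqM"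
  shows "convolution M (\<lambda>i. a i \<oplus>\<^bsub>B\<^esub> b i) m = (\<lambda>i. convolution M a m i \<oplus>\<^bsub>M\<^esub> convolution M b m i)"
  unfolding convolution_def
  using seqB_carrier[OF assms(1)] seqB_carrier[OF assms(2)] seqM_carrier[OF assms(3)]
    smult_l_distr[OF left_module] sm_closed
  by (auto simp: fun_eq_iff Pi_def intro!: M.finsum_addf)

lemma conv_r_distr:
  assumes "a \<in> seqB" "m \<in> seqM" "n \<in> seqM"
  shows "convolution M a (\<lambda>i. m i \<oplus>\<^bsub>M\<^esub> n i) = (\<lambda>i. convolution M a m i \<oplus>\<^bsub>M\<^esub> convolution M a n i)"
  unfolding convolution_def
  using seqB_carrier[OF assms(1)] seqM_carrier[OF assms(2)] seqM_carrier[OF assms(3)]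
    smult_r_distr[OF left_module] sm_closed
  by (auto simp: fun_eq_iff Pi_def intro!: M.finsum_addf)

lemma conv_assoc:
  assumes "a \<in> seqB" "b \<in> seqB" "m \<in> seqM"
  shows "convolution M (convolution (regular_module B) a b) m = convolution M a (convolution M b m)"
proof
  fix k
  have c: "a i \<in> carrier B" "b i \<in> carrier B" "m i \<in> carrier M" for i
    using seqB_carrier[OF assms(1)] seqB_carrier[OF assms(2)] seqM_carrier[OF assms(3)] by auto
  have B_conv: "convolution (regular_module B) a b i = (\<Oplus>\<^bsub>B\<^esub>j\<in>{..i}. a j \<otimes>\<^bsub>B\<^esub> b (i - j))" for i
    by (simp add: convolution_def regular_module_def finsum_def finprod_def)
  have "convolution M (convolution (regular_module B) a b) m k =
      (\<Oplus>\<^bsub>M\<^esub>i\<in>{..k}. \<Oplus>\<^bsub>M\<^esub>j\<in>{..i}. a j \<odot>\<^bsub>M\<^esub> (b (i - j) \<odot>\<^bsub>M\<^esub> m (k - i)))"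
    unfolding convolution_def[of M] B_conv
  proof (rule M.finsum_cong')
    show "(\<Oplus>\<^bsub>B\<^esub>j\<in>{..i}. a j \<otimes>\<^bsub>B\<^esub> b (i - j)) \<odot>\<^bsub>M\<^esub> m (k - i) =
      (\<Oplus>\<^bsub>M\<^esub>j\<in>{..i}. a j \<odot>\<^bsub>M\<^esub> (b (i - j) \<odot>\<^bsub>M\<^esub> m (k - i)))" for i
      using finsum_smult_distr[OF left_module c(3), of "{..i}" "\<lambda>j. a j \<otimes>\<^bsub>B\<^esub> b (i - j)" "k - i"] c
      by (simp add: smult_assoc[OF left_module])
  qed (use c sm_closed in \<open>auto intro!: M.finsum_closed\<close>)
  also have "\<dots> = (\<Oplus>\<^bsub>M\<^esub>i\<in>{..k}. \<Oplus>\<^bsub>M\<^esub>j\<in>{..k - i}. a i \<odot>\<^bsub>M\<^esub> (b j \<odot>\<^bsub>M\<^esub> m (k - i - j)))"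
    using M.finsum_triangle[of "\<lambda>i j l. a i \<odot>\<^bsub>M\<^esub> (b j \<odot>\<^bsub>M\<^esub> m l)" k] c sm_closed by simp
  also have "\<dots> = convolution M a (convolution M b m) k"
    unfolding convolution_def
  proof (rule M.finsum_cong')
    show "(\<Oplus>\<^bsub>M\<^esub>j\<in>{..k - i}. a i \<odot>\<^bsub>M\<^esub> (b j \<odot>\<^bsub>M\<^esub> m (k - i - j))) =
      a i \<odot>\<^bsub>M\<^esub> (\<Oplus>\<^bsub>M\<^esub>j\<in>{..k - i}. b j \<odot>\<^bsub>M\<^esub> m (k - i - j))" for i
      using smult_finsum_distr[OF left_module c(1), of "{..k - i}" "\<lambda>j. b j \<odot>\<^bsub>M\<^esub> m (k - i - j)" i] c sm_closed
      by simp
  qed (use c sm_closed in \<open>auto intro!: M.finsum_closed\<close>)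
  finally show "convolution M (convolution (regular_module B) a b) m k = convolution M a (convolution M b m) k" .
qed

lemma conv_single_0:
  assumes "c \<in> carrier B" "m \<in> seqM"
  shows "convolution M (single_seq B 0 c) m = (\<lambda>k. c \<odot>\<^bsub>M\<^esub> m k)"
proof
  fix k
  have "(\<Oplus>\<^bsub>M\<^esub>i\<in>{..k}. single_seq B 0 c i \<odot>\<^bsub>M\<^esub> m (k - i)) =
      (\<Oplus>\<^bsub>M\<^esub>i\<in>{..k}. if 0 = i then c \<odot>\<^bsub>M\<^esub> m (k - i) else \<zero>\<^bsub>M\<^esub>)"
    using assms seqM_carrier[OF assms(2)] sm_closed smult_l_null[OF left_module]
    by (intro M.finsum_cong') (auto simp: single_seq_def)
  also have "\<dots> = c \<odot>\<^bsub>M\<^esub> m k"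
    using M.finsum_singleton[of 0 "{..k}" "\<lambda>i. c \<odot>\<^bsub>M\<^esub> m (k - i)"] assms seqM_carrier[OF assms(2)] sm_closed
    by auto
  finally show "convolution M (single_seq B 0 c) m k = c \<odot>\<^bsub>M\<^esub> m k" by (simp add: convolution_def)
qed

lemma conv_single_right:
  assumes "a \<in> seqB" "x \<in> carrier M"
  shows "convolution M a (single_seq M n x) k = (if n \<le> k then a (k - n) \<odot>\<^bsub>M\<^esub> x else \<zero>\<^bsub>M\<^esub>)"
proof -
  have "(\<Oplus>\<^bsub>M\<^esub>i\<in>{..k}. a i \<odot>\<^bsub>M\<^esub> single_seq M n x (k - i)) =
      (\<Oplus>\<^bsub>M\<^esub>i\<in>{..k}. if k - n = i \<and> n \<le> k then a i \<odot>\<^bsub>M\<^esub> x else \<zero>\<^bsub>M\<^esub>)"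
    using assms seqB_carrier[OF assms(1)] sm_closed smult_r_null[OF left_module]
    by (intro M.finsum_cong') (auto simp: single_seq_def)
  also have "\<dots> = (if n \<le> k then a (k - n) \<odot>\<^bsub>M\<^esub> x else \<zero>\<^bsub>M\<^esub>)"
    using M.finsum_singleton[of "k - n" "{..k}" "\<lambda>i. a i \<odot>\<^bsub>M\<^esub> x"] assms seqB_carrier[OF assms(1)] sm_closed
    by auto
  finally show ?thesis by (simp add: convolution_def)
qed

end

lemma regular_module_simps [simp]:
  "carrier (regular_module B) = carrier B" "\<zero>\<^bsub>regular_module B\<^esub> = \<zero>\<^bsub>B\<^esub>"
  "x \<oplus>\<^bsub>regular_module B\<^esub> y = x \<oplus>\<^bsub>B\<^esub> y" "a \<odot>\<^bsub>regular_module B\<^esub> x = a \<otimes>\<^bsub>B\<^esub> x"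
  by (simp_all add: regular_module_def)

lemma single_seq_regular_module: "single_seq (regular_module B) = single_seq B"
  unfolding single_seq_def regular_module_simps ..

lemma filt_regular_module: "filt (regular_module B) Bn = filt B Bn"
  by (simp add: filt_def regular_module_def finsum_def finprod_def fun_eq_iff)

lemma a_r_coset_regular_module: "H +>\<^bsub>regular_module B\<^esub> x = H +>\<^bsub>B\<^esub> x"
  by (simp add: a_r_coset_def' regular_module_def)

lemma gr_seqs_regular_module: "gr_seqs (regular_module B) Bn = gr_seqs B Bn"
  by (simp add: gr_seqs_def filt_regular_module)

lemma gr_of_regular_module: "gr_of (regular_module B) Bn = gr_of B Bn"
  by (simp add: gr_of_def filt_regular_module a_r_coset_regular_module fun_eq_iff)

lemma direct_sum_regular_module: "direct_sum (regular_module B) Bn \<longleftrightarrow> direct_sum B Bn"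
  by (simp add: direct_sum_def regular_module_def finsum_def finprod_def subgroup_def m_inv_def)

lemma gr_carrier_regular_module: "gr_carrier (regular_module B) Bn = gr_carrier B Bn"
  by (simp add: gr_carrier_def filt_regular_module a_r_coset_regular_module)

text \<open>A ring is a semi-graded module over itself. The ring axioms of the associated graded ring are
  the module axioms for this case.\<close>

lemma semi_graded_pair_regular:
  assumes "semi_graded_ring B Bn" shows "semi_graded_pair B Bn (regular_module B) Bn"
proof
  show "semi_graded_ring B Bn" by fact
  have "b \<odot>\<^bsub>regular_module B\<^esub> x = b \<otimes>\<^bsub>B\<^esub> x" for b x by (simp add: regular_module_def)
  then show "semi_graded_module B Bn (regular_module B, Bn)"
    using assms regular_left_module[of B]
    by (simp add: semi_graded_module_def semi_graded_ring_def direct_sum_regular_module filt_regular_module)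
qed

lemma gr_ring_as_module:
  fixes B :: "'b ring" and Bn :: "nat \<Rightarrow> 'b set"
  defines "R \<equiv> fst (gr_module (regular_module B, Bn))"
  shows "carrier R = carrier (gr_ring B Bn)" "\<zero>\<^bsub>R\<^esub> = \<zero>\<^bsub>gr_ring B Bn\<^esub>"
    "x \<oplus>\<^bsub>R\<^esub> y = x \<oplus>\<^bsub>gr_ring B Bn\<^esub> y" "x \<odot>\<^bsub>R\<^esub> y = x \<otimes>\<^bsub>gr_ring B Bn\<^esub> y"
  unfolding R_def gr_module_def gr_ring_def
  by (simp_all add: gr_carrier_regular_module filt_regular_module a_r_coset_regular_module set_add_def'
      finsum_def finprod_def) (simp_all add: regular_module_def)

context semi_graded_pair
begin

sublocale R: semi_graded_pair B Bn "regular_module B" Bn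
  using semi_graded_pair_regular[OF sg_ring] .

abbreviation "convB \<equiv> convolution (regular_module B)"
abbreviation "convM \<equiv> convolution M"

lemma GB_E:
  assumes "g \<in> carrier GB" obtains a where "a \<in> seqB" "g = grB a"
  using R.GM_E[of g] assms unfolding gr_ring_as_module gr_seqs_regular_module gr_of_regular_module by metis

lemma GB_I: "a \<in> seqB \<Longrightarrow> grB a \<in> carrier GB"
  using R.GM_I[of a] unfolding gr_ring_as_module gr_seqs_regular_module gr_of_regular_module .

lemma GB_add: "a \<in> seqB \<Longrightarrow> b \<in> seqB \<Longrightarrow> grB a \<oplus>\<^bsub>GB\<^esub> grB b = grB (\<lambda>i. a i \<oplus>\<^bsub>B\<^esub> b i)"
  using R.GM_add[of a b] unfolding gr_ring_as_module gr_seqs_regular_module gr_of_regular_module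
  by (simp add: regular_module_def)

lemma GB_mult: "a \<in> seqB \<Longrightarrow> b \<in> seqB \<Longrightarrow> grB a \<otimes>\<^bsub>GB\<^esub> grB b = grB (convB a b)"
  using R.gr_smult[of a b] unfolding gr_ring_as_module gr_seqs_regular_module gr_of_regular_module .

lemma convB_seq: "a \<in> seqB \<Longrightarrow> b \<in> seqB \<Longrightarrow> convB a b \<in> seqB"
  using R.conv_seq[of a b] unfolding gr_seqs_regular_module .

lemma convB_single_0: "c \<in> carrier B \<Longrightarrow> b \<in> seqB \<Longrightarrow> convB (single_seq B 0 c) b = (\<lambda>k. c \<otimes>\<^bsub>B\<^esub> b k)"
  using R.conv_single_0[of c b] by (simp add: gr_seqs_regular_module)

lemma convB_single_right: "a \<in> seqB \<Longrightarrow> x \<in> carrier B \<Longrightarrow>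
    convB a (single_seq B n x) k = (if n \<le> k then a (k - n) \<otimes>\<^bsub>B\<^esub> x else \<zero>\<^bsub>B\<^esub>)"
  using R.conv_single_right[of a x n k] 
  by (cases "n \<le> k") (simp_all add: gr_seqs_regular_module single_seq_regular_module)

lemma seqB_add: "a \<in> seqB \<Longrightarrow> b \<in> seqB \<Longrightarrow> (\<lambda>i. a i \<oplus>\<^bsub>B\<^esub> b i) \<in> seqB"
  using B.gr_seqs_add[of Bn, OF Bn_subgroup] .

lemma seqM_add: "a \<in> seqM \<Longrightarrow> b \<in> seqM \<Longrightarrow> (\<lambda>i. a i \<oplus>\<^bsub>M\<^esub> b i) \<in> seqM"
  using M.gr_seqs_add[of Mn, OF Mn_subgroup] .

lemma seqB_single: "x \<in> FB (Suc n) \<Longrightarrow> single_seq B n x \<in> seqB"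
  using B.gr_seqs_single[of Bn, OF Bn_subgroup] .

lemma seqM_single: "x \<in> FM (Suc n) \<Longrightarrow> single_seq M n x \<in> seqM"
  using M.gr_seqs_single[of Mn, OF Mn_subgroup] .

lemma gr_unit_eq: "k \<in> Bn 0 \<Longrightarrow> gr_unit B Bn k = grB (single_seq B 0 k)"
  using B.coset_zero_iff[of Bn, OF Bn_subgroup B.zero_closed] FB_zero
  by (auto simp: gr_unit_def gr_of_def single_seq_def fun_eq_iff)

lemma GB_one: "\<one>\<^bsub>GB\<^esub> = grB (single_seq B 0 \<one>\<^bsub>B\<^esub>)"
  using gr_unit_eq[OF one_comp] by (simp add: gr_ring_def)

lemma one_seq: "single_seq B 0 \<one>\<^bsub>B\<^esub> \<in> seqB"
  using seqB_single Bn_FB[OF one_comp] .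

lemma GB_ring: "ring GB"
proof (rule ringI)
  interpret A: abelian_group "fst (gr_module (regular_module B, Bn))" by (rule R.GM_abelian_group)
  show "abelian_group GB"
    by (rule abelian_groupI)
      (fact A.a_closed[unfolded gr_ring_as_module] A.zero_closed[unfolded gr_ring_as_module]
        A.a_assoc[unfolded gr_ring_as_module] A.a_comm[unfolded gr_ring_as_module]
        A.l_zero[unfolded gr_ring_as_module] A.add.l_inv_ex[unfolded gr_ring_as_module])+
  have assoc: "x \<otimes>\<^bsub>GB\<^esub> y \<otimes>\<^bsub>GB\<^esub> z = x \<otimes>\<^bsub>GB\<^esub> (y \<otimes>\<^bsub>GB\<^esub> z)" and cl: "x \<otimes>\<^bsub>GB\<^esub> y \<in> carrier GB"
    and ld: "(x \<oplus>\<^bsub>GB\<^esub> y) \<otimes>\<^bsub>GB\<^esub> z = x \<otimes>\<^bsub>GB\<^esub> z \<oplus>\<^bsub>GB\<^esub> y \<otimes>\<^bsub>GB\<^esub> z"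
    and rd: "z \<otimes>\<^bsub>GB\<^esub> (x \<oplus>\<^bsub>GB\<^esub> y) = z \<otimes>\<^bsub>GB\<^esub> x \<oplus>\<^bsub>GB\<^esub> z \<otimes>\<^bsub>GB\<^esub> y"
    and l1: "\<one>\<^bsub>GB\<^esub> \<otimes>\<^bsub>GB\<^esub> x = x" and r1: "x \<otimes>\<^bsub>GB\<^esub> \<one>\<^bsub>GB\<^esub> = x"
    if xyz: "x \<in> carrier GB" "y \<in> carrier GB" "z \<in> carrier GB" for x y z
  proof -
    obtain a where a: "a \<in> seqB" "x = grB a" using xyz(1) by (rule GB_E)
    obtain b where b: "b \<in> seqB" "y = grB b" using xyz(2) by (rule GB_E)
    obtain c where c: "c \<in> seqB" "z = grB c" using xyz(3) by (rule GB_E)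
    note s = a(1) b(1) c(1) convB_seq seqB_add one_seq
    show "x \<otimes>\<^bsub>GB\<^esub> y \<otimes>\<^bsub>GB\<^esub> z = x \<otimes>\<^bsub>GB\<^esub> (y \<otimes>\<^bsub>GB\<^esub> z)"
      unfolding a b c using R.conv_assoc[of a b c] s by (simp add: GB_mult gr_seqs_regular_module)
    show "x \<otimes>\<^bsub>GB\<^esub> y \<in> carrier GB" unfolding a b using s by (simp add: GB_mult GB_I)
    show "(x \<oplus>\<^bsub>GB\<^esub> y) \<otimes>\<^bsub>GB\<^esub> z = x \<otimes>\<^bsub>GB\<^esub> z \<oplus>\<^bsub>GB\<^esub> y \<otimes>\<^bsub>GB\<^esub> z"
      unfolding a b c using R.conv_l_distr[of a b c] s
      by (simp add: GB_mult GB_add gr_seqs_regular_module)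
    show "z \<otimes>\<^bsub>GB\<^esub> (x \<oplus>\<^bsub>GB\<^esub> y) = z \<otimes>\<^bsub>GB\<^esub> x \<oplus>\<^bsub>GB\<^esub> z \<otimes>\<^bsub>GB\<^esub> y"
      unfolding a b c using R.conv_r_distr[of c a b] s
      by (simp add: GB_mult GB_add gr_seqs_regular_module)
    show "\<one>\<^bsub>GB\<^esub> \<otimes>\<^bsub>GB\<^esub> x = x"
      unfolding GB_one a using convB_single_0[of "\<one>\<^bsub>B\<^esub>" a] s seqB_carrier[OF a(1)]
      by (simp add: GB_mult)
    have "convB a (single_seq B 0 \<one>\<^bsub>B\<^esub>) k = a k" for k
      using convB_single_right[of a "\<one>\<^bsub>B\<^esub>" 0 k] s seqB_carrier[OF a(1)] by simp
    then have "convB a (single_seq B 0 \<one>\<^bsub>B\<^esub>) = a" by blast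
    then show "x \<otimes>\<^bsub>GB\<^esub> \<one>\<^bsub>GB\<^esub> = x" unfolding GB_one a using s by (simp add: GB_mult)
  qed
  show "Group.monoid GB"
    by (rule monoidI) (use assoc cl l1 r1 GB_I[OF one_seq] GB_one in auto)
  show "\<And>x y z. x \<in> carrier GB \<Longrightarrow> y \<in> carrier GB \<Longrightarrow> z \<in> carrier GB \<Longrightarrow>
     (x \<oplus>\<^bsub>GB\<^esub> y) \<otimes>\<^bsub>GB\<^esub> z = x \<otimes>\<^bsub>GB\<^esub> z \<oplus>\<^bsub>GB\<^esub> y \<otimes>\<^bsub>GB\<^esub> z" using ld .
  show "\<And>x y z. x \<in> carrier GB \<Longrightarrow> y \<in> carrier GB \<Longrightarrow> z \<in> carrier GB \<Longrightarrow>
     z \<otimes>\<^bsub>GB\<^esub> (x \<oplus>\<^bsub>GB\<^esub> y) = z \<otimes>\<^bsub>GB\<^esub> x \<oplus>\<^bsub>GB\<^esub> z \<otimes>\<^bsub>GB\<^esub> y" using rd .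
qed

lemma GM_left_module: "left_module GB GM"
proof (rule left_moduleI[OF GB_ring GM_abelian_group])
  fix x u assume "x \<in> carrier GB" "u \<in> carrier GM"
  then obtain a m where a: "a \<in> seqB" "x = grB a" and m: "m \<in> seqM" "u = grM m"
    using GB_E GM_E by metis
  show "x \<odot>\<^bsub>GM\<^esub> u \<in> carrier GM" unfolding a m gr_smult[OF a(1) m(1)] by (rule GM_I[OF conv_seq[OF a(1) m(1)]])
  {
    fix y assume "y \<in> carrier GB"
    then obtain b where b: "b \<in> seqB" "y = grB b" using GB_E by metis
    show "(x \<oplus>\<^bsub>GB\<^esub> y) \<odot>\<^bsub>GM\<^esub> u = x \<odot>\<^bsub>GM\<^esub> u \<oplus>\<^bsub>GM\<^esub> y \<odot>\<^bsub>GM\<^esub> u"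
      unfolding a m b using a(1) b(1) m(1) conv_l_distr[of a b m]
      by (simp add: GB_add gr_smult GM_add seqB_add conv_seq)
    show "(x \<otimes>\<^bsub>GB\<^esub> y) \<odot>\<^bsub>GM\<^esub> u = x \<odot>\<^bsub>GM\<^esub> (y \<odot>\<^bsub>GM\<^esub> u)"
      unfolding a m b using a(1) b(1) m(1) conv_assoc[of a b m]
      by (simp add: GB_mult gr_smult convB_seq conv_seq)
  next
    fix v assume "v \<in> carrier GM"
    then obtain n where n: "n \<in> seqM" "v = grM n" using GM_E by metis
    show "x \<odot>\<^bsub>GM\<^esub> (u \<oplus>\<^bsub>GM\<^esub> v) = x \<odot>\<^bsub>GM\<^esub> u \<oplus>\<^bsub>GM\<^esub> x \<odot>\<^bsub>GM\<^esub> v"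
      unfolding a m n using a(1) n(1) m(1) conv_r_distr[of a m n]
      by (simp add: gr_smult GM_add seqM_add conv_seq)
  }
next
  fix u assume "u \<in> carrier GM"
  then obtain m where m: "m \<in> seqM" "u = grM m" using GM_E by metis
  show "\<one>\<^bsub>GB\<^esub> \<odot>\<^bsub>GM\<^esub> u = u"
    unfolding m GB_one using m(1) one_seq conv_single_0[of "\<one>\<^bsub>B\<^esub>" m] seqM_carrier[OF m(1)]
    by (simp add: gr_smult smult_one[OF left_module])
qed

lemma gr_comp_M: "g \<in> gr_comp M Mn n \<longleftrightarrow> (\<exists>x\<in>FM (Suc n). g = grM (single_seq M n x))"
  using M.gr_comp_iff[of Mn, OF Mn_subgroup] .

lemma gr_comp_B: "g \<in> gr_comp B Bn n \<longleftrightarrow> (\<exists>x\<in>FB (Suc n). g = grB (single_seq B n x))"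
  using B.gr_comp_iff[of Bn, OF Bn_subgroup] .

lemma gr_comp_mult:
  assumes "c \<in> gr_comp B Bn p" "g \<in> gr_comp M Mn n"
  shows "c \<odot>\<^bsub>GM\<^esub> g \<in> gr_comp M Mn (p + n)"
proof -
  obtain b x where b: "b \<in> FB (Suc p)" "c = grB (single_seq B p b)"
    and x: "x \<in> FM (Suc n)" "g = grM (single_seq M n x)"
    using assms unfolding gr_comp_M gr_comp_B by blast
  have "convM (single_seq B p b) (single_seq M n x) k = single_seq M (p + n) (b \<odot>\<^bsub>M\<^esub> x) k" for k
    unfolding conv_single_right[OF seqB_single[OF b(1)] FM_carrier[OF x(1)]]
    using smult_l_null[OF left_module FM_carrier[OF x(1)]] by (auto simp: single_seq_def)
  then have "convM (single_seq B p b) (single_seq M n x) = single_seq M (p + n) (b \<odot>\<^bsub>M\<^esub> x)" by blast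
  then have "c \<odot>\<^bsub>GM\<^esub> g = grM (single_seq M (p + n) (b \<odot>\<^bsub>M\<^esub> x))"
    unfolding b(2) x(2) by (simp add: gr_smult seqB_single[OF b(1)] seqM_single[OF x(1)])
  moreover have "b \<odot>\<^bsub>M\<^esub> x \<in> FM (Suc (p + n))" using FM_smult[OF b(1) x(1)] by simp
  ultimately show ?thesis unfolding gr_comp_M by blast
qed

lemma gr_comp_subgroup: "subgroup (gr_comp M Mn n) (add_monoid GM)"
proof -
  interpret GM: abelian_group GM using GM_abelian_group .
  have add: "grM (single_seq M n x) \<oplus>\<^bsub>GM\<^esub> grM (single_seq M n y) = grM (single_seq M n (x \<oplus>\<^bsub>M\<^esub> y))"
    if "x \<in> FM (Suc n)" "y \<in> FM (Suc n)" for x y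
  proof -
    have "(\<lambda>i. single_seq M n x i \<oplus>\<^bsub>M\<^esub> single_seq M n y i) = single_seq M n (x \<oplus>\<^bsub>M\<^esub> y)"
      by (auto simp: single_seq_def)
    then show ?thesis using GM_add[OF seqM_single seqM_single] that by simp
  qed
  have z: "grM (single_seq M n \<zero>\<^bsub>M\<^esub>) = \<zero>\<^bsub>GM\<^esub>"
  proof -
    have "single_seq M n \<zero>\<^bsub>M\<^esub> = (\<lambda>i. \<zero>\<^bsub>M\<^esub>)" by (auto simp: single_seq_def)
    then show ?thesis using M.gr_of_zero[of Mn, OF Mn_subgroup] GM_zero by simp
  qed
  have cl: "g \<in> carrier GM" if "g \<in> gr_comp M Mn n" for g
    using that by (simp add: gr_comp_def GM_carrier)
  show ?thesis
  proof (rule GM.add.subgroupI)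
    show "gr_comp M Mn n \<subseteq> carrier GM" using cl by blast
    show "gr_comp M Mn n \<noteq> {}" using FM_zero[of "Suc n"] unfolding gr_comp_M by (auto simp: ex_in_conv[symmetric] gr_comp_M)
  next
    fix g assume g: "g \<in> gr_comp M Mn n"
    then obtain x where x: "x \<in> FM (Suc n)" "g = grM (single_seq M n x)" unfolding gr_comp_M by blast
    have "grM (single_seq M n (\<ominus>\<^bsub>M\<^esub> x)) \<oplus>\<^bsub>GM\<^esub> g = \<zero>\<^bsub>GM\<^esub>"
      unfolding x(2) add[OF FM_minus[OF x(1)] x(1)] using FM_carrier[OF x(1)] z by (simp add: M.l_neg)
    moreover have m: "grM (single_seq M n (\<ominus>\<^bsub>M\<^esub> x)) \<in> gr_comp M Mn n"
      unfolding gr_comp_M using FM_minus[OF x(1)] by blast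
    ultimately have "\<ominus>\<^bsub>GM\<^esub> g = grM (single_seq M n (\<ominus>\<^bsub>M\<^esub> x))"
      using GM.minus_equality cl[OF g] cl by blast
    then show "\<ominus>\<^bsub>GM\<^esub> g \<in> gr_comp M Mn n" using m by simp
  next
    fix g h assume "g \<in> gr_comp M Mn n" "h \<in> gr_comp M Mn n"
    then obtain x y where "x \<in> FM (Suc n)" "g = grM (single_seq M n x)" "y \<in> FM (Suc n)" "h = grM (single_seq M n y)"
      unfolding gr_comp_M by blast
    then show "g \<oplus>\<^bsub>GM\<^esub> h \<in> gr_comp M Mn n" unfolding gr_comp_M using add FM_add by metis
  qed
qed

text \<open>The \<open>n\<close>-th step of the filtration of \<open>Gr(M)\<close> consists of the elements that vanish in all degrees from
  \<open>n\<close> on. Both inclusions are proved by induction, and each gives one of the two conditions for a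
  direct sum.\<close>

lemma gr_direct_sum: "direct_sum GM (gr_comp M Mn)"
proof -
  interpret GM: abelian_group GM using GM_abelian_group .
  note filt_Suc = GM.filt_Suc[of "gr_comp M Mn", OF gr_comp_subgroup]
  have below: "\<forall>k\<ge>n. g k = FM k" if "g \<in> filt GM (gr_comp M Mn) n" for g n
    using that
  proof (induction n arbitrary: g)
    case 0
    then show ?case by (simp add: GM_zero)
  next
    case (Suc n)
    obtain u v where uv: "u \<in> filt GM (gr_comp M Mn) n" "v \<in> gr_comp M Mn n" "g = u \<oplus>\<^bsub>GM\<^esub> v"
      using Suc.prems unfolding filt_Suc by blast
    have "g k = FM k" if "k \<ge> Suc n" for k
    proof -
      have "u k = FM k" "v k = FM k" using Suc.IH[OF uv(1)] uv(2) that by (auto simp: gr_comp_def)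
      then have "g k = FM k <+>\<^bsub>M\<^esub> FM k" unfolding uv(3) by (simp add: gr_module_def)
      then show ?thesis using M.subgroup_add_id[OF M.filt_subgroup[of Mn, OF Mn_subgroup]] by simp
    qed
    then show ?case by blast
  qed
  have exhaust: "grM a \<in> filt GM (gr_comp M Mn) n" if "a \<in> seqM" "\<And>k. k \<ge> n \<Longrightarrow> a k = \<zero>\<^bsub>M\<^esub>" for a n
    using that
  proof (induction n arbitrary: a)
    case 0
    then have "a = (\<lambda>i. \<zero>\<^bsub>M\<^esub>)" by blast
    then show ?case using M.gr_of_zero[of Mn, OF Mn_subgroup] GM_zero by simp
  next
    case (Suc n)
    let ?b = "a(n := \<zero>\<^bsub>M\<^esub>)" and ?c = "single_seq M n (a n)"
    have b: "?b \<in> seqM"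
      using seqM_FM[OF Suc.prems(1)] FM_zero Suc.prems(2)
      by (intro M.gr_seqsI[of Mn, OF Mn_subgroup, where N = "Suc n"]) auto
    have c: "?c \<in> seqM" using seqM_single seqM_FM[OF Suc.prems(1)] .
    have "a = (\<lambda>i. ?b i \<oplus>\<^bsub>M\<^esub> ?c i)" using seqM_carrier[OF Suc.prems(1)] by (auto simp: single_seq_def)
    then have e: "grM a = grM ?b \<oplus>\<^bsub>GM\<^esub> grM ?c" using GM_add[OF b c] by simp
    have "grM ?b \<in> filt GM (gr_comp M Mn) n"
      using Suc.prems(2) by (intro Suc.IH[OF b]) (auto simp: le_Suc_eq)
    moreover have "grM ?c \<in> gr_comp M Mn n" unfolding gr_comp_M using seqM_FM[OF Suc.prems(1)] by blast
    ultimately show ?case unfolding filt_Suc e by blast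
  qed
  show ?thesis unfolding GM.direct_sum_iff
  proof (intro conjI allI ballI)
    show "subgroup (gr_comp M Mn n) (add_monoid GM)" for n by (rule gr_comp_subgroup)
  next
    fix g assume g: "g \<in> carrier GM"
    then have "g \<in> gr_carrier M Mn" by (simp add: GM_carrier)
    then obtain a where a: "a \<in> seqM" "g = grM a" "\<And>i. g i = FM i \<Longrightarrow> a i = \<zero>\<^bsub>M\<^esub>"
      using M.gr_carrierE[of Mn, OF Mn_subgroup] by metis
    have "finite {n. g n \<noteq> FM n}" using \<open>g \<in> gr_carrier M Mn\<close> by (simp add: gr_carrier_def)
    then obtain N where N: "{n. g n \<noteq> FM n} \<subseteq> {..<N}" using finite_nat_iff_bounded by blast
    then have "a k = \<zero>\<^bsub>M\<^esub>" if "k \<ge> N" for k using a(3)[of k] that by fastforce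
    then show "\<exists>n. g \<in> filt GM (gr_comp M Mn) n" using exhaust[OF a(1)] a(2) by blast
  next
    fix n
    show "filt GM (gr_comp M Mn) n \<inter> gr_comp M Mn n \<subseteq> {\<zero>\<^bsub>GM\<^esub>}"
    proof
      fix g assume g: "g \<in> filt GM (gr_comp M Mn) n \<inter> gr_comp M Mn n"
      have "g k = FM k" for k using below[of g n] g by (cases "k = n") (auto simp: gr_comp_def)
      then show "g \<in> {\<zero>\<^bsub>GM\<^esub>}" by (auto simp: GM_zero)
    qed
  qed
qed

lemma gr_graded_module: "graded_module GB (gr_comp B Bn) (GM, gr_comp M Mn)"
  using GM_left_module gr_direct_sum gr_comp_mult by (auto simp: graded_module_def)

end

context semi_graded_pair
begin

lemma FB_1_iff: "b \<in> FB (Suc 0) \<longleftrightarrow> b \<in> Bn 0"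
proof
  assume "b \<in> FB (Suc 0)"
  then obtain u v where "u \<in> FB 0" "v \<in> Bn 0" "b = u \<oplus>\<^bsub>B\<^esub> v" unfolding FB_Suc by blast
  then show "b \<in> Bn 0" using Bn_carrier by simp
qed (rule Bn_FB)

lemma FB_mult: "b \<in> FB (Suc m) \<Longrightarrow> y \<in> FB n \<Longrightarrow> b \<otimes>\<^bsub>B\<^esub> y \<in> FB (m + n)"
  using R.FM_smult[of b m y n] by (simp add: filt_regular_module)

lemma B0_mult: "a \<in> Bn 0 \<Longrightarrow> b \<in> Bn 0 \<Longrightarrow> a \<otimes>\<^bsub>B\<^esub> b \<in> Bn 0"
  using FB_mult[of a 0 b "Suc 0"] by (simp add: FB_1_iff)

lemma B0_add: "a \<in> Bn 0 \<Longrightarrow> b \<in> Bn 0 \<Longrightarrow> a \<oplus>\<^bsub>B\<^esub> b \<in> Bn 0"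
  using B.comp_add[of Bn, OF Bn_subgroup] .

lemma gr_unit_hom: "gr_unit B Bn \<in> ring_hom (base_ring B Bn) GB"
proof (rule ring_hom_memI)
  fix k assume "k \<in> carrier (base_ring B Bn)"
  then have k: "k \<in> Bn 0" by simp
  then show "gr_unit B Bn k \<in> carrier GB" using gr_unit_eq GB_I[OF seqB_single[OF Bn_FB]] by simp
  fix l assume "l \<in> carrier (base_ring B Bn)"
  then have l: "l \<in> Bn 0" by simp
  note s = seqB_single[OF Bn_FB[OF k]] seqB_single[OF Bn_FB[OF l]]
  have "convB (single_seq B 0 k) (single_seq B 0 l) = single_seq B 0 (k \<otimes>\<^bsub>B\<^esub> l)"
    unfolding convB_single_0[OF Bn_carrier[OF k] s(2)] using Bn_carrier[OF k] by (auto simp: single_seq_def)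
  then show "gr_unit B Bn (k \<otimes>\<^bsub>base_ring B Bn\<^esub> l) = gr_unit B Bn k \<otimes>\<^bsub>GB\<^esub> gr_unit B Bn l"
    using k l B0_mult by (simp add: gr_unit_eq GB_mult[OF s])
  have "(\<lambda>i. single_seq B 0 k i \<oplus>\<^bsub>B\<^esub> single_seq B 0 l i) = single_seq B 0 (k \<oplus>\<^bsub>B\<^esub> l)"
    by (auto simp: single_seq_def)
  then show "gr_unit B Bn (k \<oplus>\<^bsub>base_ring B Bn\<^esub> l) = gr_unit B Bn k \<oplus>\<^bsub>GB\<^esub> gr_unit B Bn l"
    using k l B0_add by (simp add: gr_unit_eq GB_add[OF s])
next
  show "gr_unit B Bn \<one>\<^bsub>base_ring B Bn\<^esub> = \<one>\<^bsub>GB\<^esub>" by (simp add: gr_ring_def)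
qed

lemma gr_unit_central:
  assumes "\<forall>k\<in>Bn 0. \<forall>b\<in>carrier B. k \<otimes>\<^bsub>B\<^esub> b = b \<otimes>\<^bsub>B\<^esub> k" and k: "k \<in> Bn 0" and x: "x \<in> carrier GB"
  shows "gr_unit B Bn k \<otimes>\<^bsub>GB\<^esub> x = x \<otimes>\<^bsub>GB\<^esub> gr_unit B Bn k"
proof -
  obtain a where a: "a \<in> seqB" "x = grB a" using x by (rule GB_E)
  have s: "single_seq B 0 k \<in> seqB" using seqB_single[OF Bn_FB[OF k]] .
  have "convB (single_seq B 0 k) a = convB a (single_seq B 0 k)"
    using convB_single_0[OF Bn_carrier[OF k] a(1)] convB_single_right[OF a(1) Bn_carrier[OF k], of 0]
      assms(1) k seqB_carrier[OF a(1)] by (auto simp: fun_eq_iff)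
  then show ?thesis unfolding gr_unit_eq[OF k] a(2) using GB_mult s a(1) by simp
qed

lemma gr_unit_comp: "gr_unit B Bn ` carrier (base_ring B Bn) \<subseteq> gr_comp B Bn 0"
  using gr_unit_eq Bn_FB unfolding gr_comp_B image_subset_iff by auto

lemma gr_comp_B_carrier: "gr_comp B Bn n \<subseteq> carrier GB"
  by (auto simp: gr_comp_def gr_ring_def)

lemma gr_smult_unit:
  assumes "k \<in> Bn 0" "x \<in> FM (Suc n)"
  shows "gr_unit B Bn k \<odot>\<^bsub>GM\<^esub> grM (single_seq M n x) = grM (single_seq M n (k \<odot>\<^bsub>M\<^esub> x))"
proof -
  have "convM (single_seq B 0 k) (single_seq M n x) = single_seq M n (k \<odot>\<^bsub>M\<^esub> x)"
    unfolding conv_single_0[OF Bn_carrier[OF assms(1)] seqM_single[OF assms(2)]]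
    using smult_r_null[OF left_module Bn_carrier[OF assms(1)]] by (auto simp: single_seq_def)
  then show ?thesis
    unfolding gr_unit_eq[OF assms(1)]
    using gr_smult[OF seqB_single[OF Bn_FB[OF assms(1)]] seqM_single[OF assms(2)]] by simp
qed

text \<open>\<open>Gr(M)\<^sub>n\<close> is \<open>M\<^sub>n\<close> itself, as \<open>F\<^sub>n(M) = F\<^bsub>n-1\<^esub>(M) \<oplus> M\<^sub>n\<close>.\<close>

lemma gr_comp_free:
  assumes free: "free_of_rank (base_ring B Bn) (M\<lparr>carrier := Mn n\<rparr>) 1"
  shows "free_of_rank (base_ring B Bn)
    ((restrict_scalars (gr_unit B Bn) GM)\<lparr>carrier := gr_comp M Mn n\<rparr>) 1"
proof -
  obtain e where e: "e \<in> Mn n" "\<And>v. v \<in> Mn n \<Longrightarrow> \<exists>!a. a \<in> Bn 0 \<and> v = a \<odot>\<^bsub>M\<^esub> e"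
    and L: "left_module (base_ring B Bn) (M\<lparr>carrier := Mn n\<rparr>)"
    using free unfolding free_of_rank_one_iff by auto
  have clos: "a \<odot>\<^bsub>M\<^esub> e \<in> Mn n" if "a \<in> Bn 0" for a
    using smult_closed[OF L, of a e] that e(1) by simp
  have LG: "left_module (base_ring B Bn) ((restrict_scalars (gr_unit B Bn) GM)\<lparr>carrier := gr_comp M Mn n\<rparr>)"
    using component_left_module[OF gr_graded_module left_module_ring[OF L] gr_unit_hom gr_unit_comp] .
  have "\<exists>!a. a \<in> Bn 0 \<and> g = gr_unit B Bn a \<odot>\<^bsub>GM\<^esub> grM (single_seq M n e)" if "g \<in> gr_comp M Mn n" for g
  proof -
    obtain x where x: "x \<in> FM (Suc n)" "g = grM (single_seq M n x)" using \<open>g \<in> gr_comp M Mn n\<close> unfolding gr_comp_M by blast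
    obtain u v where uv: "u \<in> FM n" "v \<in> Mn n" "x = u \<oplus>\<^bsub>M\<^esub> v" using x(1) unfolding FM_Suc by blast
    have c: "u \<in> carrier M" "v \<in> carrier M" using FM_carrier[OF uv(1)] Mn_carrier[OF uv(2)] .
    have "g = gr_unit B Bn a \<odot>\<^bsub>GM\<^esub> grM (single_seq M n e) \<longleftrightarrow> v = a \<odot>\<^bsub>M\<^esub> e" if a: "a \<in> Bn 0" for a
    proof -
      let ?w = "a \<odot>\<^bsub>M\<^esub> e"
      have w: "?w \<in> Mn n" "?w \<in> carrier M" "?w \<in> FM (Suc n)" using clos[OF a] Mn_carrier Mn_FM by auto
      have "g = gr_unit B Bn a \<odot>\<^bsub>GM\<^esub> grM (single_seq M n e) \<longleftrightarrow>
          (\<forall>i. single_seq M n x i \<ominus>\<^bsub>M\<^esub> single_seq M n ?w i \<in> FM i)"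
        unfolding x(2) gr_smult_unit[OF a Mn_FM[OF e(1)]]
        by (rule grM_eq_iff[OF seqM_single[OF x(1)] seqM_single[OF w(3)]])
      also have "\<dots> \<longleftrightarrow> x \<ominus>\<^bsub>M\<^esub> ?w \<in> FM n"
        using FM_zero FM_diff[OF FM_zero FM_zero] by (auto simp: single_seq_def)
      also have "\<dots> \<longleftrightarrow> v \<ominus>\<^bsub>M\<^esub> ?w \<in> FM n"
      proof
        have e1: "x \<ominus>\<^bsub>M\<^esub> ?w = u \<oplus>\<^bsub>M\<^esub> (v \<ominus>\<^bsub>M\<^esub> ?w)" using c w uv(3) by (simp add: a_minus_def M.a_assoc)
        show "x \<ominus>\<^bsub>M\<^esub> ?w \<in> FM n" if "v \<ominus>\<^bsub>M\<^esub> ?w \<in> FM n" unfolding e1 by (rule FM_add[OF uv(1) that])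
        have e2: "v \<ominus>\<^bsub>M\<^esub> ?w = (\<ominus>\<^bsub>M\<^esub> u) \<oplus>\<^bsub>M\<^esub> (x \<ominus>\<^bsub>M\<^esub> ?w)" unfolding e1 using c w by (simp add: M.r_neg1)
        show "v \<ominus>\<^bsub>M\<^esub> ?w \<in> FM n" if "x \<ominus>\<^bsub>M\<^esub> ?w \<in> FM n"
          unfolding e2 by (rule FM_add[OF FM_minus[OF uv(1)] that])
      qed
      also have "\<dots> \<longleftrightarrow> v \<ominus>\<^bsub>M\<^esub> ?w = \<zero>\<^bsub>M\<^esub>"
      proof
        have "v \<ominus>\<^bsub>M\<^esub> ?w \<in> Mn n" unfolding a_minus_def
          using M.comp_add[of Mn, OF Mn_subgroup uv(2) M.comp_minus[of Mn, OF Mn_subgroup w(1)]] .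
        then show "v \<ominus>\<^bsub>M\<^esub> ?w \<in> FM n \<Longrightarrow> v \<ominus>\<^bsub>M\<^esub> ?w = \<zero>\<^bsub>M\<^esub>" using M_indep by blast
      qed (simp add: FM_zero)
      also have "\<dots> \<longleftrightarrow> v = ?w"
      proof
        assume z: "v \<ominus>\<^bsub>M\<^esub> ?w = \<zero>\<^bsub>M\<^esub>"
        have "v = (v \<ominus>\<^bsub>M\<^esub> ?w) \<oplus>\<^bsub>M\<^esub> ?w" using c w by (simp add: a_minus_def M.a_assoc M.l_neg)
        then show "v = ?w" unfolding z using w by simp
      qed (use w in \<open>simp add: a_minus_def M.r_neg\<close>)
      finally show ?thesis .
    qed
    then have "(a \<in> Bn 0 \<and> g = gr_unit B Bn a \<odot>\<^bsub>GM\<^esub> grM (single_seq M n e)) \<longleftrightarrow>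
        (a \<in> Bn 0 \<and> v = a \<odot>\<^bsub>M\<^esub> e)" for a by blast
    then show ?thesis using e(2)[OF uv(2)] by presburger
  qed
  moreover have "grM (single_seq M n e) \<in> gr_comp M Mn n" using Mn_FM[OF e(1)] unfolding gr_comp_M by blast
  ultimately show ?thesis
    unfolding free_of_rank_one_iff
    by (intro conjI LG bexI[of _ "grM (single_seq M n e)"] ballI) (simp_all add: restrict_scalars_def)
qed

end

section \<open>Point modules and their associated graded modules\<close>

text \<open>The situation of a point module of a semi-graded ring over a field; \<open>x\<close> is the generator \<open>m\<^sub>0\<close>.\<close>

locale cyclic_rank_one_pair = semi_graded_pair +
  fixes x
  assumes K_field: "field (base_ring B Bn)"
    and deg1: "generated_in_degree_one B Bn"
    and x_comp: "x \<in> Mn 0" and x_gen: "carrier M = {b \<odot>\<^bsub>M\<^esub> x | b. b \<in> carrier B}"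
    and rank_one: "free_of_rank (base_ring B Bn) (M\<lparr>carrier := Mn n\<rparr>) 1"
begin

lemma basisE:
  obtains e where "e \<in> Mn n" "\<And>v. v \<in> Mn n \<Longrightarrow> \<exists>a. a \<in> Bn 0 \<and> v = a \<odot>\<^bsub>M\<^esub> e" "e \<noteq> \<zero>\<^bsub>M\<^esub>"
proof -
  obtain e where e: "e \<in> Mn n" "\<And>v. v \<in> Mn n \<Longrightarrow> \<exists>!a. a \<in> Bn 0 \<and> v = a \<odot>\<^bsub>M\<^esub> e"
    using rank_one[of n] unfolding free_of_rank_one_iff by auto
  have 0: "\<zero>\<^bsub>B\<^esub> \<in> Bn 0" using B.comp_zero[of Bn, OF Bn_subgroup] .
  have "\<one>\<^bsub>B\<^esub> \<noteq> \<zero>\<^bsub>B\<^esub>" using domain.one_not_zero[OF field.axioms(1)[OF K_field]] by simp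
  have "e \<noteq> \<zero>\<^bsub>M\<^esub>"
  proof
    assume z: "e = \<zero>\<^bsub>M\<^esub>"
    have "e = \<zero>\<^bsub>B\<^esub> \<odot>\<^bsub>M\<^esub> e" "e = \<one>\<^bsub>B\<^esub> \<odot>\<^bsub>M\<^esub> e"
      using smult_r_null[OF left_module B.zero_closed] smult_r_null[OF left_module B.one_closed] z by simp_all
    then show False using e(2)[OF e(1)] 0 one_comp \<open>\<one>\<^bsub>B\<^esub> \<noteq> \<zero>\<^bsub>B\<^esub>\<close> by blast
  qed
  then show ?thesis using that e by blast
qed

lemma scalar_inverse:
  assumes "a \<in> Bn 0" "a \<noteq> \<zero>\<^bsub>B\<^esub>" obtains a' where "a' \<in> Bn 0" "a' \<otimes>\<^bsub>B\<^esub> a = \<one>\<^bsub>B\<^esub>"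
proof -
  have "a \<in> Units (base_ring B Bn)" using assms field.field_Units[OF K_field] by simp
  then show ?thesis using that by (auto simp: Units_def)
qed

text \<open>If \<open>v = a e\<close> with a basis vector \<open>e\<close> and \<open>v \<noteq> 0\<close>, then \<open>e\<close> is a scalar multiple of \<open>v\<close>.\<close>

lemma basis_from_nonzero:
  assumes e: "e \<in> Mn n" and v: "v = a \<odot>\<^bsub>M\<^esub> e" "a \<in> Bn 0" "v \<noteq> \<zero>\<^bsub>M\<^esub>"
  obtains a' where "a' \<in> Bn 0" "e = a' \<odot>\<^bsub>M\<^esub> v"
proof -
  have "a \<noteq> \<zero>\<^bsub>B\<^esub>" using v smult_l_null[OF left_module Mn_carrier[OF e]] by blast
  then obtain a' where a': "a' \<in> Bn 0" "a' \<otimes>\<^bsub>B\<^esub> a = \<one>\<^bsub>B\<^esub>" using scalar_inverse[OF v(2)] by blast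
  then have "e = a' \<odot>\<^bsub>M\<^esub> v" unfolding v(1)
    using smult_assoc[OF left_module Bn_carrier[OF a'(1)] Bn_carrier[OF v(2)] Mn_carrier[OF e]]
      smult_one[OF left_module Mn_carrier[OF e]] by simp
  then show ?thesis using that a' by blast
qed

text \<open>The step at which generation in degree one enters: if \<open>B\<^sub>1\<close> mapped \<open>F\<^sub>n(M)\<close> into itself, then so
  would all of \<open>B\<close>, and \<open>M = B x\<close> would have no elements of degree \<open>n + 1\<close>.\<close>

lemma degree_one_raises:
  obtains b y where "b \<in> Bn 1" "y \<in> FM (Suc n)" "b \<odot>\<^bsub>M\<^esub> y \<notin> FM (Suc n)"
proof (rule ccontr)
  assume "\<not> thesis"
  then have stable: "b \<odot>\<^bsub>M\<^esub> y \<in> FM (Suc n)" if "b \<in> Bn 1" "y \<in> FM (Suc n)" for b y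
    using that \<open>\<And>b y. b \<in> Bn 1 \<Longrightarrow> y \<in> FM (Suc n) \<Longrightarrow> b \<odot>\<^bsub>M\<^esub> y \<notin> FM (Suc n) \<Longrightarrow> thesis\<close> by blast
  obtain X where X: "X \<subseteq> Bn 1" "generate_ring B (Bn 0 \<union> X) = carrier B"
    using deg1 unfolding generated_in_degree_one_def by blast
  have "b \<in> carrier B \<and> (\<forall>y\<in>FM (Suc n). b \<odot>\<^bsub>M\<^esub> y \<in> FM (Suc n))" if "b \<in> generate_ring B (Bn 0 \<union> X)" for b
    using that
  proof (induction rule: generate_ring.induct)
    case one
    then show ?case using smult_one[OF left_module FM_carrier] by simp
  next
    case (incl h)
    then show ?case
      using stable X(1) FM_smult_comp[of h 0 _ "Suc n"] Bn_carrier[of h] by auto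
  next
    case (a_inv h)
    then show ?case using smult_l_minus[OF left_module _ FM_carrier] FM_minus by simp
  next
    case (eng_add h1 h2)
    then show ?case using smult_l_distr[OF left_module _ _ FM_carrier] FM_add by simp
  next
    case (eng_mult h1 h2)
    then show ?case using smult_assoc[OF left_module _ _ FM_carrier] by simp
  qed
  moreover have "x \<in> FM (Suc n)" using FM_mono[OF _ Mn_FM[OF x_comp], of "Suc n"] by simp
  ultimately have sub: "carrier M \<subseteq> FM (Suc n)" unfolding X(2) x_gen by blast
  obtain e where e: "e \<in> Mn (Suc n)" "e \<noteq> \<zero>\<^bsub>M\<^esub>" using basisE[of "Suc n"] by blast
  then show False using sub Mn_carrier[OF e(1)] M_indep[of "Suc n"] by blast
qed

text \<open>In the induction step \<open>b y\<^sub>1 = u + v\<close> with \<open>u \<in> F\<^sub>n(M)\<close> and \<open>0 \<noteq> v \<in> M\<^bsub>n+1\<^esub>\<close>. By induction \<open>y\<^sub>1\<close> and \<open>u\<close> are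
  multiples of \<open>x\<close>, so \<open>v\<close> is a multiple of \<open>x\<close> by an element of \<open>F\<^bsub>n+1\<^esub>(B)\<close>, and \<open>v\<close> spans \<open>M\<^bsub>n+1\<^esub>\<close>.\<close>

lemma FM_eq_FB_smult: "y \<in> FM (Suc n) \<Longrightarrow> \<exists>b\<in>FB (Suc n). y = b \<odot>\<^bsub>M\<^esub> x"
proof (induction n arbitrary: y)
  case 0
  obtain e where e: "e \<in> Mn 0" "\<And>v. v \<in> Mn 0 \<Longrightarrow> \<exists>a. a \<in> Bn 0 \<and> v = a \<odot>\<^bsub>M\<^esub> e" "e \<noteq> \<zero>\<^bsub>M\<^esub>"
    using basisE[of 0] by blast
  have "x \<noteq> \<zero>\<^bsub>M\<^esub>"
  proof
    assume "x = \<zero>\<^bsub>M\<^esub>"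
    then have "carrier M \<subseteq> {\<zero>\<^bsub>M\<^esub>}" unfolding x_gen using smult_r_null[OF left_module] by auto
    then show False using Mn_carrier[OF e(1)] e(3) by blast
  qed
  obtain a where a: "a \<in> Bn 0" "x = a \<odot>\<^bsub>M\<^esub> e" using e(2)[OF x_comp] by blast
  obtain a' where a': "a' \<in> Bn 0" "e = a' \<odot>\<^bsub>M\<^esub> x"
    using basis_from_nonzero[OF e(1) a(2) a(1) \<open>x \<noteq> \<zero>\<^bsub>M\<^esub>\<close>] by blast
  obtain u v where "u \<in> FM 0" "v \<in> Mn 0" "y = u \<oplus>\<^bsub>M\<^esub> v" using 0 unfolding FM_Suc by blast
  then have "y \<in> Mn 0" using Mn_carrier by simp
  then obtain c where c: "c \<in> Bn 0" "y = c \<odot>\<^bsub>M\<^esub> e" using e(2) by blast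
  have "y = (c \<otimes>\<^bsub>B\<^esub> a') \<odot>\<^bsub>M\<^esub> x"
    using c(2) a'(2) smult_assoc[OF left_module Bn_carrier[OF c(1)] Bn_carrier[OF a'(1)] Mn_carrier[OF x_comp]] by simp
  then show ?case using B0_mult[OF c(1) a'(1)] FB_1_iff by blast
next
  case (Suc n)
  have xc: "x \<in> carrier M" using Mn_carrier[OF x_comp] .
  obtain b y1 where b: "b \<in> Bn 1" "y1 \<in> FM (Suc n)" "b \<odot>\<^bsub>M\<^esub> y1 \<notin> FM (Suc n)" using degree_one_raises[of n] by blast
  have bc: "b \<in> carrier B" using Bn_carrier[OF b(1)] .
  have "b \<odot>\<^bsub>M\<^esub> y1 \<in> FM (Suc (Suc n))" using FM_smult_comp[OF b(1,2)] by simp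
  then obtain u v where uv: "u \<in> FM (Suc n)" "v \<in> Mn (Suc n)" "b \<odot>\<^bsub>M\<^esub> y1 = u \<oplus>\<^bsub>M\<^esub> v"
    unfolding FM_Suc[of _ "Suc n"] by blast
  have "v \<noteq> \<zero>\<^bsub>M\<^esub>" using b(3) uv FM_carrier[OF uv(1)] by auto
  obtain e where e: "e \<in> Mn (Suc n)" "\<And>v. v \<in> Mn (Suc n) \<Longrightarrow> \<exists>a. a \<in> Bn 0 \<and> v = a \<odot>\<^bsub>M\<^esub> e"
    using basisE[of "Suc n"] by blast
  obtain c where c: "c \<in> Bn 0" "v = c \<odot>\<^bsub>M\<^esub> e" using e(2)[OF uv(2)] by blast
  obtain c' where c': "c' \<in> Bn 0" "e = c' \<odot>\<^bsub>M\<^esub> v"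
    using basis_from_nonzero[OF e(1) c(2) c(1) \<open>v \<noteq> \<zero>\<^bsub>M\<^esub>\<close>] by blast
  obtain d where d: "d \<in> FB (Suc n)" "y1 = d \<odot>\<^bsub>M\<^esub> x" using Suc.IH[OF b(2)] by blast
  obtain d' where d': "d' \<in> FB (Suc n)" "u = d' \<odot>\<^bsub>M\<^esub> x" using Suc.IH[OF uv(1)] by blast
  have dc: "d \<in> carrier B" "d' \<in> carrier B" using FB_carrier d(1) d'(1) by blast+
  define f where "f = c' \<otimes>\<^bsub>B\<^esub> (b \<otimes>\<^bsub>B\<^esub> d \<ominus>\<^bsub>B\<^esub> d')"
  have "v = (\<ominus>\<^bsub>M\<^esub> u) \<oplus>\<^bsub>M\<^esub> b \<odot>\<^bsub>M\<^esub> y1"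
    unfolding uv(3) using FM_carrier[OF uv(1)] Mn_carrier[OF uv(2)] by (simp add: M.r_neg1)
  also have "\<dots> = (\<ominus>\<^bsub>B\<^esub> d') \<odot>\<^bsub>M\<^esub> x \<oplus>\<^bsub>M\<^esub> (b \<otimes>\<^bsub>B\<^esub> d) \<odot>\<^bsub>M\<^esub> x"
    unfolding d(2) d'(2) using smult_l_minus[OF left_module dc(2) xc] smult_assoc[OF left_module bc dc(1) xc] by simp
  also have "\<dots> = (b \<otimes>\<^bsub>B\<^esub> d \<ominus>\<^bsub>B\<^esub> d') \<odot>\<^bsub>M\<^esub> x"
    using smult_l_distr[OF left_module _ _ xc, of "\<ominus>\<^bsub>B\<^esub> d'" "b \<otimes>\<^bsub>B\<^esub> d"] dc bc
    by (simp add: a_minus_def B.a_comm)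
  finally have "e = f \<odot>\<^bsub>M\<^esub> x"
    unfolding f_def using c' smult_assoc[OF left_module Bn_carrier[OF c'(1)] _ xc, of "b \<otimes>\<^bsub>B\<^esub> d \<ominus>\<^bsub>B\<^esub> d'"] dc bc by simp
  moreover have f: "f \<in> FB (Suc (Suc n))"
  proof -
    have "b \<otimes>\<^bsub>B\<^esub> d \<in> FB (Suc (Suc n))" using FB_mult[OF Bn_FB[OF b(1)] d(1)] by simp
    moreover have "d' \<in> FB (Suc (Suc n))" using FB_mono[OF _ d'(1), of "Suc (Suc n)"] by simp
    ultimately have "b \<otimes>\<^bsub>B\<^esub> d \<ominus>\<^bsub>B\<^esub> d' \<in> FB (Suc (Suc n))"
      using B.filt_diff[of Bn, OF Bn_subgroup] by blast
    then show ?thesis unfolding f_def using FB_mult[of c' 0] c'(1) FB_1_iff by simp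
  qed
  moreover obtain u2 v2 where w: "u2 \<in> FM (Suc n)" "v2 \<in> Mn (Suc n)" "y = u2 \<oplus>\<^bsub>M\<^esub> v2"
    using Suc.prems unfolding FM_Suc[of _ "Suc n"] by blast
  moreover obtain g where g: "g \<in> FB (Suc n)" "u2 = g \<odot>\<^bsub>M\<^esub> x" using Suc.IH[OF w(1)] by blast
  moreover obtain h where h: "h \<in> Bn 0" "v2 = h \<odot>\<^bsub>M\<^esub> e" using e(2)[OF w(2)] by blast
  moreover have hf: "h \<otimes>\<^bsub>B\<^esub> f \<in> FB (Suc (Suc n))" using FB_mult[of h 0, OF _ f] h(1) FB_1_iff by simp
  moreover have g2: "g \<in> FB (Suc (Suc n))" using FB_mono[OF _ g(1), of "Suc (Suc n)"] by simp
  ultimately have "y = (g \<oplus>\<^bsub>B\<^esub> h \<otimes>\<^bsub>B\<^esub> f) \<odot>\<^bsub>M\<^esub> x"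
    using smult_l_distr[OF left_module FB_carrier[OF g2] FB_carrier[OF hf] xc]
      smult_assoc[OF left_module Bn_carrier[OF h(1)] FB_carrier[OF f] xc] by simp
  then show ?case using FB_add[OF g2 hf] by blast
qed

lemma gr_cyclic: "cyclic_in_degree_zero GB (GM, gr_comp M Mn)"
proof -
  let ?x = "grM (single_seq M 0 x)"
  have xc: "x \<in> carrier M" using Mn_carrier[OF x_comp] .
  have x: "?x \<in> gr_comp M Mn 0" using Mn_FM[OF x_comp] unfolding gr_comp_M by blast
  have xs: "single_seq M 0 x \<in> seqM" using seqM_single[OF Mn_FM[OF x_comp]] .
  have "\<exists>c\<in>carrier GB. g = c \<odot>\<^bsub>GM\<^esub> ?x" if g: "g \<in> carrier GM" for g
  proof -
    have "g \<in> gr_carrier M Mn" using g by (simp add: GM_carrier)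
    then obtain a where a: "a \<in> seqM" "g = grM a" "\<And>i. g i = FM i \<Longrightarrow> a i = \<zero>\<^bsub>M\<^esub>"
      using M.gr_carrierE[of Mn, OF Mn_subgroup] by metis
    have "\<forall>i. \<exists>b. b \<in> FB (Suc i) \<and> a i = b \<odot>\<^bsub>M\<^esub> x" using FM_eq_FB_smult seqM_FM[OF a(1)] by blast
    then obtain b0 where b0: "\<And>i. b0 i \<in> FB (Suc i)" "\<And>i. a i = b0 i \<odot>\<^bsub>M\<^esub> x" by metis
    \<comment> \<open>A zero coset is represented by zero, so that almost all components of \<open>b\<close> vanish.\<close>
    define b where "b i = (if g i = FM i then \<zero>\<^bsub>B\<^esub> else b0 i)" for i
    have bx: "b i \<odot>\<^bsub>M\<^esub> x = a i" for i
      using b0(2)[of i] a(3)[of i] smult_l_null[OF left_module xc] by (auto simp: b_def)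
    have "{i. b i \<notin> FB i} \<subseteq> {n. g n \<noteq> FM n}" using FB_zero by (auto simp: b_def)
    moreover have "finite {n. g n \<noteq> FM n}" using \<open>g \<in> gr_carrier M Mn\<close> by (simp add: gr_carrier_def)
    ultimately have b: "b \<in> seqB" using b0(1) FB_zero finite_subset by (auto simp: gr_seqs_def b_def)
    have "convM b (single_seq M 0 x) = a" using conv_single_right[OF b xc, of 0] bx by auto
    then have "g = grB b \<odot>\<^bsub>GM\<^esub> ?x" using gr_smult[OF b xs] a(2) by simp
    then show ?thesis using GB_I[OF b] by blast
  qed
  moreover have "c \<odot>\<^bsub>GM\<^esub> ?x \<in> carrier GM" if "c \<in> carrier GB" for c
    using smult_closed[OF GM_left_module that GM_I[OF xs]] .
  ultimately have "carrier GM = {c \<odot>\<^bsub>GM\<^esub> ?x | c. c \<in> carrier GB}" by blast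
  then show ?thesis unfolding cyclic_in_degree_zero_def split_conv using x by blast
qed

lemma gr_point_module:
  "point_module (base_ring B Bn) (gr_unit B Bn) GB (gr_comp B Bn) (gr_module (M, Mn))"
proof -
  have e: "gr_module (M, Mn) = (GM, gr_comp M Mn)" by (simp add: gr_module_def)
  show ?thesis
    by (subst e) (unfold point_module_def split_conv,
        intro conjI allI gr_graded_module gr_cyclic gr_comp_free[OF rank_one])
qed

end

section \<open>Functoriality of the associated graded module\<close>

lemma module_iso_finsum:
  assumes h: "module_iso R M N h" and M: "abelian_group M" and N: "abelian_group N"
    and f: "\<And>i. i \<in> I \<Longrightarrow> f i \<in> carrier M"
  shows "h (\<Oplus>\<^bsub>M\<^esub>i\<in>I. f i) = (\<Oplus>\<^bsub>N\<^esub>i\<in>I. h (f i))"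
proof -
  interpret M: abelian_group M by fact
  interpret N: abelian_group N by fact
  show ?thesis using f
  proof (induction I rule: infinite_finite_induct)
    case (insert i I)
    have "h (\<Oplus>\<^bsub>M\<^esub>i\<in>insert i I. f i) = h (f i \<oplus>\<^bsub>M\<^esub> (\<Oplus>\<^bsub>M\<^esub>i\<in>I. f i))"
      using insert by (subst M.finsum_insert) auto
    also have "\<dots> = h (f i) \<oplus>\<^bsub>N\<^esub> h (\<Oplus>\<^bsub>M\<^esub>i\<in>I. f i)"
      using insert by (intro module_isoD(3)[OF h] M.finsum_closed) auto
    also have "\<dots> = (\<Oplus>\<^bsub>N\<^esub>i\<in>insert i I. h (f i))"
      using insert module_isoD(5)[OF h] by (subst N.finsum_insert) auto
    finally show ?case .
  qed (simp_all add: module_iso_zero[OF h M N])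
qed

text \<open>A homogeneous isomorphism carries the filtration of \<open>M\<close> onto that of \<open>N\<close>, so it acts on cosets.\<close>

lemma gr_homogeneous_iso:
  assumes "semi_graded_pair B Bn M Mn" "semi_graded_pair B Bn N Nn"
    and iso: "homogeneous_iso B (M, Mn) (N, Nn)"
  shows "homogeneous_iso (gr_ring B Bn) (gr_module (M, Mn)) (gr_module (N, Nn))"
proof -
  interpret M: semi_graded_pair B Bn M Mn by fact
  interpret N: semi_graded_pair B Bn N Nn by fact
  obtain h where h: "module_iso B M N h" and deg: "\<And>n. h ` Mn n \<subseteq> Nn n"
    using iso by (auto simp: homogeneous_iso_def)
  have dM: "direct_sum M Mn" and dN: "direct_sum N Nn"
    using M.sg_module N.sg_module by (auto simp: semi_graded_module_def)
  note ab = M.M.abelian_group_axioms N.M.abelian_group_axioms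
  have onto: "h ` Mn n = Nn n" for n using homogeneous_iso_onto[OF h ab dM dN deg] .
  let ?g = "inv_into (carrier M) h"
  have g: "module_iso B N M ?g" using module_iso_sym[OF h M.left_module] .
  have gh: "?g (h x) = x" if "x \<in> carrier M" for x using that module_isoD(1)[OF h] by simp
  have hg: "h (?g y) = y" if "y \<in> carrier N" for y
    using that module_isoD(2)[OF h] by (simp add: f_inv_into_f)
  have gdeg: "?g ` Nn n \<subseteq> Mn n" for n unfolding onto[symmetric] using gh M.Mn_carrier by auto
  have hf: "x \<in> M.FM n \<Longrightarrow> h x \<in> N.FM n" for x n
    by (rule module_iso_filt[OF h ab M.Mn_subgroup N.Mn_subgroup deg])
  have gf: "y \<in> N.FM n \<Longrightarrow> ?g y \<in> M.FM n" for y n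
    by (rule module_iso_filt[OF g ab(2,1) N.Mn_subgroup M.Mn_subgroup gdeg])
  have hseq: "h \<circ> a \<in> N.seqM" if a: "a \<in> M.seqM" for a
  proof -
    have "{i. (h \<circ> a) i \<notin> N.FM i} \<subseteq> {i. a i \<notin> M.FM i}" using hf by auto
    then show ?thesis using a hf finite_subset by (auto simp: gr_seqs_def)
  qed
  have gseq: "?g \<circ> a \<in> M.seqM" if a: "a \<in> N.seqM" for a
  proof -
    have "{i. (?g \<circ> a) i \<notin> M.FM i} \<subseteq> {i. a i \<notin> N.FM i}" using gf by auto
    then show ?thesis using a gf finite_subset by (auto simp: gr_seqs_def)
  qed
  define H where "H x = (\<lambda>i. h ` x i)" for x :: "nat \<Rightarrow> _ set"
  have H: "H (M.grM a) = N.grM (h \<circ> a)" if a: "a \<in> M.seqM" for a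
  proof
    fix i
    have "h ` M.FM i = N.FM i"
    proof
      show "N.FM i \<subseteq> h ` M.FM i"
      proof
        fix y assume y: "y \<in> N.FM i"
        then have "y = h (?g y)" using hg N.FM_carrier by simp
        then show "y \<in> h ` M.FM i" using gf[OF y] by blast
      qed
    qed (use hf in blast)
    moreover have "h ` (M.FM i +>\<^bsub>M\<^esub> a i) = (\<lambda>u. h u \<oplus>\<^bsub>N\<^esub> h (a i)) ` M.FM i"
      unfolding a_r_coset_def' using module_isoD(3)[OF h M.FM_carrier M.seqM_carrier[OF a]]
      by (auto simp: image_UN image_iff)
    then have "h ` (M.FM i +>\<^bsub>M\<^esub> a i) = (h ` M.FM i) +>\<^bsub>N\<^esub> h (a i)"
      unfolding a_r_coset_def' by auto
    ultimately show "H (M.grM a) i = N.grM (h \<circ> a) i" by (simp add: H_def gr_of_def)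
  qed
  have "module_iso M.GB M.GM N.GM H"
    unfolding module_iso_def bij_betw_def
  proof (intro conjI ballI)
    show "inj_on H (carrier M.GM)"
    proof (rule inj_onI)
      fix x y assume xy: "x \<in> carrier M.GM" "y \<in> carrier M.GM" "H x = H y"
      obtain a where a: "a \<in> M.seqM" "x = M.grM a" using xy(1) by (rule M.GM_E)
      obtain b where b: "b \<in> M.seqM" "y = M.grM b" using xy(2) by (rule M.GM_E)
      have cosets: "x i \<subseteq> carrier M" "y i \<subseteq> carrier M" for i
        unfolding a(2) b(2) gr_of_def
        by (intro M.M.a_r_coset_subset_G subsetI M.FM_carrier M.seqM_carrier[OF a(1)]
            M.seqM_carrier[OF b(1)]; assumption)+
      have "h ` x i = h ` y i" for i using xy(3) unfolding H_def by meson
      then show "x = y" using inj_on_image_eq_iff[OF module_isoD(1)[OF h] cosets] by blast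
    qed
    show "H ` carrier M.GM = carrier N.GM"
    proof
      show "H ` carrier M.GM \<subseteq> carrier N.GM"
      proof
        fix y assume "y \<in> H ` carrier M.GM"
        then obtain x where x: "x \<in> carrier M.GM" "y = H x" by blast
        obtain a where a: "a \<in> M.seqM" "x = M.grM a" using x(1) by (rule M.GM_E)
        show "y \<in> carrier N.GM" unfolding x(2) a(2) H[OF a(1)] by (rule N.GM_I[OF hseq[OF a(1)]])
      qed
      show "carrier N.GM \<subseteq> H ` carrier M.GM"
      proof
        fix y assume "y \<in> carrier N.GM"
        then obtain a where a: "a \<in> N.seqM" "y = N.grM a" by (rule N.GM_E)
        have "h \<circ> (?g \<circ> a) = a" using hg N.seqM_carrier[OF a(1)] by auto
        then have "y = H (M.grM (?g \<circ> a))" using H[OF gseq[OF a(1)]] a(2) by simp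
        then show "y \<in> H ` carrier M.GM" using M.GM_I[OF gseq[OF a(1)]] by blast
      qed
    qed
  next
    fix x y assume xy: "x \<in> carrier M.GM" "y \<in> carrier M.GM"
    obtain a where a: "a \<in> M.seqM" "x = M.grM a" using xy(1) by (rule M.GM_E)
    obtain b where b: "b \<in> M.seqM" "y = M.grM b" using xy(2) by (rule M.GM_E)
    have "h \<circ> (\<lambda>i. a i \<oplus>\<^bsub>M\<^esub> b i) = (\<lambda>i. (h \<circ> a) i \<oplus>\<^bsub>N\<^esub> (h \<circ> b) i)"
      using module_isoD(3)[OF h M.seqM_carrier[OF a(1)] M.seqM_carrier[OF b(1)]] by (simp add: fun_eq_iff)
    then show "H (x \<oplus>\<^bsub>M.GM\<^esub> y) = H x \<oplus>\<^bsub>N.GM\<^esub> H y"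
      unfolding a(2) b(2) M.GM_add[OF a(1) b(1)] H[OF a(1)] H[OF b(1)] H[OF M.seqM_add[OF a(1) b(1)]]
        N.GM_add[OF hseq[OF a(1)] hseq[OF b(1)]] by simp
  next
    fix c x assume cx: "c \<in> carrier M.GB" "x \<in> carrier M.GM"
    obtain b where b: "b \<in> M.seqB" "c = M.grB b" using cx(1) by (rule M.GB_E)
    obtain a where a: "a \<in> M.seqM" "x = M.grM a" using cx(2) by (rule M.GM_E)
    have "h (convolution M b a k) = convolution N b (h \<circ> a) k" for k
    proof -
      have "h (convolution M b a k) = (\<Oplus>\<^bsub>N\<^esub>i\<in>{..k}. h (b i \<odot>\<^bsub>M\<^esub> a (k - i)))"
        unfolding convolution_def using M.sm_closed M.seqB_carrier[OF b(1)] M.seqM_carrier[OF a(1)]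
        by (intro module_iso_finsum[OF h ab]) blast
      then show ?thesis
        using module_isoD(4)[OF h M.seqB_carrier[OF b(1)] M.seqM_carrier[OF a(1)]]
        by (simp add: convolution_def)
    qed
    then have "h \<circ> convolution M b a = convolution N b (h \<circ> a)" by auto
    then show "H (c \<odot>\<^bsub>M.GM\<^esub> x) = c \<odot>\<^bsub>N.GM\<^esub> H x"
      unfolding a(2) b(2) M.gr_smult[OF b(1) a(1)] H[OF a(1)] H[OF M.conv_seq[OF b(1) a(1)]]
        N.gr_smult[OF b(1) hseq[OF a(1)]] by simp
  qed
  moreover have "H ` gr_comp M Mn n \<subseteq> gr_comp N Nn n" for n
  proof
    fix y assume "y \<in> H ` gr_comp M Mn n"
    then obtain w where w: "w \<in> gr_comp M Mn n" "y = H w" by blast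
    then obtain x where x: "x \<in> M.FM (Suc n)" "y = H (M.grM (single_seq M n x))"
      using M.gr_comp_M[of w n] by blast
    have "h \<circ> single_seq M n x = single_seq N n (h x)"
      using module_iso_zero[OF h ab] by (auto simp: single_seq_def)
    then show "y \<in> gr_comp N Nn n"
      unfolding N.gr_comp_M x(2) H[OF M.seqM_single[OF x(1)]] using hf[OF x(1)] by auto
  qed
  ultimately have ex: "\<exists>H. module_iso M.GB M.GM N.GM H \<and> (\<forall>n. H ` gr_comp M Mn n \<subseteq> gr_comp N Nn n)" by blast
  have "gr_module (M, Mn) = (M.GM, gr_comp M Mn)" "gr_module (N, Nn) = (N.GM, gr_comp N Nn)"
    by (simp_all add: gr_module_def)
  note e = this
  show ?thesis
    by (subst e(1), subst e(2)) (unfold homogeneous_iso_def split_conv, rule ex)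
qed

lemma sg_point_module_cyclic_rank_one:
  assumes M: "sg_point_module B Bn (M, Mn)" and B: "semi_graded_ring B Bn"
    and K: "field (base_ring B Bn)" and deg1: "generated_in_degree_one B Bn"
  shows "\<exists>x. cyclic_rank_one_pair B Bn M Mn x"
proof -
  have sg: "semi_graded_module B Bn (M, Mn)" and "cyclic_in_degree_zero B (M, Mn)"
    and free: "\<And>n. free_of_rank (base_ring B Bn) (M\<lparr>carrier := Mn n\<rparr>) 1"
    using M by (auto simp: sg_point_module_def finitely_semi_graded_module_def)
  then obtain x where "x \<in> Mn 0" "carrier M = {b \<odot>\<^bsub>M\<^esub> x | b. b \<in> carrier B}"
    by (auto simp: cyclic_in_degree_zero_def)
  then have "cyclic_rank_one_pair B Bn M Mn x"
    using B sg K deg1 free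
    by (simp add: cyclic_rank_one_pair_def cyclic_rank_one_pair_axioms_def semi_graded_pair_def)
  then show ?thesis by blast
qed

section \<open>Point modules as families over the base field\<close>

lemma free_of_rank_one_restrict:
  assumes V: "free_of_rank R V 1" and R': "ring R'" and \<phi>: "\<phi> \<in> ring_iso R' R"
  shows "free_of_rank R' (restrict_scalars \<phi> V) 1"
proof -
  obtain e where e: "e \<in> carrier V" "\<And>v. v \<in> carrier V \<Longrightarrow> \<exists>!a. a \<in> carrier R \<and> v = a \<odot>\<^bsub>V\<^esub> e"
    and LV: "left_module R V"
    using V unfolding free_of_rank_one_iff by metis
  have hom: "\<phi> \<in> ring_hom R' R" and bij: "bij_betw \<phi> (carrier R') (carrier R)"
    using \<phi> by (auto simp: ring_iso_def)
  have "\<exists>!a. a \<in> carrier R' \<and> v = \<phi> a \<odot>\<^bsub>V\<^esub> e" if v: "v \<in> carrier V" for v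
  proof -
    obtain a where a: "a \<in> carrier R" "v = a \<odot>\<^bsub>V\<^esub> e" and u: "\<And>b. b \<in> carrier R \<Longrightarrow> v = b \<odot>\<^bsub>V\<^esub> e \<Longrightarrow> b = a"
      using e(2)[OF v] by metis
    obtain a' where a': "a' \<in> carrier R'" "\<phi> a' = a" using a(1) unfolding bij_betw_imp_surj_on[OF bij, symmetric] by blast
    show ?thesis
    proof (rule ex1I[of _ a'])
      fix b assume b: "b \<in> carrier R' \<and> v = \<phi> b \<odot>\<^bsub>V\<^esub> e"
      then have "\<phi> b = \<phi> a'" using u[of "\<phi> b"] ring_hom_closed[OF hom] a' by simp
      then show "b = a'" using inj_onD[OF bij_betw_imp_inj_on[OF bij], of b a'] b a' by simp
    qed (use a a' in simp)
  qed
  moreover have "left_module R' (restrict_scalars \<phi> V)" using left_module_restrict_scalars[OF LV R' hom] .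
  ultimately show ?thesis
    unfolding free_of_rank_one_iff
    by (intro conjI bexI[of _ e] ballI) (simp_all add: restrict_scalars_def e(1))
qed

text \<open>The cover of the spectrum by the single basic open set of \<open>1\<close>: localizing at \<open>{1}\<close> changes nothing.\<close>

lemma free_imp_locally_free:
  assumes R: "cring R" and V: "free_of_rank R V 1"
  shows "locally_free_of_rank R V 1"
proof -
  interpret cring R by fact
  have LV: "left_module R V" using V by (simp add: free_of_rank_def)
  interpret V: abelian_group V using left_module_group[OF LV] .
  define D where "D = {\<one>\<^bsub>R\<^esub>}"
  have fr: "frac (regular_module R) D a \<one>\<^bsub>R\<^esub> = {(a, \<one>\<^bsub>R\<^esub>)}" if "a \<in> carrier R" for a
    using that by (auto simp: frac_def D_def regular_module_def)
  have fv: "frac V D m \<one>\<^bsub>R\<^esub> = {(m, \<one>\<^bsub>R\<^esub>)}" if "m \<in> carrier V" for m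
    using that smult_one[OF LV] by (auto simp: frac_def D_def)
  define \<phi> where "\<phi> a = {(a, \<one>\<^bsub>R\<^esub>)}" for a :: 'a
  define h where "h m = {(m, \<one>\<^bsub>R\<^esub>)}" for m :: 'b
  let ?R = "loc_ring R D" and ?V = "loc_module R D V"
  have cR: "carrier ?R = \<phi> ` carrier R"
    unfolding loc_ring_def Let_def \<phi>_def using fr by (auto simp: D_def)
  have cV: "carrier ?V = h ` carrier V"
    unfolding loc_module_def Let_def h_def using fv by (auto simp: D_def)
  have mR: "\<phi> a \<otimes>\<^bsub>?R\<^esub> \<phi> b = \<phi> (a \<otimes>\<^bsub>R\<^esub> b)" and aR: "\<phi> a \<oplus>\<^bsub>?R\<^esub> \<phi> b = \<phi> (a \<oplus>\<^bsub>R\<^esub> b)"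
    if "a \<in> carrier R" "b \<in> carrier R" for a b
    using that by (simp_all add: loc_ring_def Let_def \<phi>_def fr)
  have oR: "\<one>\<^bsub>?R\<^esub> = \<phi> \<one>\<^bsub>R\<^esub>" and zR: "\<zero>\<^bsub>?R\<^esub> = \<phi> \<zero>\<^bsub>R\<^esub>"
    by (simp_all add: loc_ring_def Let_def \<phi>_def fr)
  have iso: "\<phi> \<in> ring_iso R ?R"
    unfolding ring_iso_def bij_betw_def
  proof (intro CollectI conjI)
    show "\<phi> \<in> ring_hom R ?R" by (rule ring_hom_memI) (auto simp: cR mR aR oR)
  qed (auto simp: inj_on_def \<phi>_def cR)
  have "ring (?R\<lparr>ring.zero := \<phi> \<zero>\<^bsub>R\<^esub>\<rparr>)" by (rule ring_iso_imp_img_ring[OF iso])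
  then have ring: "ring ?R" unfolding zR[symmetric] by simp
  define \<psi> where "\<psi> = inv_into (carrier R) \<phi>"
  have \<psi>: "\<psi> \<in> ring_iso ?R R" unfolding \<psi>_def by (rule ring_iso_set_sym[OF ring_axioms iso])
  have \<psi>\<phi>: "\<psi> (\<phi> a) = a" if "a \<in> carrier R" for a
    unfolding \<psi>_def using that iso by (simp add: ring_iso_def bij_betw_def)
  let ?W = "restrict_scalars \<psi> V"
  have W: "free_of_rank ?R ?W 1" by (rule free_of_rank_one_restrict[OF V ring \<psi>])
  have aV: "h m \<oplus>\<^bsub>?V\<^esub> h n = h (m \<oplus>\<^bsub>V\<^esub> n)" if "m \<in> carrier V" "n \<in> carrier V" for m n
    using that smult_one[OF LV] by (simp add: loc_module_def Let_def h_def fv)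
  have sV: "\<phi> a \<odot>\<^bsub>?V\<^esub> h m = h (a \<odot>\<^bsub>V\<^esub> m)" if "a \<in> carrier R" "m \<in> carrier V" for a m
    using that smult_closed[OF LV] by (simp add: loc_module_def Let_def h_def \<phi>_def fv)
  have hi: "module_iso ?R ?W ?V h"
    unfolding module_iso_def bij_betw_def
  proof (intro conjI ballI)
    show "h (a \<odot>\<^bsub>?W\<^esub> x) = a \<odot>\<^bsub>?V\<^esub> h x" if ax: "a \<in> carrier ?R" "x \<in> carrier ?W" for a x
    proof -
      obtain r where r: "r \<in> carrier R" "a = \<phi> r" using ax(1) unfolding cR by blast
      then show ?thesis using ax(2) sV \<psi>\<phi> by (simp add: restrict_scalars_def)
    qed
  qed (auto simp: inj_on_def h_def restrict_scalars_def cV aV[unfolded h_def])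
  have "h \<zero>\<^bsub>?W\<^esub> = \<zero>\<^bsub>?V\<^esub>" by (simp add: restrict_scalars_def loc_module_def Let_def h_def fv)
  then have LV': "left_module ?R ?V" using left_module_iso[OF _ hi] W by (simp add: free_of_rank_def)
  have F: "free_of_rank ?R ?V 1" by (rule free_of_rank_one_iso[OF W hi LV'])
  have "{\<one>\<^bsub>R\<^esub> [^]\<^bsub>R\<^esub> k | k::nat. True} = D" by (auto simp: D_def)
  then show ?thesis
    unfolding locally_free_of_rank_def Let_def using LV F genideal_one
    by (intro conjI exI[of _ "{\<one>\<^bsub>R\<^esub>}"]) auto
qed

locale central_algebra =
  fixes K :: "'k ring" and \<kappa> :: "'k \<Rightarrow> 'c" and C :: "'c ring"
  assumes K_cring: "cring K" and C_ring: "ring C" and \<kappa>: "\<kappa> \<in> ring_hom K C"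
    and central: "\<And>k c. k \<in> carrier K \<Longrightarrow> c \<in> carrier C \<Longrightarrow> \<kappa> k \<otimes>\<^bsub>C\<^esub> c = c \<otimes>\<^bsub>C\<^esub> \<kappa> k"
begin

sublocale K: cring K by (rule K_cring)
sublocale C: ring C by (rule C_ring)

abbreviation V where "V \<equiv> algebra_module id K"
abbreviation W where "W \<equiv> algebra_module \<kappa> C"
abbreviation P where "P \<equiv> pairs_group V W"
abbreviation TA where "TA \<equiv> tensor_algebra K id K \<kappa> C"

lemma VW_simps [simp]: "carrier V = carrier K" "carrier W = carrier C" "v \<oplus>\<^bsub>V\<^esub> v' = v \<oplus>\<^bsub>K\<^esub> v'"
  "w \<oplus>\<^bsub>W\<^esub> w' = w \<oplus>\<^bsub>C\<^esub> w'" "r \<odot>\<^bsub>V\<^esub> v = r \<otimes>\<^bsub>K\<^esub> v" "r \<odot>\<^bsub>W\<^esub> w = \<kappa> r \<otimes>\<^bsub>C\<^esub> w"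
  by (simp_all add: restrict_scalars_def regular_module_def)

lemmas \<kappa>_closed = ring_hom_closed[OF \<kappa>]

text \<open>The canonical map \<open>K \<otimes> C \<rightarrow> C\<close> on formal sums.\<close>

definition ev :: "('k \<times> 'c \<Rightarrow>\<^sub>0 int) \<Rightarrow> 'c" where
  "ev = (SOME h. h \<in> hom P (add_monoid C) \<and>
     (\<forall>p\<in>carrier K \<times> carrier C. h (frag_of p) = \<kappa> (fst p) \<otimes>\<^bsub>C\<^esub> snd p))"

lemma ev: "ev \<in> hom P (add_monoid C)"
  and ev_of: "k \<in> carrier K \<Longrightarrow> c \<in> carrier C \<Longrightarrow> ev (frag_of (k, c)) = \<kappa> k \<otimes>\<^bsub>C\<^esub> c"
proof -
  have "(\<lambda>p. \<kappa> (fst p) \<otimes>\<^bsub>C\<^esub> snd p) ` (carrier K \<times> carrier C) \<subseteq> carrier (add_monoid C)"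
    using \<kappa>_closed by auto
  from comm_group.free_Abelian_group_universal[OF C.a_comm_group this]
  have "\<exists>h. h \<in> hom P (add_monoid C) \<and>
     (\<forall>p\<in>carrier K \<times> carrier C. h (frag_of p) = \<kappa> (fst p) \<otimes>\<^bsub>C\<^esub> snd p)"
    by (metis VW_simps(1,2))
  from someI_ex[OF this] have *: "ev \<in> hom P (add_monoid C) \<and>
     (\<forall>p\<in>carrier K \<times> carrier C. ev (frag_of p) = \<kappa> (fst p) \<otimes>\<^bsub>C\<^esub> snd p)"
    unfolding ev_def .
  then show "ev \<in> hom P (add_monoid C)" by blast
  show "k \<in> carrier K \<Longrightarrow> c \<in> carrier C \<Longrightarrow> ev (frag_of (k, c)) = \<kappa> k \<otimes>\<^bsub>C\<^esub> c" using * by simp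
qed

abbreviation fsums where "fsums S \<equiv> {x :: ('k \<times> 'c) \<Rightarrow>\<^sub>0 int. Poly_Mapping.keys x \<subseteq> S}"
abbreviation KC where "KC \<equiv> carrier K \<times> carrier C"

lemma P_carrier: "carrier P = fsums KC" by auto

lemma ev_closed: "x \<in> fsums KC \<Longrightarrow> ev x \<in> carrier C"
  using hom_in_carrier[OF ev, of x] by simp

lemma ev_add: "x \<in> fsums KC \<Longrightarrow> y \<in> fsums KC \<Longrightarrow> ev (x + y) = ev x \<oplus>\<^bsub>C\<^esub> ev y"
  using hom_mult[OF ev, of x y] by simp

lemma sums_diff: "x \<in> fsums S \<Longrightarrow> y \<in> fsums S \<Longrightarrow> x - y \<in> fsums S"
  using keys_diff[of x y] by blast

lemma sums_add: "x \<in> fsums S \<Longrightarrow> y \<in> fsums S \<Longrightarrow> x + y \<in> fsums S"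
  using keys_add[of x y] by blast

lemma ev_diff:
  assumes "x \<in> fsums KC" "y \<in> fsums KC" shows "ev (x - y) = ev x \<ominus>\<^bsub>C\<^esub> ev y"
proof -
  have "ev x = ev (x - y) \<oplus>\<^bsub>C\<^esub> ev y" using ev_add[OF sums_diff[OF assms] assms(2)] by simp
  then show ?thesis using ev_closed[OF sums_diff[OF assms]] ev_closed[OF assms(2)]
    by (simp add: a_minus_def C.a_assoc C.r_neg)
qed

lemma ev_0: "ev 0 = \<zero>\<^bsub>C\<^esub>"
  using ev_diff[of 0 0] ev_closed[of 0] by (simp add: a_minus_def C.r_neg)

definition fib :: "'c \<Rightarrow> ('k, 'c) tens" where
  "fib c = {x \<in> fsums KC. ev x = c}"

lemma fib_nonempty: "c \<in> carrier C \<Longrightarrow> frag_of (\<one>\<^bsub>K\<^esub>, c) \<in> fib c"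
  using ev_of[of "\<one>\<^bsub>K\<^esub>" c] ring_hom_one[OF \<kappa>] by (simp add: fib_def)

lemma fib_inj: "inj_on fib (carrier C)"
proof (rule inj_onI)
  fix c d assume c: "c \<in> carrier C" and "fib c = fib d"
  then have "frag_of (\<one>\<^bsub>K\<^esub>, c) \<in> fib c \<inter> fib d" using fib_nonempty[OF c] by simp
  then show "c = d" by (auto simp: fib_def)
qed

text \<open>Every formal sum \<open>x\<close> is congruent to \<open>1 \<otimes> ev x\<close> modulo the bilinearity relations, so these
  generate the kernel of \<open>ev\<close>. In this way elements of the tensor product are fibres of \<open>ev\<close>.\<close>

lemma tensor_null: "tensor_null K V W = fib \<zero>\<^bsub>C\<^esub>"
proof
  interpret P: group P by simp
  let ?R1 = "{frag_of (v \<oplus>\<^bsub>V\<^esub> v', w) - frag_of (v, w) - frag_of (v', w) | v v' w.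
         v \<in> carrier V \<and> v' \<in> carrier V \<and> w \<in> carrier W}"
  let ?R2 = "{frag_of (v, w \<oplus>\<^bsub>W\<^esub> w') - frag_of (v, w) - frag_of (v, w') | v w w'.
         v \<in> carrier V \<and> w \<in> carrier W \<and> w' \<in> carrier W}"
  let ?R3 = "{frag_of (r \<odot>\<^bsub>V\<^esub> v, w) - frag_of (v, r \<odot>\<^bsub>W\<^esub> w) | r v w.
         r \<in> carrier K \<and> v \<in> carrier V \<and> w \<in> carrier W}"
  let ?R = "?R1 \<union> ?R2 \<union> ?R3"
  define N where "N = generate P ?R"
  have null: "tensor_null K V W = N" by (simp add: tensor_null_def N_def)
  have of: "frag_of (k, c) \<in> fsums KC" if "k \<in> carrier K" "c \<in> carrier C" for k c using that by simp
  have sub: "?R \<subseteq> carrier P"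
  proof -
    have "frag_of (v \<oplus>\<^bsub>K\<^esub> v', w) - frag_of (v, w) - frag_of (v', w) \<in> fsums KC"
      if "v \<in> carrier K" "v' \<in> carrier K" "w \<in> carrier C" for v v' w
      using that by (intro sums_diff of K.a_closed)
    then have 1: "?R1 \<subseteq> fsums KC" unfolding VW_simps by blast
    have "frag_of (v, w \<oplus>\<^bsub>C\<^esub> w') - frag_of (v, w) - frag_of (v, w') \<in> fsums KC"
      if "v \<in> carrier K" "w \<in> carrier C" "w' \<in> carrier C" for v w w'
      using that by (intro sums_diff of C.a_closed)
    then have 2: "?R2 \<subseteq> fsums KC" unfolding VW_simps by blast
    have "frag_of (r \<otimes>\<^bsub>K\<^esub> v, w) - frag_of (v, \<kappa> r \<otimes>\<^bsub>C\<^esub> w) \<in> fsums KC"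
      if "r \<in> carrier K" "v \<in> carrier K" "w \<in> carrier C" for r v w
      using that by (intro sums_diff of K.m_closed C.m_closed \<kappa>_closed)
    then have 3: "?R3 \<subseteq> fsums KC" unfolding VW_simps by blast
    from 1 2 3 show ?thesis unfolding P_carrier by (intro Un_least)
  qed
  have gen: "subgroup N P" unfolding N_def using P.generate_is_subgroup[OF sub] .
  have "subgroup (fib \<zero>\<^bsub>C\<^esub>) P"
  proof (rule P.subgroupI)
    show "fib \<zero>\<^bsub>C\<^esub> \<subseteq> carrier P" by (auto simp: fib_def)
    show "fib \<zero>\<^bsub>C\<^esub> \<noteq> {}" using fib_nonempty[OF C.zero_closed] by blast
    show "inv\<^bsub>P\<^esub> a \<in> fib \<zero>\<^bsub>C\<^esub>" if "a \<in> fib \<zero>\<^bsub>C\<^esub>" for a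
      using that ev_diff[of 0 a] ev_0 C.r_neg[OF C.zero_closed] by (simp add: fib_def a_minus_def)
    show "a \<otimes>\<^bsub>P\<^esub> b \<in> fib \<zero>\<^bsub>C\<^esub>" if "a \<in> fib \<zero>\<^bsub>C\<^esub>" "b \<in> fib \<zero>\<^bsub>C\<^esub>" for a b
      using that ev_add[of a b] sums_add[of a KC b] by (simp add: fib_def)
  qed
  moreover have "?R \<subseteq> fib \<zero>\<^bsub>C\<^esub>"
  proof -
    have R1: "ev (frag_of (v \<oplus>\<^bsub>K\<^esub> v', w) - frag_of (v, w) - frag_of (v', w)) = \<zero>\<^bsub>C\<^esub>"
      if "v \<in> carrier K" "v' \<in> carrier K" "w \<in> carrier C" for v v' w
    proof -
      have "ev (frag_of (v \<oplus>\<^bsub>K\<^esub> v', w) - frag_of (v, w) - frag_of (v', w)) =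
         (\<kappa> (v \<oplus>\<^bsub>K\<^esub> v') \<otimes>\<^bsub>C\<^esub> w \<ominus>\<^bsub>C\<^esub> \<kappa> v \<otimes>\<^bsub>C\<^esub> w) \<ominus>\<^bsub>C\<^esub> \<kappa> v' \<otimes>\<^bsub>C\<^esub> w"
        using that of sums_diff by (simp add: ev_diff ev_of del: mem_Collect_eq)
      also have "\<dots> = \<zero>\<^bsub>C\<^esub>"
        using that \<kappa>_closed by (simp add: ring_hom_add[OF \<kappa>] C.l_distr a_minus_def C.a_ac C.r_neg C.r_neg1)
      finally show ?thesis .
    qed
    have R2: "ev (frag_of (v, w \<oplus>\<^bsub>C\<^esub> w') - frag_of (v, w) - frag_of (v, w')) = \<zero>\<^bsub>C\<^esub>"
      if "v \<in> carrier K" "w \<in> carrier C" "w' \<in> carrier C" for v w w'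
    proof -
      have "ev (frag_of (v, w \<oplus>\<^bsub>C\<^esub> w') - frag_of (v, w) - frag_of (v, w')) =
         (\<kappa> v \<otimes>\<^bsub>C\<^esub> (w \<oplus>\<^bsub>C\<^esub> w') \<ominus>\<^bsub>C\<^esub> \<kappa> v \<otimes>\<^bsub>C\<^esub> w) \<ominus>\<^bsub>C\<^esub> \<kappa> v \<otimes>\<^bsub>C\<^esub> w'"
        using that of sums_diff by (simp add: ev_diff ev_of del: mem_Collect_eq)
      also have "\<dots> = \<zero>\<^bsub>C\<^esub>"
        using that \<kappa>_closed by (simp add: C.r_distr a_minus_def C.a_ac C.r_neg C.r_neg1)
      finally show ?thesis .
    qed
    have R3: "ev (frag_of (r \<otimes>\<^bsub>K\<^esub> v, w) - frag_of (v, \<kappa> r \<otimes>\<^bsub>C\<^esub> w)) = \<zero>\<^bsub>C\<^esub>"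
      if "r \<in> carrier K" "v \<in> carrier K" "w \<in> carrier C" for r v w
    proof -
      have "ev (frag_of (r \<otimes>\<^bsub>K\<^esub> v, w) - frag_of (v, \<kappa> r \<otimes>\<^bsub>C\<^esub> w)) =
         \<kappa> (r \<otimes>\<^bsub>K\<^esub> v) \<otimes>\<^bsub>C\<^esub> w \<ominus>\<^bsub>C\<^esub> \<kappa> v \<otimes>\<^bsub>C\<^esub> (\<kappa> r \<otimes>\<^bsub>C\<^esub> w)"
        using that of \<kappa>_closed by (simp add: ev_diff ev_of del: mem_Collect_eq)
      also have "\<kappa> (r \<otimes>\<^bsub>K\<^esub> v) = \<kappa> v \<otimes>\<^bsub>C\<^esub> \<kappa> r"
        using that K.m_comm[of r v] by (simp add: ring_hom_mult[OF \<kappa>, symmetric])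
      finally show ?thesis
        using that \<kappa>_closed by (simp add: C.m_assoc a_minus_def C.r_neg)
    qed
    have evR: "ev x = \<zero>\<^bsub>C\<^esub>" if "x \<in> ?R" for x
      using that unfolding VW_simps by (elim UnE CollectE exE conjE) (simp_all only: R1 R2 R3)
    show ?thesis
    proof
      fix x assume x: "x \<in> ?R"
      from subsetD[OF sub x] have "x \<in> fsums KC" unfolding P_carrier .
      with evR[OF x] show "x \<in> fib \<zero>\<^bsub>C\<^esub>" by (simp add: fib_def)
    qed
  qed
  ultimately show "tensor_null K V W \<subseteq> fib \<zero>\<^bsub>C\<^esub>" unfolding null N_def by (intro P.generate_subgroup_incl)
  have Nadd: "x + y \<in> N" if "x \<in> N" "y \<in> N" for x y using subgroup.m_closed[OF gen that] by simp
  have Nminus: "- x \<in> N" if "x \<in> N" for x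
    using subgroup.m_inv_closed[OF gen that] subgroup.mem_carrier[OF gen that] by simp
  have Ndiff: "x - y \<in> N" if "x \<in> N" "y \<in> N" for x y
    using Nadd[OF that(1) Nminus[OF that(2)]] by simp
  have r2: "frag_of (v, w \<oplus>\<^bsub>C\<^esub> w') - frag_of (v, w) - frag_of (v, w') \<in> N"
    if "v \<in> carrier K" "w \<in> carrier C" "w' \<in> carrier C" for v w w'
    unfolding N_def by (rule generate.incl) (use that in auto)
  have r3: "frag_of (r \<otimes>\<^bsub>K\<^esub> v, w) - frag_of (v, \<kappa> r \<otimes>\<^bsub>C\<^esub> w) \<in> N"
    if "r \<in> carrier K" "v \<in> carrier K" "w \<in> carrier C" for r v w
    unfolding N_def by (rule generate.incl) (use that in auto)
  have one0: "frag_of (\<one>\<^bsub>K\<^esub>, \<zero>\<^bsub>C\<^esub>) \<in> N"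
    using Nminus[OF r2[OF K.one_closed C.zero_closed C.zero_closed]] by simp
  have cong: "x - frag_of (\<one>\<^bsub>K\<^esub>, ev x) \<in> N" if "Poly_Mapping.keys x \<subseteq> KC" for x
    using that
  proof (induction x rule: free_Abelian_group_induct[consumes 1, case_names zero diff single])
    case zero
    then show ?case using Nminus[OF one0] by (simp add: ev_0)
  next
    case (diff x y)
    have c: "ev x \<in> carrier C" "ev y \<in> carrier C" using diff ev_closed by auto
    have "frag_of (\<one>\<^bsub>K\<^esub>, (ev x \<ominus>\<^bsub>C\<^esub> ev y) \<oplus>\<^bsub>C\<^esub> ev y) - frag_of (\<one>\<^bsub>K\<^esub>, ev x \<ominus>\<^bsub>C\<^esub> ev y) - frag_of (\<one>\<^bsub>K\<^esub>, ev y) \<in> N"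
      using c by (intro r2) auto
    moreover have "(ev x \<ominus>\<^bsub>C\<^esub> ev y) \<oplus>\<^bsub>C\<^esub> ev y = ev x" using c by (simp add: a_minus_def C.a_assoc C.l_neg)
    ultimately have "frag_of (\<one>\<^bsub>K\<^esub>, ev x) - frag_of (\<one>\<^bsub>K\<^esub>, ev (x - y)) - frag_of (\<one>\<^bsub>K\<^esub>, ev y) \<in> N"
      using diff by (simp add: ev_diff)
    from Nadd[OF Ndiff[OF diff(3,4)] this] show ?case by (simp add: algebra_simps)
  next
    case (single p)
    then obtain k c where p: "p = (k, c)" "k \<in> carrier K" "c \<in> carrier C" by auto
    show ?case using r3[OF p(2) K.one_closed p(3)] p by (simp add: ev_of)
  qed
  show "fib \<zero>\<^bsub>C\<^esub> \<subseteq> tensor_null K V W"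
  proof
    fix x assume "x \<in> fib \<zero>\<^bsub>C\<^esub>"
    then have "x - frag_of (\<one>\<^bsub>K\<^esub>, \<zero>\<^bsub>C\<^esub>) \<in> N" using cong[of x] by (simp add: fib_def)
    from Nadd[OF this one0] show "x \<in> tensor_null K V W" unfolding null by simp
  qed
qed

lemma tensor_class: 
  assumes x: "x \<in> fsums KC" shows "tensor_class K V W x = fib (ev x)"
proof -
  have "tensor_class K V W x = {u + x | u. u \<in> fib \<zero>\<^bsub>C\<^esub>}"
    unfolding tensor_class_def tensor_null r_coset_def by auto
  also have "\<dots> = fib (ev x)"
  proof
    show "{u + x | u. u \<in> fib \<zero>\<^bsub>C\<^esub>} \<subseteq> fib (ev x)"
      using x ev_add[OF _ x] sums_add[OF _ x] ev_closed[OF x] by (auto simp: fib_def)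
    show "fib (ev x) \<subseteq> {u + x | u. u \<in> fib \<zero>\<^bsub>C\<^esub>}"
    proof
      fix y assume y: "y \<in> fib (ev x)"
      then have "y - x \<in> fib \<zero>\<^bsub>C\<^esub>"
        using sums_diff[OF _ x, of y] ev_diff[OF _ x, of y] ev_closed[OF x] by (simp add: fib_def a_minus_def C.r_neg)
      moreover have "y = (y - x) + x" by simp
      ultimately show "y \<in> {u + x | u. u \<in> fib \<zero>\<^bsub>C\<^esub>}" by blast
    qed
  qed
  finally show ?thesis .
qed

lemma tensor_part:
  assumes S: "subgroup S (add_monoid C)" and sm: "\<And>k c. k \<in> carrier K \<Longrightarrow> c \<in> S \<Longrightarrow> \<kappa> k \<otimes>\<^bsub>C\<^esub> c \<in> S"
  shows "tensor_part K V W S = fib ` S"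
proof -
  have SC: "c \<in> S \<Longrightarrow> c \<in> carrier C" for c using subgroup.subset[OF S] by auto
  have evS: "ev x \<in> S" if "Poly_Mapping.keys x \<subseteq> carrier K \<times> S" for x
    using that
  proof (induction x rule: free_Abelian_group_induct[consumes 1, case_names zero diff single])
    case zero
    then show ?case using subgroup.one_closed[OF S] by (simp add: ev_0)
  next
    case (diff x y)
    then have "x \<in> fsums KC" "y \<in> fsums KC" using SC by auto
    then show ?case using diff ev_diff[of x y] subgroup.m_closed[OF S diff(3) subgroup.m_inv_closed[OF S diff(4)]]
      by (simp add: a_minus_def a_inv_def)
  next
    case (single p)
    then show ?case using sm SC by (auto simp: ev_of)
  qed
  have "tensor_part K V W S = {fib (ev x) | x. Poly_Mapping.keys x \<subseteq> carrier K \<times> S}"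
    unfolding tensor_part_def
  proof (rule Collect_cong)
    fix y
    have "tensor_class K V W x = fib (ev x)" if "Poly_Mapping.keys x \<subseteq> carrier K \<times> S" for x
      using that SC by (intro tensor_class) auto
    then show "(\<exists>x. y = tensor_class K V W x \<and> x \<in> carrier (free_Abelian_group (carrier V \<times> S))) \<longleftrightarrow>
        (\<exists>x. y = fib (ev x) \<and> Poly_Mapping.keys x \<subseteq> carrier K \<times> S)"
      by auto
  qed
  also have "\<dots> = fib ` S"
  proof
    show "fib ` S \<subseteq> {fib (ev x) | x. Poly_Mapping.keys x \<subseteq> carrier K \<times> S}"
    proof
      fix y assume "y \<in> fib ` S"
      then obtain c where c: "c \<in> S" "y = fib c" by blast
      have "y = fib (ev (frag_of (\<one>\<^bsub>K\<^esub>, c)))"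
        using c SC fib_nonempty[of c] by (simp add: fib_def)
      moreover have "Poly_Mapping.keys (frag_of (\<one>\<^bsub>K\<^esub>, c)) \<subseteq> carrier K \<times> S" using c by simp
      ultimately show "y \<in> {fib (ev x) | x. Poly_Mapping.keys x \<subseteq> carrier K \<times> S}" by blast
    qed
  qed (use evS in blast)
  finally show ?thesis .
qed

lemma ev_frag_bilinear:
  assumes x: "x \<in> fsums KC" and y: "y \<in> fsums KC"
  defines "f \<equiv> \<lambda>(s, c) (s', c'). (s \<otimes>\<^bsub>K\<^esub> s', c \<otimes>\<^bsub>C\<^esub> c')"
  shows "frag_bilinear f x y \<in> fsums KC \<and> ev (frag_bilinear f x y) = ev x \<otimes>\<^bsub>C\<^esub> ev y"
proof -
  have in1: "frag_extend (\<lambda>q. frag_of (f p q)) y \<in> fsums KC \<and>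
      ev (frag_extend (\<lambda>q. frag_of (f p q)) y) = ev (frag_of p) \<otimes>\<^bsub>C\<^esub> ev y" if p: "p \<in> KC" for p
  proof -
    obtain k c where pk: "p = (k, c)" "k \<in> carrier K" "c \<in> carrier C" using p by auto
    have ec: "ev (frag_of p) \<in> carrier C" using p ev_closed by simp
    have "Poly_Mapping.keys y \<subseteq> KC" using y by simp
    then show ?thesis
    proof (induction y rule: free_Abelian_group_induct[consumes 1, case_names zero diff single])
      case zero
      then show ?case using ec by (simp add: ev_0)
    next
      case (diff x y)
      have "ev x \<in> carrier C" "ev y \<in> carrier C" using diff ev_closed by auto
      then have "ev (frag_of p) \<otimes>\<^bsub>C\<^esub> (ev x \<ominus>\<^bsub>C\<^esub> ev y) = ev (frag_of p) \<otimes>\<^bsub>C\<^esub> ev x \<ominus>\<^bsub>C\<^esub> ev (frag_of p) \<otimes>\<^bsub>C\<^esub> ev y"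
        using ec by (simp add: a_minus_def C.r_distr C.r_minus)
      then show ?case using diff ev_diff sums_diff by (simp add: frag_extend_diff del: mem_Collect_eq) (simp add: ev_diff)
    next
      case (single q)
      then obtain l d where q: "q = (l, d)" "l \<in> carrier K" "d \<in> carrier C" by auto
      have "(\<kappa> k \<otimes>\<^bsub>C\<^esub> \<kappa> l) \<otimes>\<^bsub>C\<^esub> (c \<otimes>\<^bsub>C\<^esub> d) = (\<kappa> k \<otimes>\<^bsub>C\<^esub> c) \<otimes>\<^bsub>C\<^esub> (\<kappa> l \<otimes>\<^bsub>C\<^esub> d)"
      proof -
        have "(\<kappa> k \<otimes>\<^bsub>C\<^esub> \<kappa> l) \<otimes>\<^bsub>C\<^esub> (c \<otimes>\<^bsub>C\<^esub> d) = \<kappa> k \<otimes>\<^bsub>C\<^esub> ((\<kappa> l \<otimes>\<^bsub>C\<^esub> c) \<otimes>\<^bsub>C\<^esub> d)"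
          using pk q \<kappa>_closed by (simp add: C.m_assoc)
        also have "\<kappa> l \<otimes>\<^bsub>C\<^esub> c = c \<otimes>\<^bsub>C\<^esub> \<kappa> l" using central[OF q(2) pk(3)] .
        finally show ?thesis using pk q \<kappa>_closed by (simp add: C.m_assoc)
      qed
      then show ?case using pk q \<kappa>_closed by (simp add: f_def ev_of ring_hom_mult[OF \<kappa>])
    qed
  qed
  have "Poly_Mapping.keys x \<subseteq> KC" using x by simp
  then show ?thesis
    unfolding frag_bilinear_def
  proof (induction x rule: free_Abelian_group_induct[consumes 1, case_names zero diff single])
    case zero
    then show ?case using ev_closed[OF y] by (simp add: ev_0)
  next
    case (diff x z)
    have "ev x \<in> carrier C" "ev z \<in> carrier C" using diff ev_closed by auto
    then have "(ev x \<ominus>\<^bsub>C\<^esub> ev z) \<otimes>\<^bsub>C\<^esub> ev y = ev x \<otimes>\<^bsub>C\<^esub> ev y \<ominus>\<^bsub>C\<^esub> ev z \<otimes>\<^bsub>C\<^esub> ev y"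
      using ev_closed[OF y] by (simp add: a_minus_def C.l_distr C.l_minus)
    then show ?case using diff ev_diff sums_diff by (simp add: frag_extend_diff del: mem_Collect_eq) (simp add: ev_diff)
  next
    case (single p)
    then show ?case using in1[of p] by simp
  qed
qed

end

lemma direct_sum_restrict_scalars: "direct_sum (restrict_scalars \<phi> M) Mn \<longleftrightarrow> direct_sum M Mn"
proof -
  have 1: "finsum (restrict_scalars \<phi> M) f A = finsum M f A" for f :: "nat \<Rightarrow> _" and A
    by (simp add: finsum_def finprod_def restrict_scalars_def)
  have 2: "subgroup H (add_monoid (restrict_scalars \<phi> M)) \<longleftrightarrow> subgroup H (add_monoid M)" for H
    by (simp add: restrict_scalars_def subgroup_def m_inv_def)
  have 3: "carrier (restrict_scalars \<phi> M) = carrier M" "\<zero>\<^bsub>restrict_scalars \<phi> M\<^esub> = \<zero>\<^bsub>M\<^esub>"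
    by (simp_all add: restrict_scalars_def)
  show ?thesis unfolding direct_sum_def unfolding 1 2 unfolding 3 ..
qed

context central_algebra
begin

lemma TA_carrier: "carrier TA = fib ` carrier C"
proof -
  have "carrier TA = tensor_part K V W (carrier C)" by (simp add: tensor_algebra_def Let_def)
  also have "\<dots> = fib ` carrier C"
  proof (rule tensor_part)
    show "subgroup (carrier C) (add_monoid C)" using C.add.subgroup_self by simp
  qed (use \<kappa>_closed in auto)
  finally show ?thesis .
qed

lemma TA_zero: "\<zero>\<^bsub>TA\<^esub> = fib \<zero>\<^bsub>C\<^esub>"
  using tensor_null by (simp add: tensor_algebra_def Let_def)

lemma TA_one: "\<one>\<^bsub>TA\<^esub> = fib \<one>\<^bsub>C\<^esub>"
  using tensor_class[of "frag_of (\<one>\<^bsub>K\<^esub>, \<one>\<^bsub>C\<^esub>)"] ev_of[of "\<one>\<^bsub>K\<^esub>" "\<one>\<^bsub>C\<^esub>"] ring_hom_one[OF \<kappa>]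
  by (simp add: tensor_algebra_def Let_def)

lemma TA_add:
  assumes c: "c \<in> carrier C" and d: "d \<in> carrier C"
  shows "fib c \<oplus>\<^bsub>TA\<^esub> fib d = fib (c \<oplus>\<^bsub>C\<^esub> d)"
proof -
  have "fib c \<oplus>\<^bsub>TA\<^esub> fib d = {x + y | x y. x \<in> fib c \<and> y \<in> fib d}"
    by (auto simp: tensor_algebra_def Let_def set_mult_def)
  also have "\<dots> = fib (c \<oplus>\<^bsub>C\<^esub> d)"
  proof
    show "{x + y | x y. x \<in> fib c \<and> y \<in> fib d} \<subseteq> fib (c \<oplus>\<^bsub>C\<^esub> d)"
    proof
      fix z assume "z \<in> {x + y | x y. x \<in> fib c \<and> y \<in> fib d}"
      then obtain x y where xy: "z = x + y" "x \<in> fsums KC" "y \<in> fsums KC" "ev x = c" "ev y = d"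
        unfolding fib_def by blast
      show "z \<in> fib (c \<oplus>\<^bsub>C\<^esub> d)" using sums_add[OF xy(2,3)] ev_add[OF xy(2,3)] xy by (simp add: fib_def)
    qed
    show "fib (c \<oplus>\<^bsub>C\<^esub> d) \<subseteq> {x + y | x y. x \<in> fib c \<and> y \<in> fib d}"
    proof
      fix z assume z: "z \<in> fib (c \<oplus>\<^bsub>C\<^esub> d)"
      let ?x = "frag_of (\<one>\<^bsub>K\<^esub>, c)"
      have x: "?x \<in> fib c" using fib_nonempty[OF c] .
      have zk: "z \<in> fsums KC" "ev z = c \<oplus>\<^bsub>C\<^esub> d" and xk: "?x \<in> fsums KC" "ev ?x = c"
        using z x by (auto simp: fib_def)
      have "ev (z - ?x) = (c \<oplus>\<^bsub>C\<^esub> d) \<ominus>\<^bsub>C\<^esub> c" using ev_diff[OF zk(1) xk(1)] zk xk by simp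
      also have "\<dots> = d" using c d by (simp add: a_minus_def C.a_comm[of c d] C.a_assoc C.r_neg)
      finally have "z - ?x \<in> fib d" using sums_diff[OF zk(1) xk(1)] by (simp add: fib_def)
      moreover have "z = ?x + (z - ?x)" by simp
      ultimately show "z \<in> {x + y | x y. x \<in> fib c \<and> y \<in> fib d}" using x by blast
    qed
  qed
  finally show ?thesis .
qed

lemma TA_mult:
  assumes c: "c \<in> carrier C" and d: "d \<in> carrier C"
  shows "fib c \<otimes>\<^bsub>TA\<^esub> fib d = fib (c \<otimes>\<^bsub>C\<^esub> d)"
proof -
  let ?f = "\<lambda>(s, c) (s', c'). (s \<otimes>\<^bsub>K\<^esub> s', c \<otimes>\<^bsub>C\<^esub> c')"
  have "fib c \<otimes>\<^bsub>TA\<^esub> fib d = (\<Union>x\<in>fib c. \<Union>y\<in>fib d. tensor_class K V W (frag_bilinear ?f x y))"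
    by (simp add: tensor_algebra_def Let_def)
  also have "\<dots> = (\<Union>x\<in>fib c. \<Union>y\<in>fib d. fib (c \<otimes>\<^bsub>C\<^esub> d))"
  proof (intro SUP_cong refl)
    fix x y assume "x \<in> fib c" "y \<in> fib d"
    then have xy: "x \<in> fsums KC" "y \<in> fsums KC" "ev x = c" "ev y = d" by (auto simp: fib_def)
    from ev_frag_bilinear[OF xy(1,2)] tensor_class
    show "tensor_class K V W (frag_bilinear ?f x y) = fib (c \<otimes>\<^bsub>C\<^esub> d)" unfolding xy(3,4) by metis
  qed
  also have "\<dots> = fib (c \<otimes>\<^bsub>C\<^esub> d)" using fib_nonempty[OF c] fib_nonempty[OF d] by auto
  finally show ?thesis .
qed

lemma fib_iso: "fib \<in> ring_iso C TA"
  unfolding ring_iso_def bij_betw_def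
proof (intro CollectI conjI)
  show "fib \<in> ring_hom C TA" by (rule ring_hom_memI) (auto simp: TA_carrier TA_mult TA_add TA_one)
qed (use fib_inj TA_carrier in auto)

lemma TA_ring: "ring TA"
proof -
  have "ring (TA\<lparr>ring.zero := fib \<zero>\<^bsub>C\<^esub>\<rparr>)" by (rule C.ring_iso_imp_img_ring[OF fib_iso])
  then show ?thesis unfolding TA_zero[symmetric] by simp
qed

definition unfib :: "('k, 'c) tens \<Rightarrow> 'c" where "unfib = inv_into (carrier C) fib"

lemma unfib_iso: "unfib \<in> ring_iso TA C"
  unfolding unfib_def by (rule ring_iso_set_sym[OF C_ring fib_iso])

lemma unfib_hom: "unfib \<in> ring_hom TA C"
  using unfib_iso by (simp add: ring_iso_def)

lemma unfib_fib [simp]: "c \<in> carrier C \<Longrightarrow> unfib (fib c) = c"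
  unfolding unfib_def using fib_inj by simp

lemma pure_tensor_one:
  assumes "k \<in> carrier K" shows "pure_tensor K id K \<kappa> C k \<one>\<^bsub>C\<^esub> = fib (\<kappa> k)"
  unfolding pure_tensor_def using tensor_class[of "frag_of (k, \<one>\<^bsub>C\<^esub>)"] ev_of[of k "\<one>\<^bsub>C\<^esub>"] assms \<kappa>_closed by simp

text \<open>Since \<open>K \<otimes>\<^sub>K C = C\<close>, every point module of \<open>C\<close> is a \<open>K\<close>-point module.\<close>

lemma S_point_module_of_point_module:
  assumes N: "point_module K \<kappa> C Cn (N, Nn)" and Cn: "\<And>n. subgroup (Cn n) (add_monoid C)"
    and \<kappa>0: "\<kappa> ` carrier K \<subseteq> Cn 0" and deg: "\<And>k c n. k \<in> carrier K \<Longrightarrow> c \<in> Cn n \<Longrightarrow> \<kappa> k \<otimes>\<^bsub>C\<^esub> c \<in> Cn n"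
  shows "S_point_module K \<kappa> C Cn K id (restrict_scalars unfib N, Nn)"
proof -
  have gN: "graded_module C Cn (N, Nn)" and cyc: "cyclic_in_degree_zero C (N, Nn)"
    and free: "\<And>n. free_of_rank K ((restrict_scalars \<kappa> N)\<lparr>carrier := Nn n\<rparr>) 1"
    using N by (auto simp: point_module_def)
  have LN: "left_module C N" and dN: "direct_sum N Nn"
    and degN: "\<And>m n c x. c \<in> Cn m \<Longrightarrow> x \<in> Nn n \<Longrightarrow> c \<odot>\<^bsub>N\<^esub> x \<in> Nn (m + n)"
    using gN by (auto simp: graded_module_def)
  let ?N = "restrict_scalars unfib N"
  have CnC: "c \<in> Cn n \<Longrightarrow> c \<in> carrier C" for c n using subgroup.subset[OF Cn] by auto
  have grading: "tensor_grading K id K \<kappa> C Cn n = fib ` Cn n" for n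
    unfolding tensor_grading_def by (rule tensor_part[OF Cn deg])
  have LN': "left_module TA ?N" using left_module_restrict_scalars[OF LN TA_ring unfib_hom] .
  have "direct_sum ?N Nn"
    using dN by (simp add: direct_sum_restrict_scalars)
  moreover have "b \<odot>\<^bsub>?N\<^esub> x \<in> Nn (m + n)" if bx: "b \<in> fib ` Cn m" "x \<in> Nn n" for b x m n
  proof -
    obtain c where "c \<in> Cn m" "b = fib c" using bx(1) by blast
    then show ?thesis using degN[OF _ bx(2)] CnC by (simp add: restrict_scalars_def)
  qed
  ultimately have gN': "graded_module TA (tensor_grading K id K \<kappa> C Cn) (?N, Nn)"
    using LN' by (simp add: graded_module_def grading)
  obtain x where x: "x \<in> Nn 0" "carrier N = {c \<odot>\<^bsub>N\<^esub> x | c. c \<in> carrier C}"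
    using cyc by (auto simp: cyclic_in_degree_zero_def)
  have "{b \<odot>\<^bsub>?N\<^esub> x | b. b \<in> carrier TA} = {c \<odot>\<^bsub>N\<^esub> x | c. c \<in> carrier C}"
  proof
    show "{b \<odot>\<^bsub>?N\<^esub> x | b. b \<in> carrier TA} \<subseteq> {c \<odot>\<^bsub>N\<^esub> x | c. c \<in> carrier C}"
      using ring_hom_closed[OF unfib_hom] by (auto simp: restrict_scalars_def)
    show "{c \<odot>\<^bsub>N\<^esub> x | c. c \<in> carrier C} \<subseteq> {b \<odot>\<^bsub>?N\<^esub> x | b. b \<in> carrier TA}"
    proof
      fix y assume "y \<in> {c \<odot>\<^bsub>N\<^esub> x | c. c \<in> carrier C}"
      then obtain c where c: "c \<in> carrier C" "y = c \<odot>\<^bsub>N\<^esub> x" by blast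
      then have "y = fib c \<odot>\<^bsub>?N\<^esub> x" "fib c \<in> carrier TA" by (simp_all add: restrict_scalars_def TA_carrier)
      then show "y \<in> {b \<odot>\<^bsub>?N\<^esub> x | b. b \<in> carrier TA}" by blast
    qed
  qed
  then have cyc': "cyclic_in_degree_zero TA (?N, Nn)"
    unfolding cyclic_in_degree_zero_def split_conv using x
    by (intro bexI[of _ x]) (simp_all add: restrict_scalars_def)
  let ?V = "\<lambda>n. (restrict_scalars \<kappa> N)\<lparr>carrier := Nn n\<rparr>"
  let ?W = "\<lambda>n. (scalars_left K id K \<kappa> C ?N)\<lparr>carrier := Nn n\<rparr>"
  have VW: "module_iso K (?V n) (?W n) id" for n
    by (simp add: module_iso_def restrict_scalars_def scalars_left_def pure_tensor_one \<kappa>_closed)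
  have LW: "left_module K (?W n)" for n
    by (rule left_module_iso[OF _ VW]) (use free[of n] in \<open>simp_all add: free_of_rank_def restrict_scalars_def scalars_left_def\<close>)
  have freeW: "free_of_rank K (?W n) 1" for n by (rule free_of_rank_one_iso[OF free VW LW])
  obtain e where e: "e \<in> carrier (?W 0)" "\<And>v. v \<in> carrier (?W 0) \<Longrightarrow> \<exists>!a. a \<in> carrier K \<and> v = a \<odot>\<^bsub>?W 0\<^esub> e"
    using freeW[of 0] unfolding free_of_rank_one_iff by metis
  have "module_iso K (regular_module K) (?W 0) (\<lambda>a. a \<odot>\<^bsub>?W 0\<^esub> e)"
    unfolding module_iso_def bij_betw_def
  proof (intro conjI ballI)
    have cl: "a \<odot>\<^bsub>?W 0\<^esub> e \<in> carrier (?W 0)" if "a \<in> carrier K" for a using smult_closed[OF LW that e(1)] .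
    show "inj_on (\<lambda>a. a \<odot>\<^bsub>?W 0\<^esub> e) (carrier (regular_module K))"
    proof (rule inj_onI)
      fix a b assume ab: "a \<in> carrier (regular_module K)" "b \<in> carrier (regular_module K)"
        "a \<odot>\<^bsub>?W 0\<^esub> e = b \<odot>\<^bsub>?W 0\<^esub> e"
      then have "a \<in> carrier K" "b \<in> carrier K" by (simp_all add: regular_module_def)
      then show "a = b" using e(2)[OF cl, of a] ab(3) by blast
    qed
    show "(\<lambda>a. a \<odot>\<^bsub>?W 0\<^esub> e) ` carrier (regular_module K) = carrier (?W 0)"
    proof
      show "carrier (?W 0) \<subseteq> (\<lambda>a. a \<odot>\<^bsub>?W 0\<^esub> e) ` carrier (regular_module K)"
      proof
        fix v assume "v \<in> carrier (?W 0)"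
        then obtain a where "a \<in> carrier K" "v = a \<odot>\<^bsub>?W 0\<^esub> e" using e(2) by blast
        then show "v \<in> (\<lambda>a. a \<odot>\<^bsub>?W 0\<^esub> e) ` carrier (regular_module K)" by (simp add: regular_module_def)
      qed
    qed (use cl in \<open>auto simp: regular_module_def\<close>)
  qed (use smult_l_distr[OF LW _ _ e(1)] smult_assoc[OF LW _ _ e(1)] in \<open>simp_all add: regular_module_def\<close>)
  then show ?thesis
    unfolding S_point_module_def split_conv using gN' cyc' free_imp_locally_free[OF K_cring freeW] by blast
qed

lemma homogeneous_iso_unfib:
  assumes "homogeneous_iso TA (restrict_scalars unfib N, Nn) (restrict_scalars unfib N', Nn')"
  shows "homogeneous_iso C (N, Nn) (N', Nn')"
proof -
  obtain h where h: "module_iso TA (restrict_scalars unfib N) (restrict_scalars unfib N') h"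
    "\<forall>n. h ` Nn n \<subseteq> Nn' n" using assms by (auto simp: homogeneous_iso_def)
  have "h (c \<odot>\<^bsub>N\<^esub> x) = c \<odot>\<^bsub>N'\<^esub> h x" if "c \<in> carrier C" "x \<in> carrier N" for c x
    using module_isoD(4)[OF h(1), of "fib c" x] that by (simp add: restrict_scalars_def TA_carrier)
  then have "module_iso C N N' h"
    using h(1) by (simp add: module_iso_def restrict_scalars_def)
  then show ?thesis using h(2) by (auto simp: homogeneous_iso_def)
qed

end

section \<open>Fractions and spectra\<close>

lemma openin_zariski:
  "openin (zariski R) U \<longleftrightarrow> (\<exists>E\<subseteq>carrier R. U = {p. primeideal p R \<and> \<not> E \<subseteq> p})"
  unfolding zariski_def by (simp add: topology_inverse'[OF istopology_zariski])

lemma basic_open: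
  assumes "a \<in> carrier R" shows "openin (zariski R) {p. primeideal p R \<and> a \<notin> p}"
  unfolding openin_zariski using assms by (intro exI[of _ "{a}"]) auto

lemma topspace_zariski:
  assumes "cring R" shows "topspace (zariski R) = {p. primeideal p R}"
proof
  show "topspace (zariski R) \<subseteq> {p. primeideal p R}"
    using openin_topspace[of "zariski R"] unfolding openin_zariski by auto
  interpret cring R by fact
  have "\<not> carrier R \<subseteq> p" if "primeideal p R" for p
    using primeideal.I_notcarr[OF that] ideal.Icarr[OF primeideal.axioms(1)[OF that]] by blast
  then have "openin (zariski R) {p. primeideal p R}"
    unfolding openin_zariski by (intro exI[of _ "carrier R"]) auto
  then show "{p. primeideal p R} \<subseteq> topspace (zariski R)" by (rule openin_subset)
qed

text \<open>The operations of a localization are unions over all numerators and denominators of the arguments.\<close>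

lemma UN_pairs_const:
  assumes "p \<in> A" "q \<in> A'" "\<And>a d b e. (a, d) \<in> A \<Longrightarrow> (b, e) \<in> A' \<Longrightarrow> f a d b e = C"
  shows "(\<Union>(a, d)\<in>A. \<Union>(b, e)\<in>A'. f a d b e) = C"
proof -
  have "(\<Union>(a, d)\<in>A. \<Union>(b, e)\<in>A'. f a d b e) = (\<Union>p\<in>A. \<Union>q\<in>A'. C)"
    using assms(3) by (intro SUP_cong refl) auto
  then show ?thesis using assms(1,2) by auto
qed

locale prime_localization = cring R for R :: "'r ring" (structure) +
  fixes r assumes prime: "primeideal r R"
begin

abbreviation D where "D \<equiv> carrier R - r"

lemma D_closed: "d \<in> D \<Longrightarrow> e \<in> D \<Longrightarrow> d \<otimes> e \<in> D"
  using primeideal.I_prime[OF prime] by auto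

lemma one_D: "\<one> \<in> D"
  using primeideal.I_notcarr[OF prime] ideal.one_imp_carrier[OF primeideal.axioms(1)[OF prime]] by auto

lemma frac_iff: "(b, e) \<in> frac_at R r a d \<longleftrightarrow> b \<in> carrier R \<and> e \<in> D \<and> (\<exists>u\<in>D. u \<otimes> (e \<otimes> a) = u \<otimes> (d \<otimes> b))"
  by (simp add: frac_def regular_module_def)

lemma frac_self: "a \<in> carrier R \<Longrightarrow> d \<in> D \<Longrightarrow> (a, d) \<in> frac_at R r a d"
  unfolding frac_iff using one_D by blast

lemma frac_trans:
  assumes "(b, e) \<in> frac_at R r a d" "(c, g) \<in> frac_at R r b e" and a: "a \<in> carrier R" "d \<in> D"
  shows "(c, g) \<in> frac_at R r a d"
proof -
  obtain u v where u: "u \<in> D" "u \<otimes> (e \<otimes> a) = u \<otimes> (d \<otimes> b)" and v: "v \<in> D" "v \<otimes> (g \<otimes> b) = v \<otimes> (e \<otimes> c)"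
    and c: "b \<in> carrier R" "e \<in> D" "c \<in> carrier R" "g \<in> D"
    using assms(1,2) unfolding frac_iff by blast
  have cc: "u \<in> carrier R" "v \<in> carrier R" "e \<in> carrier R" "g \<in> carrier R" "d \<in> carrier R"
    using u v c a by auto
  have "(u \<otimes> v \<otimes> e) \<otimes> (g \<otimes> a) = (v \<otimes> g) \<otimes> (u \<otimes> (e \<otimes> a))" using cc a c by (simp add: m_ac)
  also have "\<dots> = (u \<otimes> d) \<otimes> (v \<otimes> (g \<otimes> b))" unfolding u(2) using cc a c by (simp add: m_ac)
  also have "\<dots> = (u \<otimes> v \<otimes> e) \<otimes> (d \<otimes> c)" unfolding v(2) using cc a c by (simp add: m_ac)
  finally show ?thesis unfolding frac_iff using c D_closed[OF D_closed[OF u(1) v(1)] c(2)] by blast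
qed

lemma frac_sym:
  assumes "(b, e) \<in> frac_at R r a d" and a: "a \<in> carrier R" "d \<in> D"
  shows "(a, d) \<in> frac_at R r b e"
  using assms unfolding frac_iff by metis

lemma frac_eq:
  assumes "(b, e) \<in> frac_at R r a d" and a: "a \<in> carrier R" "d \<in> D"
  shows "frac_at R r a d = frac_at R r b e"
proof -
  have b: "b \<in> carrier R" "e \<in> D" using assms(1) unfolding frac_iff by auto
  show ?thesis
  proof (intro Set.set_eqI iffI)
    fix p assume p: "p \<in> frac_at R r a d"
    obtain c g where "p = (c, g)" by (cases p)
    then show "p \<in> frac_at R r b e" using frac_trans[OF frac_sym[OF assms] _ b] p by blast
  next
    fix p assume p: "p \<in> frac_at R r b e"
    obtain c g where "p = (c, g)" by (cases p)
    then show "p \<in> frac_at R r a d" using frac_trans[OF assms(1) _ a] p by blast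
  qed
qed

lemma frac_mult:
  assumes a: "a \<in> carrier R" "d \<in> D" and b: "b \<in> carrier R" "e \<in> D"
  shows "frac_at R r a d \<otimes>\<^bsub>loc_at R r\<^esub> frac_at R r b e = frac_at R r (a \<otimes> b) (d \<otimes> e)"
proof -
  have *: "frac_at R r (a' \<otimes> b') (d' \<otimes> e') = frac_at R r (a \<otimes> b) (d \<otimes> e)"
    if a': "(a', d') \<in> frac_at R r a d" and b': "(b', e') \<in> frac_at R r b e" for a' d' b' e'
  proof (rule frac_eq[symmetric])
    obtain u v where u: "u \<in> D" "u \<otimes> (d' \<otimes> a) = u \<otimes> (d \<otimes> a')" and v: "v \<in> D" "v \<otimes> (e' \<otimes> b) = v \<otimes> (e \<otimes> b')"
      and c: "a' \<in> carrier R" "d' \<in> D" "b' \<in> carrier R" "e' \<in> D"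
      using a' b' unfolding frac_iff by blast
    have cc: "u \<in> carrier R" "v \<in> carrier R" "e \<in> carrier R" "d \<in> carrier R" "d' \<in> carrier R" "e' \<in> carrier R"
      using u v c a b by auto
    have "(u \<otimes> v) \<otimes> ((d' \<otimes> e') \<otimes> (a \<otimes> b)) = (u \<otimes> (d' \<otimes> a)) \<otimes> (v \<otimes> (e' \<otimes> b))"
      using cc a b by (simp add: m_ac)
    also have "\<dots> = (u \<otimes> v) \<otimes> ((d \<otimes> e) \<otimes> (a' \<otimes> b'))" unfolding u(2) v(2) using cc c by (simp add: m_ac)
    finally show "(a' \<otimes> b', d' \<otimes> e') \<in> frac_at R r (a \<otimes> b) (d \<otimes> e)"
      unfolding frac_iff using c D_closed[OF u(1) v(1)] D_closed[OF c(2,4)] by blast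
  qed (use a b D_closed in auto)
  have **: "frac_at R r a d \<otimes>\<^bsub>loc_at R r\<^esub> frac_at R r b e =
    (\<Union>(a', d')\<in>frac_at R r a d. \<Union>(b', e')\<in>frac_at R r b e. frac_at R r (a' \<otimes> b') (d' \<otimes> e'))"
    by (simp add: loc_ring_def Let_def)
  from UN_pairs_const[OF frac_self[OF a] frac_self[OF b] *]
  have "(\<Union>(a', d')\<in>frac_at R r a d. \<Union>(b', e')\<in>frac_at R r b e. frac_at R r (a' \<otimes> b') (d' \<otimes> e')) =
    frac_at R r (a \<otimes> b) (d \<otimes> e)" .
  with ** show ?thesis by simp
qed

lemma loc_one: "\<one>\<^bsub>loc_at R r\<^esub> = frac_at R r \<one> \<one>"
  by (simp add: loc_ring_def Let_def)

lemma loc_carrier: "carrier (loc_at R r) = {frac_at R r a d | a d. a \<in> carrier R \<and> d \<in> D}"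
  by (simp add: loc_ring_def Let_def)

lemma frac_inverse:
  assumes "a \<in> D" shows "frac_at R r a \<one> \<otimes>\<^bsub>loc_at R r\<^esub> frac_at R r \<one> a = \<one>\<^bsub>loc_at R r\<^esub>"
proof -
  have a: "a \<in> carrier R" using assms by auto
  have "frac_at R r a a = frac_at R r \<one> \<one>"
  proof (rule frac_eq)
    show "(\<one>, \<one>) \<in> frac_at R r a a" unfolding frac_iff using one_D a by (auto intro!: bexI[of _ \<one>])
  qed (use assms in auto)
  then show ?thesis using frac_mult[OF a one_D _ assms, of \<one>] a by (simp add: loc_one)
qed

lemma frac_not_invertible:
  assumes a: "a \<in> r" and t: "t \<in> carrier (loc_at R r)"
  shows "frac_at R r a \<one> \<otimes>\<^bsub>loc_at R r\<^esub> t \<noteq> \<one>\<^bsub>loc_at R r\<^esub>"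
proof
  assume e: "frac_at R r a \<one> \<otimes>\<^bsub>loc_at R r\<^esub> t = \<one>\<^bsub>loc_at R r\<^esub>"
  interpret I: ideal r R using primeideal.axioms(1)[OF prime] .
  have ac: "a \<in> carrier R" using I.Icarr[OF a] .
  obtain b d where b: "t = frac_at R r b d" "b \<in> carrier R" "d \<in> D" using t unfolding loc_carrier by blast
  have "frac_at R r \<one> \<one> = frac_at R r (a \<otimes> b) (\<one> \<otimes> d)"
    using e frac_mult[OF ac one_D b(2,3)] unfolding b(1) loc_one by simp
  moreover have "(a \<otimes> b, \<one> \<otimes> d) \<in> frac_at R r (a \<otimes> b) (\<one> \<otimes> d)"
    using frac_self[of "a \<otimes> b" "\<one> \<otimes> d"] ac b D_closed[OF one_D] by blast
  ultimately have "(a \<otimes> b, \<one> \<otimes> d) \<in> frac_at R r \<one> \<one>" by simp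
  then obtain u where u: "u \<in> D" "u \<otimes> ((\<one> \<otimes> d) \<otimes> \<one>) = u \<otimes> (\<one> \<otimes> (a \<otimes> b))" unfolding frac_iff by blast
  have "a \<otimes> b \<in> r" using I.I_r_closed[OF a b(2)] .
  then have "u \<otimes> (\<one> \<otimes> (a \<otimes> b)) \<in> r" using I.I_l_closed[of "a \<otimes> b" u] u(1) ac b(2) by simp
  then have "u \<otimes> d \<in> r" using u b(3) by auto
  then show False using D_closed[OF u(1) b(3)] by blast
qed

end

section \<open>Sections that are invertible near a point\<close>

text \<open>The section does not vanish at \<open>x\<close>. In terms of restrictions to neighbourhoods this condition can be
  moved along morphisms without passing to stalks.\<close>

definition invertible_near :: "('x, 'o) ringed_space \<Rightarrow> 'x \<Rightarrow> 'x set \<Rightarrow> 'o \<Rightarrow> bool" where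
  "invertible_near X x U s \<longleftrightarrow> (\<exists>W. openin (topo X) W \<and> x \<in> W \<and> W \<subseteq> U \<and>
     (\<exists>t\<in>carrier (sec X W). res X U W s \<otimes>\<^bsub>sec X W\<^esub> t = \<one>\<^bsub>sec X W\<^esub>))"

text \<open>By Zorn's lemma a non-unit lies in some maximal ideal, and there is only one.\<close>

lemma nonunit_in_maximal_ideal:
  assumes R: "local_ring R" and a: "a \<in> carrier R" "a \<notin> Units R" and I: "maximalideal I R"
  shows "a \<in> I"
proof -
  interpret cring R using R by (simp add: local_ring_def)
  let ?A = "{J. ideal J R \<and> a \<in> J \<and> \<one>\<^bsub>R\<^esub> \<notin> J}"
  have "PIdl\<^bsub>R\<^esub> a \<in> ?A"
  proof -
    have "\<one>\<^bsub>R\<^esub> \<notin> PIdl\<^bsub>R\<^esub> a"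
    proof
      assume "\<one>\<^bsub>R\<^esub> \<in> PIdl\<^bsub>R\<^esub> a"
      then obtain b where "b \<in> carrier R" "b \<otimes>\<^bsub>R\<^esub> a = \<one>\<^bsub>R\<^esub>" by (auto simp: cgenideal_def)
      then have "a \<in> Units R" using a m_comm by (auto simp: Units_def)
      then show False using a by simp
    qed
    then show ?thesis using cgenideal_ideal[OF a(1)] cgenideal_self[OF a(1)] by simp
  qed
  then have "\<exists>M\<in>?A. \<forall>J\<in>?A. M \<subseteq> J \<longrightarrow> J = M"
  proof (intro subset_Zorn_nonempty)
    fix \<C> assume C: "\<C> \<noteq> {}" "subset.chain ?A \<C>"
    then have "subset.chain {J. ideal J R} \<C>" unfolding pred_on.chain_def by blast
    then have "ideal (\<Union>\<C>) R" using chain_Union_is_ideal C(1) by (metis (mono_tags, lifting))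
    then show "\<Union>\<C> \<in> ?A" using C unfolding pred_on.chain_def by blast
  qed blast
  then obtain M where M: "ideal M R" "a \<in> M" "\<one>\<^bsub>R\<^esub> \<notin> M"
    and max: "\<And>J. ideal J R \<Longrightarrow> a \<in> J \<Longrightarrow> \<one>\<^bsub>R\<^esub> \<notin> J \<Longrightarrow> M \<subseteq> J \<Longrightarrow> J = M" by blast
  have "maximalideal M R"
  proof (rule maximalidealI[OF M(1)])
    show "carrier R \<noteq> M" using M(3) by auto
    fix J assume J: "ideal J R" "M \<subseteq> J" "J \<subseteq> carrier R"
    have "a \<in> J" using J(2) M(2) by (rule subsetD)
    then show "J = M \<or> J = carrier R"
      using max[OF J(1) _ _ J(2)] ideal.one_imp_carrier[OF J(1)] by argo
  qed
  moreover have "\<exists>!I. maximalideal I R" using R by (simp add: local_ring_def)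
  ultimately have "M = I" using I by blast
  then show ?thesis using M(2) by simp
qed

locale local_space =
  fixes X :: "('x, 'o) ringed_space"
  assumes lrs: "locally_ringed_space X"
begin

lemma presheaf: "presheaf_of_rings X"
  using lrs by (simp add: locally_ringed_space_def sheaf_of_rings_def)

lemma sec_cring: "openin (topo X) U \<Longrightarrow> cring (sec X U)"
  using presheaf by (simp add: presheaf_of_rings_def)

lemma res_hom: "openin (topo X) U \<Longrightarrow> openin (topo X) V \<Longrightarrow> V \<subseteq> U \<Longrightarrow>
    res X U V \<in> ring_hom (sec X U) (sec X V)"
  using presheaf by (simp add: presheaf_of_rings_def)

lemma res_id: "openin (topo X) U \<Longrightarrow> s \<in> carrier (sec X U) \<Longrightarrow> res X U U s = s"
  using presheaf by (simp add: presheaf_of_rings_def)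

lemma res_res: "openin (topo X) U \<Longrightarrow> openin (topo X) V \<Longrightarrow> openin (topo X) W \<Longrightarrow> W \<subseteq> V \<Longrightarrow>
    V \<subseteq> U \<Longrightarrow> s \<in> carrier (sec X U) \<Longrightarrow> res X V W (res X U V s) = res X U W s"
  using presheaf unfolding presheaf_of_rings_def by (elim conjE) simp

lemma stalk_local: "x \<in> topspace (topo X) \<Longrightarrow> local_ring (stalk X x)"
  using lrs unfolding locally_ringed_space_def by blast

lemma germ_self:
  assumes "openin (topo X) U" "x \<in> U" "s \<in> carrier (sec X U)"
  shows "(U, s) \<in> germ X x U s"
  unfolding germ_def using assms by blast

lemma germ_eq:
  assumes U: "openin (topo X) U" "x \<in> U" "s \<in> carrier (sec X U)" and V: "(V, t) \<in> germ X x U s"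
  shows "germ X x V t = germ X x U s"
proof -
  obtain W where W: "openin (topo X) W" "x \<in> W" "W \<subseteq> U \<inter> V" "res X U W s = res X V W t"
    and Vo: "openin (topo X) V" "x \<in> V" "t \<in> carrier (sec X V)" using V unfolding germ_def by blast
  have *: "(V', t') \<in> germ X x U2 s2"
    if m: "(V', t') \<in> germ X x U1 s1" and 1: "openin (topo X) U1" "s1 \<in> carrier (sec X U1)"
      and 2: "openin (topo X) U2" "s2 \<in> carrier (sec X U2)" and W12: "W \<subseteq> U1 \<inter> U2" "res X U1 W s1 = res X U2 W s2"
    for V' t' U1 s1 U2 s2
  proof -
    obtain W' where W': "openin (topo X) W'" "x \<in> W'" "W' \<subseteq> U1 \<inter> V'" "res X U1 W' s1 = res X V' W' t'"
      and V': "openin (topo X) V'" "x \<in> V'" "t' \<in> carrier (sec X V')" using m unfolding germ_def by blast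
    let ?W = "W \<inter> W'"
    have o: "openin (topo X) ?W" using W(1) W'(1) by blast
    have "res X U2 ?W s2 = res X W ?W (res X U2 W s2)"
      using res_res[OF 2(1) W(1) o _ _ 2(2)] W12 by auto
    also have "\<dots> = res X W ?W (res X U1 W s1)" using W12 by simp
    also have "\<dots> = res X U1 ?W s1" using res_res[OF 1(1) W(1) o _ _ 1(2)] W12 by auto
    also have "\<dots> = res X W' ?W (res X U1 W' s1)" using res_res[OF 1(1) W'(1) o _ _ 1(2)] W' by auto
    also have "\<dots> = res X W' ?W (res X V' W' t')" using W' by simp
    also have "\<dots> = res X V' ?W t'" using res_res[OF V'(1) W'(1) o _ _ V'(3)] W' by auto
    finally have "res X U2 ?W s2 = res X V' ?W t'" .
    moreover have "x \<in> ?W" "?W \<subseteq> U2 \<inter> V'" using W W' W12 by auto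
    ultimately show ?thesis unfolding germ_def using V' o by blast
  qed
  show ?thesis
  proof (intro Set.set_eqI iffI)
    fix p assume "p \<in> germ X x V t"
    then show "p \<in> germ X x U s"
      using *[of "fst p" "snd p" V t U s] Vo U W by auto
  next
    fix p assume "p \<in> germ X x U s"
    then show "p \<in> germ X x V t"
      using *[of "fst p" "snd p" U s V t] Vo U W by auto
  qed
qed

lemma germ_carrier:
  "openin (topo X) U \<Longrightarrow> x \<in> U \<Longrightarrow> s \<in> carrier (sec X U) \<Longrightarrow> germ X x U s \<in> carrier (stalk X x)"
  unfolding stalk_def by auto

text \<open>The operations of the stalk are defined as unions. To compute a sum or product of germs it therefore
  suffices to find one member of it.\<close>

lemma stalk_carrier_eq:
  assumes "A \<in> carrier (stalk X x)" "(U, s) \<in> A" shows "A = germ X x U s"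
proof -
  obtain V t where "A = germ X x V t" "openin (topo X) V" "x \<in> V" "t \<in> carrier (sec X V)"
    using assms(1) unfolding stalk_def by auto
  then show ?thesis using germ_eq[of V x t U s] assms(2) by simp
qed

context
  fixes x U s t
  assumes U: "openin (topo X) U" "x \<in> U" and s: "s \<in> carrier (sec X U)" and t: "t \<in> carrier (sec X U)"
begin

lemma stalk_cring: "cring (stalk X x)"
  using stalk_local[of x] openin_subset[OF U(1)] U(2) by (auto simp: local_ring_def)

lemma germ_add: "germ X x U s \<oplus>\<^bsub>stalk X x\<^esub> germ X x U t = germ X x U (s \<oplus>\<^bsub>sec X U\<^esub> t)"
proof (rule stalk_carrier_eq)
  interpret S: cring "stalk X x" by (rule stalk_cring)
  interpret G: cring "sec X U" using sec_cring[OF U(1)] .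
  show "germ X x U s \<oplus>\<^bsub>stalk X x\<^esub> germ X x U t \<in> carrier (stalk X x)"
    using germ_carrier[OF U s] germ_carrier[OF U t] by simp
  have "(U, s \<oplus>\<^bsub>sec X U\<^esub> t) \<in> germ X x (U \<inter> U) (res X U (U \<inter> U) s \<oplus>\<^bsub>sec X (U \<inter> U)\<^esub> res X U (U \<inter> U) t)"
    using germ_self[OF U] s t res_id[OF U(1)] by simp
  then show "(U, s \<oplus>\<^bsub>sec X U\<^esub> t) \<in> germ X x U s \<oplus>\<^bsub>stalk X x\<^esub> germ X x U t"
    using germ_self[OF U s] germ_self[OF U t] unfolding stalk_def by force
qed

lemma germ_mult: "germ X x U s \<otimes>\<^bsub>stalk X x\<^esub> germ X x U t = germ X x U (s \<otimes>\<^bsub>sec X U\<^esub> t)"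
proof (rule stalk_carrier_eq)
  interpret S: cring "stalk X x" by (rule stalk_cring)
  interpret G: cring "sec X U" using sec_cring[OF U(1)] .
  show "germ X x U s \<otimes>\<^bsub>stalk X x\<^esub> germ X x U t \<in> carrier (stalk X x)"
    using germ_carrier[OF U s] germ_carrier[OF U t] by simp
  have "(U, s \<otimes>\<^bsub>sec X U\<^esub> t) \<in> germ X x (U \<inter> U) (res X U (U \<inter> U) s \<otimes>\<^bsub>sec X (U \<inter> U)\<^esub> res X U (U \<inter> U) t)"
    using germ_self[OF U] s t res_id[OF U(1)] by simp
  then show "(U, s \<otimes>\<^bsub>sec X U\<^esub> t) \<in> germ X x U s \<otimes>\<^bsub>stalk X x\<^esub> germ X x U t"
    using germ_self[OF U s] germ_self[OF U t] unfolding stalk_def by force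
qed

lemma germ_one: "germ X x U \<one>\<^bsub>sec X U\<^esub> = \<one>\<^bsub>stalk X x\<^esub>"
proof -
  let ?T = "topspace (topo X)"
  have UT: "U \<subseteq> ?T" "x \<in> ?T" "openin (topo X) ?T" using openin_subset[OF U(1)] U(2) by auto
  interpret G: cring "sec X U" using sec_cring[OF U(1)] .
  interpret T: cring "sec X ?T" using sec_cring[OF UT(3)] .
  have "(U, \<one>\<^bsub>sec X U\<^esub>) \<in> germ X x ?T \<one>\<^bsub>sec X ?T\<^esub>"
    unfolding germ_def using U UT ring_hom_one[OF res_hom[OF UT(3) U(1) UT(1)]] res_id[OF U(1) G.one_closed] by auto
  from germ_eq[OF UT(3,2) T.one_closed this] show ?thesis by (simp add: stalk_def)
qed

text \<open>An inverse germ is represented by a section, and the equation holds on a small neighbourhood.\<close>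

lemma unit_germ_invertible_near:
  assumes "germ X x U s \<in> Units (stalk X x)" shows "invertible_near X x U s"
proof -
  obtain B where B: "B \<in> carrier (stalk X x)" "germ X x U s \<otimes>\<^bsub>stalk X x\<^esub> B = \<one>\<^bsub>stalk X x\<^esub>"
    using assms by (auto simp: Units_def)
  obtain V u where V: "B = germ X x V u" "openin (topo X) V" "x \<in> V" "u \<in> carrier (sec X V)"
    using B(1) unfolding stalk_def by auto
  let ?T = "topspace (topo X)" and ?Z = "U \<inter> V"
  have Z: "openin (topo X) ?Z" "x \<in> ?Z" "?Z \<subseteq> ?T" using U V openin_subset[OF U(1)] by auto
  interpret G: cring "sec X ?Z" using sec_cring[OF Z(1)] .
  have sc: "res X U ?Z s \<in> carrier (sec X ?Z)" and uc: "res X V ?Z u \<in> carrier (sec X ?Z)"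
    using ring_hom_closed[OF res_hom[OF U(1) Z(1)] s] ring_hom_closed[OF res_hom[OF V(2) Z(1)] V(4)] by auto
  let ?p = "res X U ?Z s \<otimes>\<^bsub>sec X ?Z\<^esub> res X V ?Z u"
  have "(?Z, ?p) \<in> germ X x ?Z ?p" using germ_self[OF Z(1,2)] sc uc by simp
  then have "(?Z, ?p) \<in> germ X x U s \<otimes>\<^bsub>stalk X x\<^esub> B"
    using germ_self[OF U s] germ_self[OF V(2,3,4)] unfolding V(1) stalk_def by force
  then have "(?Z, ?p) \<in> germ X x ?T \<one>\<^bsub>sec X ?T\<^esub>" unfolding B(2) by (simp add: stalk_def)
  then obtain W where W: "openin (topo X) W" "x \<in> W" "W \<subseteq> ?T \<inter> ?Z" "res X ?T W \<one>\<^bsub>sec X ?T\<^esub> = res X ?Z W ?p"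
    unfolding germ_def by blast
  note hZ = res_hom[OF Z(1) W(1)]
  have "\<one>\<^bsub>sec X W\<^esub> = res X ?Z W ?p"
    using W ring_hom_one[OF res_hom[OF openin_topspace W(1)]] by auto
  also have "\<dots> = res X ?Z W (res X U ?Z s) \<otimes>\<^bsub>sec X W\<^esub> res X ?Z W (res X V ?Z u)"
    using ring_hom_mult[OF hZ sc uc] W by auto
  also have "res X ?Z W (res X U ?Z s) = res X U W s" using res_res[OF U(1) Z(1) W(1) _ _ s] W by auto
  finally have "res X U W s \<otimes>\<^bsub>sec X W\<^esub> res X ?Z W (res X V ?Z u) = \<one>\<^bsub>sec X W\<^esub>" by simp
  moreover have "res X ?Z W (res X V ?Z u) \<in> carrier (sec X W)" using ring_hom_closed[OF hZ uc] W by auto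
  ultimately show ?thesis unfolding invertible_near_def using W by blast
qed

lemma not_invertible_in_maximal:
  assumes "\<not> invertible_near X x U s" "maximalideal I (stalk X x)"
  shows "germ X x U s \<in> I"
  using nonunit_in_maximal_ideal[OF stalk_local germ_carrier[OF U s] _ assms(2)]
    unit_germ_invertible_near assms(1) openin_subset[OF U(1)] U(2) by blast

end

text \<open>In the local ring at \<open>x\<close> the non-units form an ideal, so a unit is not the sum of two non-units.\<close>

lemma invertible_near_sum:
  assumes U: "openin (topo X) U" "x \<in> U" and s: "s \<in> carrier (sec X U)" and t: "t \<in> carrier (sec X U)"
    and c': "c' \<in> carrier (sec X U)" "(s \<oplus>\<^bsub>sec X U\<^esub> t) \<otimes>\<^bsub>sec X U\<^esub> c' = \<one>\<^bsub>sec X U\<^esub>"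
  shows "invertible_near X x U s \<or> invertible_near X x U t"
proof (rule ccontr)
  assume n: "\<not> (invertible_near X x U s \<or> invertible_near X x U t)"
  obtain I where I: "maximalideal I (stalk X x)"
    using stalk_local[of x] openin_subset[OF U(1)] U(2) unfolding local_ring_def by blast
  interpret I: maximalideal I "stalk X x" by (rule I)
  interpret G: cring "sec X U" using sec_cring[OF U(1)] .
  have "germ X x U s \<in> I" "germ X x U t \<in> I"
    using not_invertible_in_maximal[OF U s s _ I] not_invertible_in_maximal[OF U t t _ I] n by auto
  then have "germ X x U (s \<oplus>\<^bsub>sec X U\<^esub> t) \<in> I" unfolding germ_add[OF U s t, symmetric] by simp
  then have "germ X x U (s \<oplus>\<^bsub>sec X U\<^esub> t) \<otimes>\<^bsub>stalk X x\<^esub> germ X x U c' \<in> I"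
    using germ_carrier[OF U c'(1)] I.I_r_closed by blast
  then have "\<one>\<^bsub>stalk X x\<^esub> \<in> I"
    using germ_mult[OF U _ c'(1), of "s \<oplus>\<^bsub>sec X U\<^esub> t"] germ_one[OF U s t] c' s t by simp
  then show False using I.one_imp_carrier I.I_notcarr by blast
qed

end

section \<open>The spectrum of a field\<close>

lemma Spec_simps [simp]: "topo (Spec R) = zariski R" "res (Spec R) U V s = restrict s V"
  "carrier (sec (Spec R) U) = spec_sections R U"
  by (simp_all add: Spec_def)

locale field_spectrum = field R for R :: "'a ring" (structure)
begin

abbreviation pt where "pt \<equiv> {\<zero>}"

lemma prime_iff: "primeideal p R \<longleftrightarrow> p = pt"
proof
  assume p: "primeideal p R"
  then have "p \<in> {I. ideal I R}" using primeideal.axioms(1) by blast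
  then show "p = pt" using all_ideals primeideal.I_notcarr[OF p] by auto
qed (use zeroprimeideal in simp)

lemma topspace_field: "topspace (zariski R) = {pt}"
  using topspace_zariski[OF is_cring] prime_iff by auto

lemma open_field: "openin (zariski R) U \<longleftrightarrow> U = {} \<or> U = {pt}"
proof
  assume "openin (zariski R) U"
  from openin_subset[OF this] show "U = {} \<or> U = {pt}" unfolding topspace_field by blast
next
  assume "U = {} \<or> U = {pt}"
  then show "openin (zariski R) U"
    using openin_empty[of "zariski R"] openin_topspace[of "zariski R"] unfolding topspace_field by metis
qed

lemma pt_localization: "prime_localization R pt"
  using zeroprimeideal by (simp add: prime_localization_def prime_localization_axioms_def is_cring)

lemma frac_pt: "a \<in> carrier R \<Longrightarrow> frac_at R pt a \<one> = {(e \<otimes> a, e) | e. e \<in> carrier R - pt}"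
proof -
  assume a: "a \<in> carrier R"
  interpret L: prime_localization R pt by (rule pt_localization)
  show ?thesis
  proof (intro Set.set_eqI)
    fix p :: "'a \<times> 'a"
    obtain b e where p: "p = (b, e)" by (cases p)
    have "(b, e) \<in> frac_at R pt a \<one> \<longleftrightarrow> e \<in> carrier R - pt \<and> b = e \<otimes> a"
    proof
      assume "(b, e) \<in> frac_at R pt a \<one>"
      then obtain u where b: "b \<in> carrier R" "e \<in> carrier R - pt" and u: "u \<in> carrier R - pt" "u \<otimes> (e \<otimes> a) = u \<otimes> (\<one> \<otimes> b)"
        unfolding L.frac_iff by blast
      then show "e \<in> carrier R - pt \<and> b = e \<otimes> a" using m_lcancel[of u "e \<otimes> a" b] a by auto
    next
      assume "e \<in> carrier R - pt \<and> b = e \<otimes> a"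
      then show "(b, e) \<in> frac_at R pt a \<one>" unfolding L.frac_iff using a L.one_D by auto
    qed
    then show "p \<in> frac_at R pt a \<one> \<longleftrightarrow> p \<in> {(e \<otimes> a, e) | e. e \<in> carrier R - pt}" unfolding p by auto
  qed
qed

lemma loc_pt_carrier: "carrier (loc_at R pt) = (\<lambda>a. frac_at R pt a \<one>) ` carrier R"
proof -
  interpret L: prime_localization R pt by (rule pt_localization)
  have "\<exists>c\<in>carrier R. frac_at R pt a d = frac_at R pt c \<one>" if a: "a \<in> carrier R" "d \<in> carrier R - pt" for a d
  proof -
    have d: "inv d \<in> carrier R" "d \<otimes> inv d = \<one>" using a(2) field_Units by auto
    have "d \<otimes> (inv d \<otimes> a) = (d \<otimes> inv d) \<otimes> a" using a d(1) by (simp add: m_assoc)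
    also have "\<dots> = a" using a(1) d(2) by simp
    finally have "(inv d \<otimes> a, \<one>) \<in> frac_at R pt a d"
      unfolding L.frac_iff using a d L.one_D by (auto intro!: bexI[of _ \<one>])
    from L.frac_eq[OF this a] show ?thesis using a d by blast
  qed
  then show ?thesis unfolding L.loc_carrier using L.one_D by blast
qed

text \<open>The isomorphism from the field to the global sections of its spectrum.\<close>

definition const_section :: "'a \<Rightarrow> 'a set \<Rightarrow> ('a \<times> 'a) set" where
  "const_section a = (\<lambda>p\<in>{pt}. frac_at R pt a \<one>)"

lemma spec_sections_pt: "spec_sections R {pt} = const_section ` carrier R"
proof
  show "spec_sections R {pt} \<subseteq> const_section ` carrier R"
  proof
    fix s assume "s \<in> spec_sections R {pt}"
    then have s: "s \<in> (\<Pi>\<^sub>E p\<in>{pt}. carrier (loc_at R p))" by (simp add: spec_sections_def)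
    then obtain a where a: "a \<in> carrier R" "s pt = frac_at R pt a \<one>" using loc_pt_carrier by (auto simp: PiE_def)
    then have "s = const_section a" using s unfolding const_section_def
      by (intro extensionalityI[of s "{pt}"]) (auto simp: PiE_def)
    then show "s \<in> const_section ` carrier R" using a by blast
  qed
  show "const_section ` carrier R \<subseteq> spec_sections R {pt}"
  proof
    fix s assume "s \<in> const_section ` carrier R"
    then obtain a where a: "a \<in> carrier R" "s = const_section a" by blast
    have "s \<in> (\<Pi>\<^sub>E p\<in>{pt}. carrier (loc_at R p))" unfolding a(2) const_section_def using loc_pt_carrier a(1) by auto
    moreover have "openin (zariski R) {pt}" using open_field by simp
    moreover have "\<forall>q\<in>{pt}. \<one> \<notin> q \<and> s q = frac_at R q a \<one>" unfolding a(2) const_section_def by simp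
    ultimately show "s \<in> spec_sections R {pt}" unfolding spec_sections_def using a(1) by blast
  qed
qed

abbreviation \<Gamma> where "\<Gamma> \<equiv> sec (Spec R) {pt}"

lemma const_section_iso: "const_section \<in> ring_iso R \<Gamma>"
  unfolding ring_iso_def bij_betw_def
proof (intro CollectI conjI)
  interpret L: prime_localization R pt by (rule pt_localization)
  show "const_section \<in> ring_hom R \<Gamma>"
  proof (rule ring_hom_memI)
    fix a assume a: "a \<in> carrier R"
    then show "const_section a \<in> carrier \<Gamma>" using spec_sections_pt by simp
    fix b assume b: "b \<in> carrier R"
    show "const_section (a \<otimes> b) = const_section a \<otimes>\<^bsub>\<Gamma>\<^esub> const_section b"
      using L.frac_mult[OF a L.one_D b L.one_D] by (simp add: Spec_def const_section_def fun_eq_iff)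
    have "frac_at R pt a \<one> \<oplus>\<^bsub>loc_at R pt\<^esub> frac_at R pt b \<one> =
      (\<Union>(a', d)\<in>frac_at R pt a \<one>. \<Union>(b', e)\<in>frac_at R pt b \<one>. frac_at R pt (e \<otimes> a' \<oplus> d \<otimes> b') (d \<otimes> e))"
      by (simp add: loc_ring_def Let_def)
    also have "\<dots> = frac_at R pt (a \<oplus> b) \<one>"
    proof (rule UN_pairs_const[OF L.frac_self[OF a L.one_D] L.frac_self[OF b L.one_D]])
      fix a' d b' e assume "(a', d) \<in> frac_at R pt a \<one>" "(b', e) \<in> frac_at R pt b \<one>"
      then have p: "a' = d \<otimes> a" "d \<in> L.D" and q: "b' = e \<otimes> b" "e \<in> L.D"
        unfolding frac_pt[OF a] frac_pt[OF b] by blast+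
      have c: "d \<in> carrier R" "e \<in> carrier R" using p q by auto
      have "frac_at R pt (a \<oplus> b) \<one> = frac_at R pt (e \<otimes> a' \<oplus> d \<otimes> b') (d \<otimes> e)"
      proof (rule L.frac_eq)
        have "e \<otimes> a' \<oplus> d \<otimes> b' = (d \<otimes> e) \<otimes> (a \<oplus> b)" using c a b p q by (simp add: r_distr m_ac)
        then show "(e \<otimes> a' \<oplus> d \<otimes> b', d \<otimes> e) \<in> frac_at R pt (a \<oplus> b) \<one>"
          unfolding frac_pt[OF a_closed[OF a b]] using L.D_closed[OF p(2) q(2)] by blast
      qed (use a b L.one_D in auto)
      then show "frac_at R pt (e \<otimes> a' \<oplus> d \<otimes> b') (d \<otimes> e) = frac_at R pt (a \<oplus> b) \<one>" by simp
    qed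
    finally show "const_section (a \<oplus> b) = const_section a \<oplus>\<^bsub>\<Gamma>\<^esub> const_section b"
      by (simp add: Spec_def const_section_def fun_eq_iff)
  next
    show "const_section \<one> = \<one>\<^bsub>\<Gamma>\<^esub>" by (simp add: Spec_def const_section_def L.loc_one fun_eq_iff)
  qed
  show "inj_on const_section (carrier R)"
  proof (rule inj_onI)
    fix a b assume a: "a \<in> carrier R" and b: "b \<in> carrier R" and e: "const_section a = const_section b"
    have "const_section a pt = const_section b pt" using e by simp
    then have "(\<one> \<otimes> a, \<one>) \<in> frac_at R pt b \<one>" using L.frac_self[OF a L.one_D] a by (simp add: const_section_def)
    then show "a = b" using a b unfolding frac_pt[OF b] by auto
  qed
qed (use spec_sections_pt in simp)

lemma \<Gamma>_field: "field \<Gamma>"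
proof -
  have z: "const_section \<zero> = \<zero>\<^bsub>\<Gamma>\<^esub>" by (simp add: Spec_def const_section_def loc_ring_def Let_def fun_eq_iff)
  have "field (\<Gamma>\<lparr>ring.zero := const_section \<zero>\<rparr>)" by (rule ring_iso_imp_img_field[OF const_section_iso])
  then show ?thesis unfolding z by simp
qed

lemma res_\<Gamma>: "s \<in> carrier \<Gamma> \<Longrightarrow> restrict s {pt} = s"
  using spec_sections_pt by (auto simp: const_section_def)

lemma germ_pt: 
  assumes s: "s \<in> carrier \<Gamma>" shows "germ (Spec R) pt {pt} s = {({pt}, s)}"
proof
  have o: "openin (zariski R) {pt}" using open_field by simp
  show "{({pt}, s)} \<subseteq> germ (Spec R) pt {pt} s" using s o unfolding germ_def by auto
  show "germ (Spec R) pt {pt} s \<subseteq> {({pt}, s)}"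
  proof
    fix p assume "p \<in> germ (Spec R) pt {pt} s"
    then obtain V t W where p: "p = (V, t)" "openin (zariski R) V" "pt \<in> V" "t \<in> spec_sections R V"
      "openin (zariski R) W" "pt \<in> W" "restrict s W = restrict t W" unfolding germ_def by auto
    then have "V = {pt}" "W = {pt}" using open_field by auto
    then show "p \<in> {({pt}, s)}" using p res_\<Gamma>[of s] res_\<Gamma>[of t] s by simp
  qed
qed

text \<open>The whole spectrum is the only neighbourhood of the point, so a germ is a single global section.\<close>

lemma stalk_pt_iso: "(\<lambda>s. {({pt}, s)}) \<in> ring_iso \<Gamma> (stalk (Spec R) pt)"
  and stalk_pt_zero: "\<zero>\<^bsub>stalk (Spec R) pt\<^esub> = {({pt}, \<zero>\<^bsub>\<Gamma>\<^esub>)}"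
proof -
  interpret G: field \<Gamma> by (rule \<Gamma>_field)
  let ?S = "stalk (Spec R) pt"
  have carr: "carrier ?S = (\<lambda>s. {({pt}, s)}) ` carrier \<Gamma>"
  proof
    show "carrier ?S \<subseteq> (\<lambda>s. {({pt}, s)}) ` carrier \<Gamma>"
    proof
      fix A assume "A \<in> carrier ?S"
      then obtain U s where U: "A = germ (Spec R) pt U s" "openin (zariski R) U" "pt \<in> U" "s \<in> spec_sections R U"
        unfolding stalk_def by auto
      then have "U = {pt}" using open_field by auto
      then show "A \<in> (\<lambda>s. {({pt}, s)}) ` carrier \<Gamma>" using U germ_pt[of s] by auto
    qed
    have o: "openin (zariski R) {pt}" using open_field by simp
    show "(\<lambda>s. {({pt}, s)}) ` carrier \<Gamma> \<subseteq> carrier ?S"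
    proof
      fix A assume "A \<in> (\<lambda>s. {({pt}, s)}) ` carrier \<Gamma>"
      then obtain s where s: "s \<in> carrier \<Gamma>" "A = germ (Spec R) pt {pt} s" using germ_pt by blast
      then show "A \<in> carrier ?S" unfolding stalk_def using o by auto
    qed
  qed
  show "\<zero>\<^bsub>?S\<^esub> = {({pt}, \<zero>\<^bsub>\<Gamma>\<^esub>)}" using germ_pt[OF G.zero_closed] by (simp add: stalk_def topspace_field)
  show "(\<lambda>s. {({pt}, s)}) \<in> ring_iso \<Gamma> ?S"
    unfolding ring_iso_def bij_betw_def
  proof (intro CollectI conjI)
    show "(\<lambda>s. {({pt}, s)}) \<in> ring_hom \<Gamma> ?S"
    proof (rule ring_hom_memI)
      fix s t assume s: "s \<in> carrier \<Gamma>" and t: "t \<in> carrier \<Gamma>"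
      show "{({pt}, s \<otimes>\<^bsub>\<Gamma>\<^esub> t)} = {({pt}, s)} \<otimes>\<^bsub>?S\<^esub> {({pt}, t)}"
        using germ_pt[of "s \<otimes>\<^bsub>\<Gamma>\<^esub> t"] G.m_closed[OF s t] res_\<Gamma>[OF s] res_\<Gamma>[OF t] by (simp add: stalk_def)
      show "{({pt}, s \<oplus>\<^bsub>\<Gamma>\<^esub> t)} = {({pt}, s)} \<oplus>\<^bsub>?S\<^esub> {({pt}, t)}"
        using germ_pt[of "s \<oplus>\<^bsub>\<Gamma>\<^esub> t"] G.a_closed[OF s t] res_\<Gamma>[OF s] res_\<Gamma>[OF t] by (simp add: stalk_def)
    next
      show "{({pt}, \<one>\<^bsub>\<Gamma>\<^esub>)} = \<one>\<^bsub>?S\<^esub>" using germ_pt[OF G.one_closed] by (simp add: stalk_def topspace_field)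
    qed (use carr in blast)
  qed (auto simp: inj_on_def carr)
qed

lemma stalk_pt_maximal: "maximalideal {\<zero>\<^bsub>stalk (Spec R) pt\<^esub>} (stalk (Spec R) pt)"
proof -
  interpret G: field \<Gamma> by (rule \<Gamma>_field)
  let ?S = "stalk (Spec R) pt"
  have "field (?S\<lparr>ring.zero := {({pt}, \<zero>\<^bsub>\<Gamma>\<^esub>)}\<rparr>)" by (rule G.ring_iso_imp_img_field[OF stalk_pt_iso])
  then have "field ?S" unfolding stalk_pt_zero[symmetric] by simp
  then show ?thesis by (rule field.zeromaximalideal)
qed

lemma sections_empty: "s \<in> carrier (sec (Spec R) {}) \<Longrightarrow> t \<in> carrier (sec (Spec R) {}) \<Longrightarrow> s = t"
  by (simp add: spec_sections_def)

end

section \<open>Rational points of schemes\<close>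

lemma lrs_morphismD:
  assumes "lrs_morphism X Y (f, fs)"
  shows "continuous_map (topo X) (topo Y) f" "f \<in> extensional (topspace (topo X))"
    "fs \<in> extensional {V. openin (topo Y) V}"
    "openin (topo Y) V \<Longrightarrow> fs V \<in> ring_hom (sec Y V) (sec X (preim X f V))"
    "openin (topo Y) V \<Longrightarrow> fs V \<in> extensional (carrier (sec Y V))"
    "openin (topo Y) U \<Longrightarrow> openin (topo Y) V \<Longrightarrow> V \<subseteq> U \<Longrightarrow> s \<in> carrier (sec Y U) \<Longrightarrow>
      fs V (res Y U V s) = res X (preim X f U) (preim X f V) (fs U s)"
    "x \<in> topspace (topo X) \<Longrightarrow> maximalideal I (stalk Y (f x)) \<Longrightarrow> maximalideal J (stalk X x) \<Longrightarrow>
      stalk_map X (f, fs) x ` I \<subseteq> J"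
  using assms unfolding lrs_morphism_def split_conv by (elim conjE, simp)+

locale scheme_over_field = K: field_spectrum K + local_space X
  for K :: "'k ring" and X :: "('x, 'o) ringed_space" +
  fixes p :: "'x \<Rightarrow> 'k set" and ps :: "'k set set \<Rightarrow> ('k set \<Rightarrow> ('k \<times> 'k) set) \<Rightarrow> 'o"
  assumes structure_map: "lrs_morphism X (Spec K) (p, ps)"
begin

abbreviation "T \<equiv> topspace (topo X)"
abbreviation "\<Gamma> \<equiv> K.\<Gamma>"
abbreviation "pt \<equiv> K.pt"

lemma pt_open: "openin (topo (Spec K)) {pt}" using K.open_field by simp

lemma preim_structure: "preim X p {pt} = T"
proof -
  have "p ` T \<subseteq> topspace (zariski K)"
    using continuous_map_image_subset_topspace[OF lrs_morphismD(1)[OF structure_map]] by simp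
  then show ?thesis unfolding K.topspace_field by auto
qed

text \<open>The global sections of \<open>Spec K\<close> are the scalars. The structure map turns them into functions on \<open>X\<close>.\<close>

definition const_on :: "'x set \<Rightarrow> ('k set \<Rightarrow> ('k \<times> 'k) set) \<Rightarrow> 'o" where
  "const_on V l = res X T V (ps {pt} l)"

lemma const_on_hom:
  assumes V: "openin (topo X) V" shows "const_on V \<in> ring_hom \<Gamma> (sec X V)"
proof -
  have 1: "ps {pt} \<in> ring_hom \<Gamma> (sec X T)"
    using lrs_morphismD(4)[OF structure_map pt_open] unfolding preim_structure .
  have 2: "res X T V \<in> ring_hom (sec X T) (sec X V)" using res_hom[OF openin_topspace V openin_subset[OF V]] .
  show ?thesis
    by (rule ring_hom_memI)
      (simp_all add: const_on_def ring_hom_closed[OF 1] ring_hom_closed[OF 2] ring_hom_mult[OF 1] ring_hom_mult[OF 2]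
        ring_hom_add[OF 1] ring_hom_add[OF 2] ring_hom_one[OF 1] ring_hom_one[OF 2] del: Spec_simps)
qed

context
  fixes f fs
  assumes g: "(f, fs) \<in> functor_of_points K X (p, ps) (K, id)"
begin

lemma point_morphism: "lrs_morphism (Spec K) X (f, fs)"
  and point_over: "lrs_comp (Spec K) X (Spec K) (p, ps) (f, fs) = Spec_map K K id"
  using g by (simp_all add: functor_of_points_def)

lemma image_in_space: "f pt \<in> T"
  using continuous_map_image_subset_topspace[OF lrs_morphismD(1)[OF point_morphism]] K.topspace_field by auto

lemma preim_point: "f pt \<in> V \<Longrightarrow> preim (Spec K) f V = {pt}"
  using K.topspace_field by auto

lemma preim_point_empty: "f pt \<notin> V \<Longrightarrow> preim (Spec K) f V = {}"
  using K.topspace_field by auto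

lemma point_hom: "openin (topo X) V \<Longrightarrow> f pt \<in> V \<Longrightarrow> fs V \<in> ring_hom (sec X V) \<Gamma>"
  using lrs_morphismD(4)[OF point_morphism, of V] preim_point[of V] by simp

lemma point_res:
  assumes "openin (topo X) U" "openin (topo X) V" "V \<subseteq> U" "f pt \<in> V" "s \<in> carrier (sec X U)"
  shows "fs V (res X U V s) = fs U s"
proof -
  have U: "f pt \<in> U" using assms by auto
  have "fs V (res X U V s) = res (Spec K) {pt} {pt} (fs U s)"
    using lrs_morphismD(6)[OF point_morphism assms(1,2,3,5)] unfolding preim_point[OF assms(4)] preim_point[OF U] .
  moreover have "fs U s \<in> carrier \<Gamma>" using ring_hom_closed[OF point_hom[OF assms(1) U] assms(5)] .
  ultimately show ?thesis using K.res_\<Gamma> by simp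
qed

lemma point_const:
  assumes V: "openin (topo X) V" "f pt \<in> V" and l: "l \<in> carrier \<Gamma>"
  shows "fs V (const_on V l) = l"
proof -
  have lc: "l \<in> spec_sections K {pt}" using l by simp
  have c: "ps {pt} l \<in> carrier (sec X T)"
    using ring_hom_closed[OF lrs_morphismD(4)[OF structure_map pt_open] l] unfolding preim_structure .
  have "fs V (const_on V l) = fs T (ps {pt} l)"
    unfolding const_on_def using point_res[OF openin_topspace V(1) openin_subset[OF V(1)] V(2) c] .
  also have "\<dots> = snd (lrs_comp (Spec K) X (Spec K) (p, ps) (f, fs)) {pt} l"
    using lc K.open_field preim_structure by (simp add: lrs_comp_def)
  also have "\<dots> = snd (Spec_map K K id) {pt} l" unfolding point_over ..
  also have "\<dots> = l"
  proof -
    define F where "F = (\<lambda>q\<in>{q. primeideal q K}. {a \<in> carrier K. id a \<in> q})"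
    have F: "F pt = pt" using K.zeroprimeideal by (auto simp: F_def)
    have pre: "preim (Spec K) F {pt} = {pt}" using F K.topspace_field by auto
    have e: "Spec_map K K id = (F, \<lambda>V\<in>{V. openin (zariski K) V}. \<lambda>s\<in>spec_sections K V.
        \<lambda>q\<in>preim (Spec K) F V. \<Union>(a, b)\<in>s (F q). frac_at K q (id a) (id b))"
      by (simp only: Spec_map_def Let_def F_def)
    have "snd (Spec_map K K id) {pt} l =
        (\<lambda>q\<in>preim (Spec K) F {pt}. \<Union>(a, b)\<in>l (F q). frac_at K q (id a) (id b))"
      unfolding e snd_conv
      by (subst restrict_apply', simp add: K.open_field, subst restrict_apply', rule lc, rule refl)
    then have "snd (Spec_map K K id) {pt} l = (\<lambda>q\<in>{pt}. \<Union>(a, b)\<in>l (F q). frac_at K q a b)"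
      unfolding pre id_apply .
    moreover have "(\<Union>(a, b)\<in>l pt. frac_at K pt a b) = l pt"
    proof -
      interpret L: prime_localization K pt by (rule K.pt_localization)
      obtain a where a: "a \<in> carrier K" "l = K.const_section a" using lc K.spec_sections_pt by auto
      then have lp: "l pt = frac_at K pt a \<one>\<^bsub>K\<^esub>" by (simp add: K.const_section_def)
      have "(\<Union>(b, e)\<in>l pt. frac_at K pt b e) = (\<Union>q\<in>l pt. l pt)"
        using L.frac_eq[OF _ a(1) L.one_D] unfolding lp by (intro SUP_cong refl) auto
      then show ?thesis using L.frac_self[OF a(1) L.one_D] unfolding lp by auto
    qed
    ultimately have "snd (Spec_map K K id) {pt} l = (\<lambda>q\<in>{pt}. l q)"
      using F by (simp only:) (rule restrict_ext, simp only: singleton_iff)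
    then show ?thesis using K.res_\<Gamma>[OF l] by simp
  qed
  finally show ?thesis .
qed

text \<open>This is locality: the germ of \<open>s\<close> lies in the maximal ideal of the stalk, which is mapped into the
  maximal ideal of a field.\<close>

lemma not_invertible_pullback:
  assumes V: "openin (topo X) V" "f pt \<in> V" and s: "s \<in> carrier (sec X V)"
    and n: "\<not> invertible_near X (f pt) V s"
  shows "fs V s = \<zero>\<^bsub>\<Gamma>\<^esub>"
proof -
  interpret G: field \<Gamma> by (rule K.\<Gamma>_field)
  obtain I where I: "maximalideal I (stalk X (f pt))"
    using stalk_local[OF image_in_space] unfolding local_ring_def by blast
  have "germ X (f pt) V s \<in> I" using not_invertible_in_maximal[OF V s s n I] .
  then have "stalk_map (Spec K) (f, fs) pt (germ X (f pt) V s) \<in> {\<zero>\<^bsub>stalk (Spec K) pt\<^esub>}"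
    using lrs_morphismD(7)[OF point_morphism _ I K.stalk_pt_maximal] K.topspace_field by auto
  moreover have "({pt}, fs V s) \<in> stalk_map (Spec K) (f, fs) pt (germ X (f pt) V s)"
  proof -
    have "fs V s \<in> carrier \<Gamma>" using ring_hom_closed[OF point_hom[OF V] s] .
    then have "({pt}, fs V s) \<in> germ (Spec K) pt (preim (Spec K) f V) (fs V s)"
      unfolding preim_point[OF V(2)] using K.germ_pt by blast
    then show ?thesis unfolding stalk_map_def split_conv using germ_self[OF V s] by blast
  qed
  ultimately show ?thesis unfolding K.stalk_pt_zero by simp
qed

lemma invertible_pullback:
  assumes V: "openin (topo X) V" "f pt \<in> V" and s: "s \<in> carrier (sec X V)"
    and n: "invertible_near X (f pt) V s"
  shows "fs V s \<noteq> \<zero>\<^bsub>\<Gamma>\<^esub>"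
proof
  assume z: "fs V s = \<zero>\<^bsub>\<Gamma>\<^esub>"
  interpret G: field \<Gamma> by (rule K.\<Gamma>_field)
  obtain W t where W: "openin (topo X) W" "f pt \<in> W" "W \<subseteq> V" "t \<in> carrier (sec X W)"
    "res X V W s \<otimes>\<^bsub>sec X W\<^esub> t = \<one>\<^bsub>sec X W\<^esub>" using n unfolding invertible_near_def by blast
  note h = point_hom[OF W(1,2)]
  have r: "res X V W s \<in> carrier (sec X W)" using ring_hom_closed[OF res_hom[OF V(1) W(1,3)] s] .
  have "\<one>\<^bsub>\<Gamma>\<^esub> = fs W (res X V W s) \<otimes>\<^bsub>\<Gamma>\<^esub> fs W t"
    using ring_hom_mult[OF h r W(4)] ring_hom_one[OF h] W(5) by simp
  also have "fs W (res X V W s) = \<zero>\<^bsub>\<Gamma>\<^esub>" using point_res[OF V(1) W(1,3,2) s] z by simp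
  finally show False using ring_hom_closed[OF h W(4)] G.one_not_zero by simp
qed

end

text \<open>Every section is the sum of a constant and of a section that vanishes at the point. Both morphisms
  pull back the constant to itself and the vanishing section to zero, because it only depends on the
  image point whether a section vanishes there.\<close>

lemma rational_point_determined:
  assumes g: "g \<in> functor_of_points K X (p, ps) (K, id)" and g': "g' \<in> functor_of_points K X (p, ps) (K, id)"
    and eq: "fst g pt = fst g' pt"
  shows "g = g'"
proof -
  interpret G: field \<Gamma> by (rule K.\<Gamma>_field)
  obtain f fs f' fs' where gf: "g = (f, fs)" "g' = (f', fs')" by (metis surj_pair)
  note P = g[unfolded gf] and P' = g'[unfolded gf]
  note m = point_morphism[OF P] and m' = point_morphism[OF P']
  have x: "f' pt = f pt" using eq gf by simp
  have "f = f'"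
    using lrs_morphismD(2)[OF m] lrs_morphismD(2)[OF m'] x
    by (intro extensionalityI[of f "{pt}"]) (auto simp: K.topspace_field)
  moreover have "fs V s = fs' V s" if V: "openin (topo X) V" and s: "s \<in> carrier (sec X V)" for V s
  proof (cases "f pt \<in> V")
    case True
    interpret S: cring "sec X V" using sec_cring[OF V] .
    define l where "l = fs V s"
    note h = point_hom[OF P V True] and h' = point_hom[OF P' V, unfolded x, OF True]
    have l: "l \<in> carrier \<Gamma>" unfolding l_def using ring_hom_closed[OF h s] .
    have c: "const_on V l \<in> carrier (sec X V)" using ring_hom_closed[OF const_on_hom[OF V] l] .
    define t where "t = s \<ominus>\<^bsub>sec X V\<^esub> const_on V l"
    have t: "t \<in> carrier (sec X V)" "s = t \<oplus>\<^bsub>sec X V\<^esub> const_on V l"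
      using s c by (simp_all add: t_def a_minus_def S.a_assoc S.l_neg)
    have "l = fs V (t \<oplus>\<^bsub>sec X V\<^esub> const_on V l)" unfolding t(2)[symmetric] by (rule l_def)
    also have "\<dots> = fs V t \<oplus>\<^bsub>\<Gamma>\<^esub> fs V (const_on V l)" by (rule ring_hom_add[OF h t(1) c])
    also have "fs V (const_on V l) = l" by (rule point_const[OF P V True l])
    finally have "fs V t = \<zero>\<^bsub>\<Gamma>\<^esub>" using G.add.r_cancel_one'[OF l ring_hom_closed[OF h t(1)]] by simp
    then have "\<not> invertible_near X (f pt) V t" using invertible_pullback[OF P V True t(1)] by blast
    then have "fs' V t = \<zero>\<^bsub>\<Gamma>\<^esub>" using not_invertible_pullback[OF P' V _ t(1), unfolded x, OF True] by blast
    have "fs' V s = fs' V (t \<oplus>\<^bsub>sec X V\<^esub> const_on V l)" by (rule arg_cong[OF t(2)])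
    also have "\<dots> = fs' V t \<oplus>\<^bsub>\<Gamma>\<^esub> fs' V (const_on V l)" by (rule ring_hom_add[OF h' t(1) c])
    also have "\<dots> = l"
      using \<open>fs' V t = \<zero>\<^bsub>\<Gamma>\<^esub>\<close> point_const[OF P' V _ l, unfolded x, OF True] l by simp
    finally show ?thesis by (simp only: l_def)
  next
    case False
    then have pre: "preim (Spec K) f V = {}" "preim (Spec K) f' V = {}"
      using preim_point_empty[OF P] preim_point_empty[OF P'] x by auto
    have "fs V \<in> ring_hom (sec X V) (sec (Spec K) {})" "fs' V \<in> ring_hom (sec X V) (sec (Spec K) {})"
      using lrs_morphismD(4)[OF m V] lrs_morphismD(4)[OF m' V] unfolding pre .
    from this[THEN ring_hom_closed[OF _ s]]
    have "fs V s \<in> carrier (sec (Spec K) {})" "fs' V s \<in> carrier (sec (Spec K) {})" .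
    then show ?thesis by (rule K.sections_empty)
  qed
  then have "fs V = fs' V" if "openin (topo X) V" for V
    using lrs_morphismD(5)[OF m that] lrs_morphismD(5)[OF m' that] that
    by (intro extensionalityI[of "fs V" "carrier (sec X V)"]) auto
  then have "fs = fs'"
    using lrs_morphismD(3)[OF m] lrs_morphismD(3)[OF m']
    by (intro extensionalityI[of fs "{V. openin (topo X) V}"]) auto
  ultimately show ?thesis by (simp add: gf)
qed

end

lemma fraction_in_sections:
  assumes A: "cring A" and V: "openin (zariski A) V" and a: "a \<in> carrier A" "d \<in> carrier A"
    and d: "\<And>q. q \<in> V \<Longrightarrow> d \<notin> q"
  shows "(\<lambda>r\<in>V. frac_at A r a d) \<in> spec_sections A V"
  unfolding spec_sections_def
proof (intro CollectI conjI ballI)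
  have "frac_at A r a d \<in> carrier (loc_at A r)" if "r \<in> V" for r
  proof -
    have "primeideal r A" using openin_subset[OF V] that unfolding topspace_zariski[OF A] by blast
    then interpret prime_localization A r
      using A by (simp add: prime_localization_def prime_localization_axioms_def)
    show ?thesis unfolding loc_carrier using a d[OF that] by blast
  qed
  then show "(\<lambda>r\<in>V. frac_at A r a d) \<in> (\<Pi>\<^sub>E p\<in>V. carrier (loc_at A p))" by (simp only: restrict_PiE_iff) blast
  fix r assume r: "r \<in> V"
  show "\<exists>W. openin (zariski A) W \<and> r \<in> W \<and> W \<subseteq> V \<and>
     (\<exists>b\<in>carrier A. \<exists>f\<in>carrier A. \<forall>q\<in>W. f \<notin> q \<and> (\<lambda>r\<in>V. frac_at A r a d) q = frac_at A q b f)"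
    by (intro exI[of _ V] conjI bexI[of _ a] bexI[of _ d] ballI) (use r a d V in simp_all)
qed

text \<open>Two different primes are distinguished by an element \<open>a\<close> of the ring that lies in one of them only,
  and the section \<open>a\<close> is invertible near a prime exactly if the prime does not contain \<open>a\<close>.\<close>

lemma affine_separates:
  assumes X: "locally_ringed_space X" and U: "openin (topo X) U" and A: "cring A"
    and iso: "lrs_isomorphic (open_subspace X U) (Spec A)"
    and xy: "x \<in> U" "y \<in> U" "x \<noteq> y"
  shows "\<exists>s\<in>carrier (sec X U). invertible_near X x U s \<noteq> invertible_near X y U s"
proof -
  interpret local_space X using X by (simp add: local_space_def)
  interpret A: cring A by fact
  let ?Y = "open_subspace X U"
  obtain f fs g gs where m: "lrs_morphism ?Y (Spec A) (f, fs)" and n: "lrs_morphism (Spec A) ?Y (g, gs)"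
    and gf: "lrs_comp ?Y (Spec A) ?Y (g, gs) (f, fs) = lrs_id ?Y"
    and fg: "lrs_comp (Spec A) ?Y (Spec A) (f, fs) (g, gs) = lrs_id (Spec A)"
    using iso unfolding lrs_isomorphic_def by (metis surj_pair)
  let ?T = "topspace (zariski A)"
  have T: "?T = {r. primeideal r A}" using topspace_zariski[OF A] .
  have topY: "topo ?Y = subtopology (topo X) U" "sec ?Y = sec X" "res ?Y = res X"
    by (simp_all add: open_subspace_def)
  have tY: "topspace (topo ?Y) = U" using topY openin_subset[OF U] by auto
  have oY: "openin (topo ?Y) W \<longleftrightarrow> openin (topo X) W \<and> W \<subseteq> U" for W
    using openin_open_subtopology[OF U] topY by auto
  have fT: "f z \<in> ?T" if "z \<in> U" for z
    using continuous_map_image_subset_topspace[OF lrs_morphismD(1)[OF m]] that unfolding tY by auto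
  have gfz: "g (f z) = z" if "z \<in> U" for z
    using fun_cong[OF arg_cong[OF gf, of fst], of z] that unfolding lrs_comp_def lrs_id_def by (simp add: tY)
  have preT: "preim ?Y f ?T = U" using fT tY by auto
  have key: "\<exists>s\<in>carrier (sec X U). \<forall>z\<in>U. invertible_near X z U s \<longleftrightarrow> a \<notin> f z" if a: "a \<in> carrier A" for a
  proof -
    define \<sigma> where "\<sigma> = (\<lambda>r\<in>?T. frac_at A r a \<one>\<^bsub>A\<^esub>)"
    have L: "prime_localization A r" if "r \<in> ?T" for r
      using that T A by (simp add: prime_localization_def prime_localization_axioms_def)
    have one: "\<one>\<^bsub>A\<^esub> \<notin> q" if "q \<in> ?T" for q using prime_localization.one_D[OF L[OF that]] by simp
    have \<sigma>: "\<sigma> \<in> spec_sections A ?T"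
      unfolding \<sigma>_def by (rule fraction_in_sections[OF A _ a A.one_closed one]) auto
    have oT: "openin (topo (Spec A)) ?T" by simp
    have hT: "fs ?T \<in> ring_hom (sec (Spec A) ?T) (sec X U)"
      using lrs_morphismD(4)[OF m oT] unfolding preT unfolding topY .
    define s where "s = fs ?T \<sigma>"
    have s: "s \<in> carrier (sec X U)"
      using ring_hom_closed[OF hT, of \<sigma>] \<sigma> unfolding s_def by simp
    have "invertible_near X z U s \<longleftrightarrow> a \<notin> f z" if z: "z \<in> U" for z
    proof
      assume af: "a \<notin> f z"
      let ?D = "{r. primeideal r A \<and> a \<notin> r}"
      have D: "openin (topo (Spec A)) ?D" "?D \<subseteq> ?T" using basic_open[OF a] T by auto
      define \<tau> where "\<tau> = (\<lambda>r\<in>?D. frac_at A r \<one>\<^bsub>A\<^esub> a)"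
      have D': "openin (zariski A) ?D" using D(1) by simp
      have \<tau>: "\<tau> \<in> spec_sections A ?D"
        unfolding \<tau>_def by (rule fraction_in_sections[OF A D' A.one_closed a]) simp
      let ?W = "preim ?Y f ?D"
      have hD: "fs ?D \<in> ring_hom (sec (Spec A) ?D) (sec X ?W)"
        using lrs_morphismD(4)[OF m D(1)] unfolding topY .
      have "openin (topo ?Y) ?W"
        using openin_continuous_map_preimage[OF lrs_morphismD(1)[OF m] D(1)] .
      then have W: "openin (topo X) ?W" "?W \<subseteq> U" using oY by auto
      have r\<sigma>: "restrict \<sigma> ?D \<in> spec_sections A ?D"
      proof -
        have "restrict \<sigma> ?D = (\<lambda>r\<in>?D. frac_at A r a \<one>\<^bsub>A\<^esub>)" 
          unfolding \<sigma>_def by (intro restrict_ext restrict_apply' subsetD[OF D(2)])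
        then show ?thesis
          using fraction_in_sections[OF A D' a A.one_closed] one D(2) by (metis (no_types, lifting) subsetD)
      qed
      have "restrict \<sigma> ?D \<otimes>\<^bsub>sec (Spec A) ?D\<^esub> \<tau> = \<one>\<^bsub>sec (Spec A) ?D\<^esub>"
      proof -
        have "\<sigma> r \<otimes>\<^bsub>loc_at A r\<^esub> \<tau> r = \<one>\<^bsub>loc_at A r\<^esub>" if "r \<in> ?D" for r
          using prime_localization.frac_inverse[OF L[OF subsetD[OF D(2) that]], of a] that a D(2)
          by (auto simp: \<sigma>_def \<tau>_def)
        then show ?thesis by (auto simp: Spec_def fun_eq_iff)
      qed
      then have "fs ?D (restrict \<sigma> ?D) \<otimes>\<^bsub>sec X ?W\<^esub> fs ?D \<tau> = \<one>\<^bsub>sec X ?W\<^esub>"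
        using ring_hom_mult[OF hD, of "restrict \<sigma> ?D" \<tau>] ring_hom_one[OF hD] r\<sigma> \<tau> by simp
      moreover have "fs ?D (restrict \<sigma> ?D) = res X U ?W s"
      proof -
        have \<sigma>c: "\<sigma> \<in> carrier (sec (Spec A) ?T)" using \<sigma> by simp
        have "fs ?D (res (Spec A) ?T ?D \<sigma>) = res X U ?W (fs ?T \<sigma>)"
          using lrs_morphismD(6)[OF m oT D \<sigma>c] unfolding preT unfolding topY .
        then show ?thesis by (simp only: s_def Spec_simps)
      qed
      moreover have "fs ?D \<tau> \<in> carrier (sec X ?W)" using ring_hom_closed[OF hD, of \<tau>] \<tau> by simp
      moreover have "z \<in> ?W" using z af fT[OF z] T tY by auto
      ultimately show "invertible_near X z U s" unfolding invertible_near_def using W by auto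
    next
      assume "invertible_near X z U s"
      then obtain W t where W: "openin (topo X) W" "z \<in> W" "W \<subseteq> U" "t \<in> carrier (sec X W)"
        "res X U W s \<otimes>\<^bsub>sec X W\<^esub> t = \<one>\<^bsub>sec X W\<^esub>" unfolding invertible_near_def by blast
      have WY: "openin (topo ?Y) W" and UY: "openin (topo ?Y) U" using oY W U by auto
      let ?W = "preim (Spec A) g W"
      have hW: "gs W \<in> ring_hom (sec X W) (sec (Spec A) ?W)" using lrs_morphismD(4)[OF n WY] unfolding topY .
      have r: "res X U W s \<in> carrier (sec X W)" using ring_hom_closed[OF res_hom[OF U W(1,3)] s] .
      have "gs W (res X U W s) = restrict (gs U s) ?W"
        using lrs_morphismD(6)[OF n UY WY W(3), of s] s unfolding topY by simp
      also have "gs U s = \<sigma>"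
      proof -
        have "snd (lrs_comp (Spec A) ?Y (Spec A) (f, fs) (g, gs)) ?T \<sigma> = gs U (fs ?T \<sigma>)"
          using \<sigma> preT by (simp add: lrs_comp_def)
        moreover have "snd (lrs_id (Spec A)) ?T \<sigma> = \<sigma>" using \<sigma> by (simp add: lrs_id_def)
        ultimately show ?thesis unfolding fg s_def by simp
      qed
      finally have e: "restrict \<sigma> ?W \<otimes>\<^bsub>sec (Spec A) ?W\<^esub> gs W t = \<one>\<^bsub>sec (Spec A) ?W\<^esub>"
        using ring_hom_mult[OF hW r W(4)] ring_hom_one[OF hW] unfolding W(5) by argo
      have fz: "f z \<in> ?W" using fT[OF z] gfz[OF z] W(2) by simp
      have "(restrict \<sigma> ?W \<otimes>\<^bsub>sec (Spec A) ?W\<^esub> gs W t) (f z) = \<one>\<^bsub>sec (Spec A) ?W\<^esub> (f z)" using e by simp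
      then have e2: "\<sigma> (f z) \<otimes>\<^bsub>loc_at A (f z)\<^esub> gs W t (f z) = \<one>\<^bsub>loc_at A (f z)\<^esub>"
        using fz by (simp add: Spec_def)
      have "gs W t \<in> spec_sections A ?W" using ring_hom_closed[OF hW W(4)] by simp
      then have "gs W t \<in> (\<Pi>\<^sub>E p\<in>?W. carrier (loc_at A p))" by (simp add: spec_sections_def)
      then have "gs W t (f z) \<in> carrier (loc_at A (f z))" using fz by (rule PiE_mem)
      then show "a \<notin> f z"
        using prime_localization.frac_not_invertible[OF L[OF fT[OF z]], of a "gs W t (f z)"] e2 fT[OF z]
        by (auto simp: \<sigma>_def)
    qed
    then show ?thesis using s by blast
  qed
  have "f x \<noteq> f y" using gfz xy by metis
  moreover have "f z \<subseteq> carrier A" if z: "z \<in> U" for z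
  proof -
    have "primeideal (f z) A" using fT[OF z] unfolding T by simp
    from ideal.Icarr[OF primeideal.axioms(1)[OF this]] show ?thesis by (rule subsetI)
  qed
  from this[OF xy(1)] this[OF xy(2)] calculation
  obtain a where a: "a \<in> carrier A" "(a \<in> f x) \<noteq> (a \<in> f y)" by blast
  obtain s where s: "s \<in> carrier (sec X U)" "\<And>z. z \<in> U \<Longrightarrow> invertible_near X z U s \<longleftrightarrow> a \<notin> f z"
    using key[OF a(1)] by metis
  show ?thesis using a(2) s(2)[OF xy(1)] s(2)[OF xy(2)] by (intro bexI[OF _ s(1)]) argo
qed

text \<open>Let \<open>y \<noteq> x\<close> lie in an affine neighbourhood of a rational point \<open>x\<close>, and let \<open>s\<close> distinguish them. If \<open>s\<close>
  vanishes at \<open>x\<close> but not at \<open>y\<close>, then \<open>y\<close> has a neighbourhood without \<open>x\<close>. Otherwise the same holds for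
  \<open>c - s\<close>, where \<open>c\<close> is the constant with the value of \<open>s\<close> at \<open>x\<close>: it vanishes at \<open>x\<close>, and at \<open>y\<close> it is
  the difference of a unit and a non-unit.\<close>

lemma (in scheme_over_field) rational_point_closed:
  assumes g: "g \<in> functor_of_points K X (p, ps) (K, id)" and X: "scheme X"
  shows "fst g pt \<in> closed_points X"
proof -
  interpret G: field \<Gamma> by (rule K.\<Gamma>_field)
  obtain f fs where gf: "g = (f, fs)" by (metis surj_pair)
  note P = g[unfolded gf]
  let ?x = "f pt"
  have x: "?x \<in> T" using image_in_space[OF P] .
  have "\<exists>W. openin (topo X) W \<and> y \<in> W \<and> W \<subseteq> T - {?x}" if y: "y \<in> T - {?x}" for y
  proof -
    have "y \<in> topspace (topo X)" using y by blast
    then obtain U A where U: "openin (topo X) U" "y \<in> U" and A: "cring (A :: 'o ring)"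
      "lrs_isomorphic (open_subspace X U) (Spec A)"
      using X unfolding scheme_def by blast
    have sep: "\<exists>W. openin (topo X) W \<and> y \<in> W \<and> W \<subseteq> T - {?x}"
      if s: "invertible_near X y U s" "\<not> invertible_near X ?x U s" for s
    proof -
      obtain W t where W: "openin (topo X) W" "y \<in> W" "W \<subseteq> U" "t \<in> carrier (sec X W)"
        "res X U W s \<otimes>\<^bsub>sec X W\<^esub> t = \<one>\<^bsub>sec X W\<^esub>" using s(1) unfolding invertible_near_def by blast
      then have "?x \<notin> W" using s(2) unfolding invertible_near_def by blast
      then show ?thesis using W openin_subset[OF W(1)] by blast
    qed
    show ?thesis
    proof (cases "?x \<in> U")
      case False
      then show ?thesis using U openin_subset[OF U(1)] by blast
    next
      case True
      obtain s where s: "s \<in> carrier (sec X U)" "invertible_near X ?x U s \<noteq> invertible_near X y U s"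
        using affine_separates[OF lrs U(1) A True U(2)] y by blast
      show ?thesis
      proof (cases "invertible_near X y U s")
        case True
        then show ?thesis using sep s(2) by blast
      next
        case False
        then have sx: "invertible_near X ?x U s" using s(2) by blast
        interpret S: cring "sec X U" using sec_cring[OF U(1)] .
        define l where "l = fs U s"
        note h = point_hom[OF P U(1) True] and c = const_on_hom[OF U(1)]
        have l: "l \<in> carrier \<Gamma>" "l \<noteq> \<zero>\<^bsub>\<Gamma>\<^esub>"
          unfolding l_def using ring_hom_closed[OF h s(1)] invertible_pullback[OF P U(1) True s(1) sx] by auto
        then have il: "inv\<^bsub>\<Gamma>\<^esub> l \<in> carrier \<Gamma>" "l \<otimes>\<^bsub>\<Gamma>\<^esub> inv\<^bsub>\<Gamma>\<^esub> l = \<one>\<^bsub>\<Gamma>\<^esub>" using G.field_Units by auto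
        have cl: "const_on U l \<in> carrier (sec X U)" using ring_hom_closed[OF c l(1)] .
        define t where "t = const_on U l \<ominus>\<^bsub>sec X U\<^esub> s"
        have t: "t \<in> carrier (sec X U)" "s \<oplus>\<^bsub>sec X U\<^esub> t = const_on U l"
          using s(1) cl by (simp_all add: t_def a_minus_def S.a_comm[of "const_on U l"] S.r_neg1 S.r_neg2)
        have "l = fs U (s \<oplus>\<^bsub>sec X U\<^esub> t)" unfolding t(2) by (rule point_const[OF P U(1) True l(1), symmetric])
        then have "l = l \<oplus>\<^bsub>\<Gamma>\<^esub> fs U t" unfolding ring_hom_add[OF h s(1) t(1)] l_def[symmetric] .
        then have "fs U t = \<zero>\<^bsub>\<Gamma>\<^esub>" using G.add.l_cancel_one'[OF l(1) ring_hom_closed[OF h t(1)]] by simp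
        then have tx: "\<not> invertible_near X ?x U t" using invertible_pullback[OF P U(1) True t(1)] by blast
        have "(s \<oplus>\<^bsub>sec X U\<^esub> t) \<otimes>\<^bsub>sec X U\<^esub> const_on U (inv\<^bsub>\<Gamma>\<^esub> l) = \<one>\<^bsub>sec X U\<^esub>"
          unfolding t(2) using ring_hom_mult[OF c l(1) il(1)] ring_hom_one[OF c] il(2) by simp
        from invertible_near_sum[OF U s(1) t(1) ring_hom_closed[OF c il(1)] this]
        have "invertible_near X y U t" using False by blast
        then show ?thesis using sep tx by blast
      qed
    qed
  qed
  then have "openin (topo X) (T - {?x})" by (subst openin_subopen) blast
  then have "closedin (topo X) {?x}" using x by (simp add: closedin_def)
  then show ?thesis using x by (simp add: closed_points_def gf)
qed

section \<open>The two injections\<close>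

text \<open>\<open>E\<close>, which stands for \<open>Gr(M) \<cong> Gr(N)\<close>, is coarser than \<open>I\<close>. Hence all members of an \<open>I\<close>-class are related by
  \<open>E\<close>, and any of them can represent an element of the iterated quotient.\<close>

lemma quotient_representatives:
  fixes A :: "'a set" and I E :: "'a \<Rightarrow> 'a \<Rightarrow> bool"
  defines "P \<equiv> A // {(M, N). M \<in> A \<and> N \<in> A \<and> I M N}"
  defines "s \<equiv> {(c, c'). c \<in> P \<and> c' \<in> P \<and> (\<exists>M\<in>c. \<exists>M'\<in>c'. E M M')}"
  assumes refl: "\<And>M. M \<in> A \<Longrightarrow> I M M"
    and IE: "\<And>M N. M \<in> A \<Longrightarrow> N \<in> A \<Longrightarrow> I M N \<Longrightarrow> E M N"
    and sym: "\<And>M N. M \<in> A \<Longrightarrow> N \<in> A \<Longrightarrow> E M N \<Longrightarrow> E N M"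
    and trans: "\<And>M N L. M \<in> A \<Longrightarrow> N \<in> A \<Longrightarrow> L \<in> A \<Longrightarrow> E M N \<Longrightarrow> E N L \<Longrightarrow> E M L"
  shows "\<exists>rep. \<forall>D\<in>P // s. rep D \<in> A \<and> (\<forall>D'\<in>P // s. E (rep D) (rep D') \<longrightarrow> D = D')"
proof -
  let ?r = "{(M, N). M \<in> A \<and> N \<in> A \<and> I M N}"
  have sub: "c \<subseteq> A" if "c \<in> P" for c using that unfolding P_def by (auto elim!: quotientE)
  have rel: "E M N" if "c \<in> P" "M \<in> c" "N \<in> c" for c M N
  proof -
    obtain L where L: "L \<in> A" "c = ?r `` {L}" using \<open>c \<in> P\<close> unfolding P_def by (rule quotientE)
    then have "M \<in> A" "N \<in> A" "E L M" "E L N" using that IE by auto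
    then show ?thesis using sym[of L M] trans[of M L N] L(1) by blast
  qed
  have ne: "\<exists>M. M \<in> c" if "c \<in> P" for c
  proof -
    obtain L where "L \<in> A" "c = ?r `` {L}" using \<open>c \<in> P\<close> unfolding P_def by (rule quotientE)
    then have "L \<in> c" using refl by simp
    then show ?thesis ..
  qed
  have "\<forall>D\<in>P // s. \<exists>M. \<exists>c\<in>P. M \<in> c \<and> D = s `` {c}"
  proof
    fix D assume "D \<in> P // s"
    then obtain c where "c \<in> P" "D = s `` {c}" by (rule quotientE)
    then show "\<exists>M. \<exists>c\<in>P. M \<in> c \<and> D = s `` {c}" using ne by blast
  qed
  then obtain rep where rep: "\<And>D. D \<in> P // s \<Longrightarrow> \<exists>c\<in>P. rep D \<in> c \<and> D = s `` {c}"
    by metis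
  have "D = D'" if D: "D \<in> P // s" "D' \<in> P // s" and e: "E (rep D) (rep D')" for D D'
  proof -
    obtain c where c: "c \<in> P" "rep D \<in> c" "D = s `` {c}" using rep[OF D(1)] by blast
    obtain c' where c': "c' \<in> P" "rep D' \<in> c'" "D' = s `` {c'}" using rep[OF D(2)] by blast
    have *: "(c1, d) \<in> s \<longleftrightarrow> d \<in> P \<and> (\<exists>N\<in>d. E M N)" if "c1 \<in> P" "M \<in> c1" for c1 d M
    proof
      assume "(c1, d) \<in> s"
      then obtain L N where L: "d \<in> P" "L \<in> c1" "N \<in> d" "E L N" unfolding s_def by blast
      have "E M N" using trans[of M L N] rel[OF that(1,2) L(2)] sub[OF that(1)] sub[OF L(1)] L that(2) by blast
      then show "d \<in> P \<and> (\<exists>N\<in>d. E M N)" using L by blast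
    qed (use that in \<open>auto simp: s_def\<close>)
    have mem: "rep D \<in> A" "rep D' \<in> A" using c c' sub by auto
    have "(c, d) \<in> s \<longleftrightarrow> (c', d) \<in> s" for d
    proof -
      have "E (rep D) N \<longleftrightarrow> E (rep D') N" if "d \<in> P" "N \<in> d" for N
        using trans[OF mem, of N] trans[OF mem(2,1), of N] sym[OF mem e] e sub[OF that(1)] that(2) by blast
      then show ?thesis using *[OF c(1,2), of d] *[OF c'(1,2), of d] by blast
    qed
    then show ?thesis unfolding c(3) c'(3) by blast
  qed
  moreover have "rep D \<in> A" if "D \<in> P // s" for D using rep[OF that] sub by blast
  ultimately show ?thesis by blast
qed

lemma iso_class_mem:
  "N \<in> A \<Longrightarrow> {(M, N). M \<in> A \<and> N \<in> A \<and> homogeneous_iso R M N} `` {N} \<in> iso_classes R A"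
  unfolding iso_classes_def by (rule quotientI)

lemma iso_class_eq:
  assumes "M \<in> A" "N \<in> A"
    and "{(M, N). M \<in> A \<and> N \<in> A \<and> homogeneous_iso R M N} `` {M} =
      {(M, N). M \<in> A \<and> N \<in> A \<and> homogeneous_iso R M N} `` {N}"
  shows "homogeneous_iso R M N"
proof -
  have "N \<in> {(M, N). M \<in> A \<and> N \<in> A \<and> homogeneous_iso R M N} `` {N}"
    using assms(2) homogeneous_iso_refl by simp
  then show ?thesis unfolding assms(3)[symmetric] by simp
qed

lemma point_module_iso_sym:
  assumes "point_module K \<kappa> C Cn M" "point_module K \<kappa> C Cn N" "homogeneous_iso C M N"
  shows "homogeneous_iso C N M"
proof -
  obtain M1 M2 N1 N2 where [simp]: "M = (M1, M2)" "N = (N1, N2)" by (metis surj_pair)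
  show ?thesis
    using assms homogeneous_iso_sym[of C M1 M2 N1 N2] left_module_group[of C N1]
    by (simp add: point_module_def graded_module_def)
qed

theorem theorem2p7:
  fixes B :: "'u ring" and Bn :: "nat \<Rightarrow> 'u set"
    and PB :: "('u, 'm) gmod set set"
    and sim :: "(('u, 'm) gmod set \<times> ('u, 'm) gmod set) set"
  defines "PB \<equiv> sg_point_classes B Bn"
    and "sim \<equiv> gr_equiv B Bn"
  assumes FSG: "finitely_semi_graded_ring B Bn"
    and deg1: "generated_in_degree_one B Bn"
    and K_field: "field (base_ring B Bn)"
    and K_algebra: "\<forall>k\<in>Bn 0. \<forall>b\<in>carrier B. k \<otimes>\<^bsub>B\<^esub> b = b \<otimes>\<^bsub>B\<^esub> k"
  shows "(\<exists>\<alpha>. inj_on \<alpha> (PB // sim) \<and>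
            \<alpha> ` (PB // sim) \<subseteq> point_classes (base_ring B Bn) (gr_unit B Bn) (gr_ring B Bn) (gr_comp B Bn)) \<and>
         (\<forall>(X :: ('x, 'o) ringed_space) \<pi>.
            K_scheme (base_ring B Bn) X \<pi> \<and>
            parametrizes (base_ring B Bn) X \<pi> (gr_unit B Bn) (gr_ring B Bn) (gr_comp B Bn) \<longrightarrow>
            (\<exists>\<alpha>'. inj_on \<alpha>' (PB // sim) \<and> \<alpha>' ` (PB // sim) \<subseteq> closed_points X))"
proof -
  have sgB: "semi_graded_ring B Bn" using FSG by (simp add: finitely_semi_graded_ring_def)
  interpret R: semi_graded_pair B Bn "regular_module B" Bn using semi_graded_pair_regular[OF sgB] .
  define K where "K = base_ring B Bn"
  define \<kappa> where "\<kappa> = gr_unit B Bn"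
  define C where "C = gr_ring B Bn"
  define Cn where "Cn = gr_comp B Bn"
  have field: "field K" unfolding K_def by (rule K_field)
  interpret K: field_spectrum K using field by (simp add: field_spectrum_def)
  have \<kappa>: "\<kappa> \<in> ring_hom K C" unfolding \<kappa>_def K_def C_def by (rule R.gr_unit_hom)
  have \<kappa>0: "\<kappa> ` carrier K \<subseteq> Cn 0" unfolding \<kappa>_def K_def Cn_def by (rule R.gr_unit_comp)
  have CnC: "Cn n \<subseteq> carrier C" for n unfolding Cn_def C_def by (rule R.gr_comp_B_carrier)
  interpret T: central_algebra K \<kappa> C
  proof (rule central_algebra.intro)
    show "cring K" by (rule K.is_cring)
    show "ring C" unfolding C_def by (rule R.GB_ring)
    show "\<kappa> \<in> ring_hom K C" by (rule \<kappa>)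
    show "\<kappa> k \<otimes>\<^bsub>C\<^esub> c = c \<otimes>\<^bsub>C\<^esub> \<kappa> k" if "k \<in> carrier K" "c \<in> carrier C" for k c
      using R.gr_unit_central[OF K_algebra] that unfolding K_def C_def \<kappa>_def by simp
  qed
  let ?A = "{M :: ('u, 'm) gmod. sg_point_module B Bn M}"
  define E where "E M N \<longleftrightarrow> homogeneous_iso C (gr_module M) (gr_module N)" for M N :: "('u, 'm) gmod"
  have gr_pm: "point_module K \<kappa> C Cn (gr_module M)" if MA: "M \<in> ?A" for M
  proof -
    obtain M1 Mn where M: "M = (M1, Mn)" by (metis surj_pair)
    have "sg_point_module B Bn (M1, Mn)" using MA unfolding M by simp
    from sg_point_module_cyclic_rank_one[OF this sgB K_field deg1]
    obtain x where "cyclic_rank_one_pair B Bn M1 Mn x" ..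
    from cyclic_rank_one_pair.gr_point_module[OF this]
    show ?thesis unfolding M K_def \<kappa>_def C_def Cn_def .
  qed
  have IE: "E M N" if "M \<in> ?A" "N \<in> ?A" "homogeneous_iso B M N" for M N
  proof -
    obtain M1 Mn N1 Nn where M: "M = (M1, Mn)" and N: "N = (N1, Nn)" by (metis surj_pair)
    have "semi_graded_pair B Bn M1 Mn" "semi_graded_pair B Bn N1 Nn"
      using that(1,2) sgB unfolding M N
      by (simp_all add: semi_graded_pair_def sg_point_module_def finitely_semi_graded_module_def)
    from gr_homogeneous_iso[OF this] that(3) show ?thesis unfolding E_def M N C_def by blast
  qed
  have Esym: "E N M" if "M \<in> ?A" "N \<in> ?A" "E M N" for M N
    using point_module_iso_sym[OF gr_pm[OF that(1)] gr_pm[OF that(2)]] that(3) unfolding E_def .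
  have Etrans: "E M L" if "E M N" "E N L" for M N L
    using homogeneous_iso_trans that unfolding E_def .
  have PB: "PB = ?A // {(M, N). M \<in> ?A \<and> N \<in> ?A \<and> homogeneous_iso B M N}"
    by (simp add: PB_def sg_point_classes_def iso_classes_def)
  have sim: "sim = {(c, c'). c \<in> PB \<and> c' \<in> PB \<and> (\<exists>M\<in>c. \<exists>M'\<in>c'. E M M')}"
    by (simp add: sim_def gr_equiv_def PB_def E_def C_def)
  have "\<exists>rep. \<forall>D\<in>PB // sim. rep D \<in> ?A \<and> (\<forall>D'\<in>PB // sim. E (rep D) (rep D') \<longrightarrow> D = D')"
    unfolding sim PB
    by (rule quotient_representatives)
      (rule homogeneous_iso_refl, erule (2) IE, erule (2) Esym, erule (1) Etrans)
  then obtain rep where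
    rep_all: "\<forall>D\<in>PB // sim. rep D \<in> ?A \<and> (\<forall>D'\<in>PB // sim. E (rep D) (rep D') \<longrightarrow> D = D')" ..
  have rep: "rep D \<in> ?A" if "D \<in> PB // sim" for D 
    using rep_all[THEN bspec, OF that] by (rule conjunct1)
  have rep_eq: "D = D'" if "D \<in> PB // sim" "D' \<in> PB // sim" "E (rep D) (rep D')" for D D'
    using rep_all[THEN bspec, OF that(1), THEN conjunct2, THEN bspec, OF that(2)] that(3) by (rule mp)
  have embed: "\<exists>N :: (_, 't) gmod. point_module K \<kappa> C Cn N \<and> homogeneous_iso C (gr_module M) N"
    if "M \<in> ?A" "inj_on \<iota> (carrier C)" for M and \<iota> :: "_ \<Rightarrow> 't"
  proof -
    obtain G Gn where G: "gr_module M = (G, Gn)" by (metis surj_pair)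
    show ?thesis
      using point_module_in_type[OF gr_pm[OF that(1), unfolded G] that(2) K.ring_axioms \<kappa> \<kappa>0 CnC] unfolding G .
  qed
  have reflect: "E M M'"
    if M: "M \<in> ?A" "M' \<in> ?A" and N: "point_module K \<kappa> C Cn N" "point_module K \<kappa> C Cn N'"
      and i: "homogeneous_iso C (gr_module M) N" "homogeneous_iso C (gr_module M') N'" "homogeneous_iso C N N'"
    for M M' and N N' :: "(_, 't) gmod"
    using homogeneous_iso_trans[OF homogeneous_iso_trans[OF i(1,3)]
        point_module_iso_sym[OF gr_pm[OF M(2)] N(2) i(2)]] unfolding E_def .
  show ?thesis unfolding K_def[symmetric] \<kappa>_def[symmetric] C_def[symmetric] Cn_def[symmetric]
  proof (intro conjI allI impI)
    show "\<exists>\<alpha>. inj_on \<alpha> (PB // sim) \<and> \<alpha> ` (PB // sim) \<subseteq> point_classes K \<kappa> C Cn"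
    proof -
      let ?P = "{N :: (_, nat \<Rightarrow> 'u set) gmod. point_module K \<kappa> C Cn N}"
      let ?r = "{(M, N). M \<in> ?P \<and> N \<in> ?P \<and> homogeneous_iso C M N}"
      have "\<forall>D\<in>PB // sim. \<exists>N. N \<in> ?P \<and> homogeneous_iso C (gr_module (rep D)) N"
        using embed[OF rep, of _ id] by simp
      then obtain F where F: "\<And>D. D \<in> PB // sim \<Longrightarrow> F D \<in> ?P \<and> homogeneous_iso C (gr_module (rep D)) (F D)"
        by metis
      show ?thesis
      proof (intro exI[of _ "\<lambda>D. ?r `` {F D}"] conjI)
        show "inj_on (\<lambda>D. ?r `` {F D}) (PB // sim)"
        proof (rule inj_onI)
          fix D D' assume D: "D \<in> PB // sim" "D' \<in> PB // sim" and e: "?r `` {F D} = ?r `` {F D'}"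
          have "homogeneous_iso C (F D) (F D')" using iso_class_eq[OF _ _ e] F[OF D(1)] F[OF D(2)] by blast
          then have "E (rep D) (rep D')" using reflect[OF rep[OF D(1)] rep[OF D(2)]] F[OF D(1)] F[OF D(2)] by blast
          then show "D = D'" by (rule rep_eq[OF D])
        qed
        show "(\<lambda>D. ?r `` {F D}) ` (PB // sim) \<subseteq> point_classes K \<kappa> C Cn"
        proof
          fix c assume "c \<in> (\<lambda>D. ?r `` {F D}) ` (PB // sim)"
          then obtain D where D: "D \<in> PB // sim" "c = ?r `` {F D}" by blast
          have "F D \<in> ?P" using F[OF D(1)] by blast
          from iso_class_mem[OF this] show "c \<in> point_classes K \<kappa> C Cn" unfolding D(2) point_classes_def .
        qed
      qed
    qed
  next
    fix X :: "('x, 'o) ringed_space" and \<pi>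
    assume "K_scheme K X \<pi> \<and> parametrizes K X \<pi> \<kappa> C Cn"
    then have sch: "scheme X" and str: "lrs_morphism X (Spec K) \<pi>" and par: "parametrizes K X \<pi> \<kappa> C Cn"
      by (auto simp: K_scheme_def)
    obtain p ps where \<pi>: "\<pi> = (p, ps)" by (metis surj_pair)
    interpret X: scheme_over_field K X p ps
      using sch str unfolding \<pi>
      by (simp add: scheme_over_field_def scheme_over_field_axioms_def local_space_def scheme_def K.field_spectrum_axioms)
    \<comment> \<open>The bijection of functors is evaluated at the test algebra \<open>K\<close>.\<close>
    let ?S = "(K, id)"
    have S: "comm_algebra K ?S"
      using K.is_cring by (auto simp: comm_algebra_def intro!: ring_hom_memI)
    have "\<exists>\<eta>. bij_betw \<eta> (S_point_classes K \<kappa> C Cn ?S) (functor_of_points K X \<pi> ?S)"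
      using par[unfolded parametrizes_def] S by (elim exE conjE) (drule spec[of _ ?S], rule exI, erule mp)
    then obtain \<eta> where \<eta>: "bij_betw \<eta> (S_point_classes K \<kappa> C Cn ?S) (functor_of_points K X \<pi> ?S)" ..
    have subg: "subgroup (Cn n) (add_monoid C)" for n
      using R.gr_comp_subgroup[of n] unfolding Cn_def C_def
      by (simp add: subgroup_def m_inv_def gr_ring_as_module gr_comp_def gr_carrier_regular_module filt_regular_module)
    have degC: "\<kappa> k \<otimes>\<^bsub>C\<^esub> c \<in> Cn n" if "k \<in> carrier K" "c \<in> Cn n" for k c n
      using R.gr_comp_mult[of "\<kappa> k" 0 c n] \<kappa>0 that unfolding Cn_def C_def
      by (simp add: gr_ring_as_module gr_comp_def gr_carrier_regular_module filt_regular_module image_subset_iff)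
    define P :: "(('u, nat \<Rightarrow> 'u set) tens, ('u, nat \<Rightarrow> 'u set) tens) gmod set"
      where "P = {N. S_point_module K \<kappa> C Cn K id N}"
    define r where "r = {(M, N). M \<in> P \<and> N \<in> P \<and> homogeneous_iso T.TA M N}"
    have "\<forall>D\<in>PB // sim. \<exists>N :: (_, ('u, nat \<Rightarrow> 'u set) tens) gmod.
        point_module K \<kappa> C Cn N \<and> homogeneous_iso C (gr_module (rep D)) N"
      using embed[OF rep T.fib_inj] by blast
    then obtain F :: "_ \<Rightarrow> (_, ('u, nat \<Rightarrow> 'u set) tens) gmod"
      where F: "\<And>D. D \<in> PB // sim \<Longrightarrow> point_module K \<kappa> C Cn (F D) \<and> homogeneous_iso C (gr_module (rep D)) (F D)"
      by metis
    \<comment> \<open>\<open>F D\<close> regarded as a module over \<open>K \<otimes> C = C\<close>\<close>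
    define F' where "F' D = (restrict_scalars T.unfib (fst (F D)), snd (F D))" for D
    have F': "F' D \<in> P" if "D \<in> PB // sim" for D
      unfolding F'_def P_def mem_Collect_eq
      by (rule T.S_point_module_of_point_module[of Cn, OF _ subg \<kappa>0 degC]) (simp add: F[OF that])
    define g where "g D = \<eta> (r `` {F' D})" for D
    have cls: "r `` {F' D} \<in> S_point_classes K \<kappa> C Cn ?S" if "D \<in> PB // sim" for D
      using iso_class_mem[OF F'[OF that], of T.TA] unfolding S_point_classes_def split_conv r_def[symmetric]
        P_def[symmetric] .
    have g: "g D \<in> functor_of_points K X (p, ps) ?S" if "D \<in> PB // sim" for D
      using bij_betwE[OF \<eta>] cls[OF that] unfolding g_def \<pi> by blast
    show "\<exists>\<alpha>'. inj_on \<alpha>' (PB // sim) \<and> \<alpha>' ` (PB // sim) \<subseteq> closed_points X"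
    proof (intro exI[of _ "\<lambda>D. fst (g D) K.pt"] conjI)
      show "inj_on (\<lambda>D. fst (g D) K.pt) (PB // sim)"
      proof (rule inj_onI)
        fix D D' assume D: "D \<in> PB // sim" "D' \<in> PB // sim" and e: "fst (g D) K.pt = fst (g D') K.pt"
        have "g D = g D'" using X.rational_point_determined[OF g[OF D(1)] g[OF D(2)] e] .
        then have "\<eta> (r `` {F' D}) = \<eta> (r `` {F' D'})" unfolding g_def .
        from inj_onD[OF bij_betw_imp_inj_on[OF \<eta>] this cls[OF D(1)] cls[OF D(2)]]
        have "r `` {F' D} = r `` {F' D'}" .
        from iso_class_eq[OF F'[OF D(1)] F'[OF D(2)] this[unfolded r_def]]
        have "homogeneous_iso C (fst (F D), snd (F D)) (fst (F D'), snd (F D'))"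
          unfolding F'_def by (rule T.homogeneous_iso_unfib)
        then have "homogeneous_iso C (F D) (F D')" by simp
        then have "E (rep D) (rep D')" using reflect[OF rep[OF D(1)] rep[OF D(2)]] F[OF D(1)] F[OF D(2)] by blast
        then show "D = D'" by (rule rep_eq[OF D])
      qed
      show "(\<lambda>D. fst (g D) K.pt) ` (PB // sim) \<subseteq> closed_points X"
        using X.rational_point_closed[OF g sch] by blast
    qed
  qed
qed

end
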